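(* Let $d\ge1$, $T>0$, $0<s<1$, $u_0\in\mathcal E'(\mathbb R^d)$, and let $a,b,c\in\mathcal D'(\mathbb R^d)$ be strictly positive in the sense of distributions: there are constants $a_0,b_0,c_0>0$ with $\langle a-a_0,\varphi\rangle\ge0$, $\langle b-b_0,\varphi\rangle\ge0$, $\langle c-c_0,\varphi\rangle\ge0$ for every $\varphi\in\mathcal D(\mathbb R^d)$ with $\varphi\ge0$. Fix a scale $\omega:(0,1]\to(0,1]$ with $\omega(\varepsilon)\to0$ as $\varepsilon\to0^+$. Let $(a_\varepsilon,b_\varepsilon,c_\varepsilon)_\varepsilon$ and $(\widetilde a_\varepsilon,\widetilde b_\varepsilon,\widetilde c_\varepsilon)_\varepsilon$ be two $L^\infty(\mathbb R^d)$-moderate regularisations of $(a,b,c)$ such that $(a_\varepsilon-\widetilde a_\varepsilon)_\varepsilon$, $(b_\varepsilon-\widetilde b_\varepsilon)_\varepsilon$, $(c_\varepsilon-\widetilde c_\varepsilon)_\varepsilon$ are negligible in $L^\infty(\mathbb R^d)$. Let $(u_{0,\varepsilon})_\varepsilon$ and $(\widetilde u_{0,\varepsilon})_\varepsilon$ be two $H^1(\mathbb R^d)$-moderate regularisations of $u_0$ such that $(u_{0,\varepsilon}-\widetilde u_{0,\varepsilon})_\varepsilon$ is negligible in $H^1(\mathbb R^d)$. Assume furthermore that \[ a_\varepsilon\ge a_0,\quad b_\varepsilon\ge b_0,\quad c_\varepsilon\ge c_0,\qquad \widetilde a_\varepsilon\ge a_0,\quad \widetilde b_\varepsilon\ge b_0,\quad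 \widetilde c_\varepsilon\ge c_0 \] (a.e. on $\mathbb R^d$) for every $\varepsilon\in(0,1]$. For each $\varepsilon$, let $u_\varepsilon$ be the unique weak solution of \[ \partial_tu_\varepsilon-\nabla\cdot(a_\varepsilon\nabla u_\varepsilon)+(-\Delta)^{s/2}\bigl(b_\varepsilon(-\Delta)^{s/2}u_\varepsilon\bigr)+c_\varepsilon u_\varepsilon=0\ \text{ in }(0,T)\times\mathbb R^d,\qquad u_\varepsilon(0,\cdot)=u_{0,\varepsilon}, \] and let $\widetilde u_\varepsilon$ be the unique weak solution of the same problem with $a_\varepsilon,b_\varepsilon,c_\varepsilon,u_{0,\varepsilon}$ replaced by $\widetilde a_\varepsilon,\widetilde b_\varepsilon,\widetilde c_\varepsilon,\widetilde u_{0,\varepsilon}$. If both nets $(u_\varepsilon)_\varepsilon$ and $(\widetilde u_\varepsilon)_\varepsilon$ are $L^\infty(0,T;H^1(\mathbb R^d))$-moderate, then $(u_\varepsilon-\widetilde u_\varepsilon)_\varepsilon$ is negligible in \[ L^\infty(0,T;L^2(\mathbb R^d))\cap L^2(0,T;H^1(\mathbb R^d)). \]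
   Context: $\mathcal D'(\mathbb R^d)$ denotes distributions, $\mathcal E'(\mathbb R^d)$ compactly supported distributions; coefficients are real-valued. $(-\Delta)^{s/2}$ is the Fourier multiplier with symbol $|\xi|^s$. Moderate and negligible nets (with respect to the fixed scale $\omega$): let $X$ be a Banach space. A net $(g_\varepsilon)_{\varepsilon\in(0,1]}\subset X$ is $X$-moderate if there are $C>0$, $N\in\mathbb N_0$ with $\|g_\varepsilon\|_X\le C\,\omega(\varepsilon)^{-N}$ for all $\varepsilon\in(0,1]$. It is $X$-negligible (negligible in $X$) if for every $q\in\mathbb N$ there is $C_q>0$ with $\|g_\varepsilon\|_X\le C_q\,\omega(\varepsilon)^{q}$ for all $\varepsilon\in(0,1]$. The intersection space carries the sum of the two norms. Regularisation: an $L^\infty(\mathbb R^d)$-moderate (resp. $H^1(\mathbb R^d)$-moderate) regularisation of a distribution $g$ is an $L^\infty(\mathbb R^d)$-moderate (resp. $H^1(\mathbb R^d)$-moderate) net $(g_\varepsilon)_{\varepsilon\in(0,1]}$ with $g_\varepsilon\to g$ in $\mathcal D'(\mathbb R^d)$ as $\varepsilon\to0$; a regularisation of a triple is a triple of regularisations. Weak solution: for $\alpha,\beta,\gamma\in L^\infty(\mathbb R^d)$ bounded below by positive constants and $v_0\in H^1(\mathbb R^d)$, a weak solution of $v_t-\nabla\cdot(\alpha\nabla v)+(-\Delta)^{s/2}(\beta(-\Delta)^{s/2}v)+\gamma v=0$, $v(0)=v_0$, is a function $v\in L^2(0,T;H^1(\mathbb R^d))$ with $v_t\in L^2(0,T;(H^1(\mathbb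 R^d))')$, $v(0)=v_0$ in $L^2(\mathbb R^d)$ (using the representative in $C([0,T];L^2)$), such that for a.e. $t\in(0,T)$ and all $\varphi\in H^1(\mathbb R^d)$ \[ \langle v_t,\varphi\rangle+\int\alpha\nabla v\cdot\overline{\nabla\varphi}\,dx+\int\beta(-\Delta)^{s/2}v\,\overline{(-\Delta)^{s/2}\varphi}\,dx+\int\gamma v\overline{\varphi}\,dx=0, \] where $\langle\cdot,\cdot\rangle$ is the $(H^1)'$–$H^1$ pairing extending $(f,g)_{L^2}=\int f\overline g\,dx$. Such a weak solution exists and is unique. *)

theory Defs
  imports "HOL-Analysis.Analysis" "HOL-Probability.Essential_Supremum"
begin

text \<open>
  Elements of Lebesgue, Sobolev and Bochner spaces are represented by functions; two functions
  that agree almost everywhere are different representatives of the same element, and all norms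
  below are blind to that difference. The space R^d is an arbitrary type of class
  \<open>euclidean_space\<close> (so d >= 1), and its coordinate directions are the elements of \<open>Basis\<close>.
\<close>


section \<open>Test functions and distributions\<close>

primrec iter_partial :: "'a::real_normed_vector list \<Rightarrow> ('a \<Rightarrow> 'b::real_normed_vector) \<Rightarrow> 'a \<Rightarrow> 'b" where
  "iter_partial [] f = f"
| "iter_partial (i # is) f = (\<lambda>x. frechet_derivative (iter_partial is f) (at x) i)"

definition smooth :: "('a::euclidean_space \<Rightarrow> 'b::real_normed_vector) \<Rightarrow> bool" where
  "smooth f \<longleftrightarrow> (\<forall>is. set is \<subseteq> Basis \<longrightarrow> iter_partial is f differentiable_on UNIV)"

text \<open>Smooth functions whose support is compact and contained in \<open>A\<close>.\<close>

definition test_functions :: "'a::euclidean_space set \<Rightarrow> ('a \<Rightarrow> 'b::real_normed_vector) set" where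
  "test_functions A =
     {\<phi>. smooth \<phi> \<and> compact (closure {x. \<phi> x \<noteq> 0}) \<and> closure {x. \<phi> x \<noteq> 0} \<subseteq> A}"

text \<open>
  Distributions over the scalar field \<open>'k\<close>, acting linearly (not antilinearly) on \<open>'k\<close>-valued test
  functions. Real distributions (\<open>'k = real\<close>) are the complex ones that are real on real test
  functions. The values of the functional off the test functions are irrelevant.
\<close>

definition distribution :: "(('a::euclidean_space \<Rightarrow> 'k::real_normed_field) \<Rightarrow> 'k) \<Rightarrow> bool" where
  "distribution u \<longleftrightarrow>
     (\<forall>\<phi>\<in>test_functions UNIV. \<forall>\<psi>\<in>test_functions UNIV. u (\<lambda>x. \<phi> x + \<psi> x) = u \<phi> + u \<psi>) \<and>
     (\<forall>\<phi>\<in>test_functions UNIV. \<forall>c. u (\<lambda>x. c * \<phi> x) = c * u \<phi>) \<and>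
     (\<forall>K. compact K \<longrightarrow> (\<exists>C m. \<forall>\<phi>\<in>test_functions K.
        norm (u \<phi>) \<le> C * (\<Sum>is | set is \<subseteq> Basis \<and> length is \<le> m. SUP x. norm (iter_partial is \<phi> x))))"

definition compactly_supported_distribution ::
    "(('a::euclidean_space \<Rightarrow> 'k::real_normed_field) \<Rightarrow> 'k) \<Rightarrow> bool" where
  "compactly_supported_distribution u \<longleftrightarrow>
     distribution u \<and> (\<exists>K. compact K \<and> (\<forall>\<phi>\<in>test_functions (- K). u \<phi> = 0))"

text \<open>\<open>u - k \<ge> 0\<close> in the sense of distributions, for a constant \<open>k\<close>.\<close>

definition distr_ge :: "(('a::euclidean_space \<Rightarrow> real) \<Rightarrow> real) \<Rightarrow> real \<Rightarrow> bool" where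
  "distr_ge u k \<longleftrightarrow>
     (\<forall>\<phi>\<in>test_functions UNIV. (\<forall>x. \<phi> x \<ge> 0) \<longrightarrow> u \<phi> - k * (LINT x|lborel. \<phi> x) \<ge> 0)"


section \<open>Normed spaces of functions\<close>

text \<open>
  A normed space given by the set of (representatives of) its elements and its norm. The norm is
  only meaningful on \<open>elts\<close>, and is zero exactly for the representatives of the zero element.
\<close>

record 'v nspace =
  elts :: "'v set"
  nrm :: "'v \<Rightarrow> real"

definition inter_space :: "'v nspace \<Rightarrow> 'v nspace \<Rightarrow> 'v nspace" where
  "inter_space X Y = \<lparr>elts = elts X \<inter> elts Y, nrm = (\<lambda>v. nrm X v + nrm Y v)\<rparr>"

definition L2 :: "('a::euclidean_space \<Rightarrow> 'b::{banach, second_countable_topology}) nspace" where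
  "L2 = \<lparr>elts = {f. f \<in> borel_measurable lborel \<and> integrable lborel (\<lambda>x. (norm (f x))\<^sup>2)},
         nrm = (\<lambda>f. sqrt (LINT x|lborel. (norm (f x))\<^sup>2))\<rparr>"

definition Linf :: "('a::euclidean_space \<Rightarrow> 'b::{banach, second_countable_topology}) nspace" where
  "Linf = \<lparr>elts = {f. f \<in> borel_measurable lborel \<and> (\<exists>C. AE x in lborel. norm (f x) \<le> C)},
           nrm = (\<lambda>f. real_of_ereal (esssup lborel (\<lambda>x. ereal (norm (f x)))))\<rparr>"

definition L2_inner :: "('a::euclidean_space \<Rightarrow> complex) \<Rightarrow> ('a \<Rightarrow> complex) \<Rightarrow> complex" where
  "L2_inner f g = (LINT x|lborel. f x * cnj (g x))"

definition has_weak_partial ::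
    "'a::euclidean_space \<Rightarrow> ('a \<Rightarrow> complex) \<Rightarrow> ('a \<Rightarrow> complex) \<Rightarrow> bool" where
  "has_weak_partial i f g \<longleftrightarrow>
     (\<forall>\<phi>\<in>test_functions UNIV.
        (LINT x|lborel. f x * frechet_derivative \<phi> (at x) i) = - (LINT x|lborel. g x * \<phi> x))"

text \<open>A representative of the weak partial derivative in L^2, if there is one.\<close>

definition weak_partial :: "'a::euclidean_space \<Rightarrow> ('a \<Rightarrow> complex) \<Rightarrow> 'a \<Rightarrow> complex" where
  "weak_partial i f = (SOME g. g \<in> elts L2 \<and> has_weak_partial i f g)"

definition H1 :: "('a::euclidean_space \<Rightarrow> complex) nspace" where
  "H1 = \<lparr>elts = {f \<in> elts L2. \<forall>i\<in>Basis. \<exists>g\<in>elts L2. has_weak_partial i f g},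
         nrm = (\<lambda>f. sqrt ((nrm L2 f)\<^sup>2 + (\<Sum>i\<in>Basis. (nrm L2 (weak_partial i f))\<^sup>2)))\<rparr>"

text \<open>
  The dual, realised by bounded antilinear functionals: in the pairing extending
  \<open>\<integral> f * cnj g\<close> the second argument enters antilinearly. Boundedness makes such a functional
  independent of the representative.
\<close>

definition antidual :: "('a \<Rightarrow> complex) nspace \<Rightarrow> (('a \<Rightarrow> complex) \<Rightarrow> complex) nspace" where
  "antidual X =
     \<lparr>elts = {F. (\<forall>\<phi>\<in>elts X. \<forall>\<psi>\<in>elts X. F (\<lambda>x. \<phi> x + \<psi> x) = F \<phi> + F \<psi>) \<and>
                 (\<forall>\<phi>\<in>elts X. \<forall>c. F (\<lambda>x. c * \<phi> x) = cnj c * F \<phi>) \<and>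
                 (\<exists>C. \<forall>\<phi>\<in>elts X. cmod (F \<phi>) \<le> C * nrm X \<phi>)},
      nrm = (\<lambda>F. SUP \<phi>\<in>{\<phi> \<in> elts X. nrm X \<phi> \<le> 1}. cmod (F \<phi>))\<rparr>"


section \<open>The fractional Laplacian\<close>

text \<open>
  The Fourier-Plancherel transform on L^2, normalised as the integral of
  \<open>exp (- \<i> x \<bullet> \<xi>) * f x\<close> (so that minus the Laplacian has symbol |xi|^2), and its inverse. Both are
  L^2-limits of the absolutely convergent integrals over balls.
\<close>

definition fourier_ball :: "real \<Rightarrow> ('a::euclidean_space \<Rightarrow> complex) \<Rightarrow> 'a \<Rightarrow> complex" where
  "fourier_ball R f \<xi> = (LINT x:cball 0 R|lborel. cis (- (x \<bullet> \<xi>)) * f x)"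

definition inv_fourier_ball :: "real \<Rightarrow> ('a::euclidean_space \<Rightarrow> complex) \<Rightarrow> 'a \<Rightarrow> complex" where
  "inv_fourier_ball R f x =
     (LINT \<xi>:cball 0 R|lborel. cis (x \<bullet> \<xi>) * f \<xi>) / of_real ((2 * pi) ^ DIM('a))"

definition fourier_L2 :: "('a::euclidean_space \<Rightarrow> complex) \<Rightarrow> 'a \<Rightarrow> complex" where
  "fourier_L2 f =
     (SOME F. F \<in> elts L2 \<and> ((\<lambda>R. nrm L2 (fourier_ball R f - F)) \<longlongrightarrow> 0) at_top)"

definition inv_fourier_L2 :: "('a::euclidean_space \<Rightarrow> complex) \<Rightarrow> 'a \<Rightarrow> complex" where
  "inv_fourier_L2 f =
     (SOME F. F \<in> elts L2 \<and> ((\<lambda>R. nrm L2 (inv_fourier_ball R f - F)) \<longlongrightarrow> 0) at_top)"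

text \<open>\<open>frac_laplacian s\<close> is \<open>(-\<Delta>)\<close> to the power \<open>s/2\<close>, with symbol |xi|^s; it is only used on
  H^1 with \<open>0 < s < 1\<close>, where the multiplied transform is again in L^2.\<close>

definition frac_laplacian :: "real \<Rightarrow> ('a::euclidean_space \<Rightarrow> complex) \<Rightarrow> 'a \<Rightarrow> complex" where
  "frac_laplacian s f = inv_fourier_L2 (\<lambda>\<xi>. of_real (norm \<xi> powr s) * fourier_L2 f \<xi>)"


section \<open>Bochner spaces on the time interval (0,T)\<close>

text \<open>Strong (Bochner) measurability: almost everywhere the limit of simple functions.\<close>

definition strongly_measurable :: "'t measure \<Rightarrow> 'v::minus nspace \<Rightarrow> ('t \<Rightarrow> 'v) \<Rightarrow> bool" where
  "strongly_measurable M X v \<longleftrightarrow>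
     (\<exists>\<sigma> :: nat \<Rightarrow> 't \<Rightarrow> 'v.
        (\<forall>n. simple_function M (\<sigma> n) \<and> \<sigma> n ` space M \<subseteq> elts X) \<and>
        (AE t in M. v t \<in> elts X \<and> (\<lambda>n. nrm X (\<sigma> n t - v t)) \<longlonglongrightarrow> 0))"

definition L2_time :: "real \<Rightarrow> 'v::minus nspace \<Rightarrow> (real \<Rightarrow> 'v) nspace" where
  "L2_time T X =
     \<lparr>elts = {v. strongly_measurable (lebesgue_on {0<..<T}) X v \<and>
                 integrable (lebesgue_on {0<..<T}) (\<lambda>t. (nrm X (v t))\<^sup>2)},
      nrm = (\<lambda>v. sqrt (LINT t|lebesgue_on {0<..<T}. (nrm X (v t))\<^sup>2))\<rparr>"

definition Linf_time :: "real \<Rightarrow> 'v::minus nspace \<Rightarrow> (real \<Rightarrow> 'v) nspace" where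
  "Linf_time T X =
     \<lparr>elts = {v. strongly_measurable (lebesgue_on {0<..<T}) X v \<and>
                 (\<exists>C. AE t in lebesgue_on {0<..<T}. nrm X (v t) \<le> C)},
      nrm = (\<lambda>v. real_of_ereal (esssup (lebesgue_on {0<..<T}) (\<lambda>t. ereal (nrm X (v t)))))\<rparr>"


section \<open>Weak solutions\<close>

text \<open>
  \<open>w\<close> is the distributional derivative on (0,T) of \<open>v\<close>, where \<open>v t\<close> is embedded into the dual of
  H^1 as \<open>L2_inner (v t)\<close>. The identity between (H^1)'-valued integrals is evaluated at the
  elements \<open>\<phi>\<close> of H^1.
\<close>

definition has_weak_time_derivative ::
    "real \<Rightarrow> (real \<Rightarrow> 'a::euclidean_space \<Rightarrow> complex) \<Rightarrow> (real \<Rightarrow> ('a \<Rightarrow> complex) \<Rightarrow> complex) \<Rightarrow> bool" where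
  "has_weak_time_derivative T v w \<longleftrightarrow>
     (\<forall>\<eta> :: real \<Rightarrow> real. \<eta> \<in> test_functions {0<..<T} \<longrightarrow> (\<forall>\<phi>\<in>elts H1.
        (LINT t|lebesgue_on {0<..<T}. of_real (\<eta> t) * w t \<phi>) =
        - (LINT t|lebesgue_on {0<..<T}. of_real (deriv \<eta> t) * L2_inner (v t) \<phi>)))"

text \<open>\<open>v(0) = v0\<close> for the representative of \<open>v\<close> that is continuous from [0,T] into L^2.\<close>

definition has_initial_value ::
    "real \<Rightarrow> (real \<Rightarrow> 'a::euclidean_space \<Rightarrow> complex) \<Rightarrow> ('a \<Rightarrow> complex) \<Rightarrow> bool" where
  "has_initial_value T v v0 \<longleftrightarrow>
     (\<exists>V. (\<forall>t\<in>{0..T}. V t \<in> elts L2 \<and> ((\<lambda>r. nrm L2 (V r - V t)) \<longlongrightarrow> 0) (at t within {0..T})) \<and>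
          (AE t in lebesgue_on {0<..<T}. AE x in lborel. V t x = v t x) \<and>
          (AE x in lborel. V 0 x = v0 x))"

definition weak_solution ::
    "real \<Rightarrow> real \<Rightarrow> ('a::euclidean_space \<Rightarrow> real) \<Rightarrow> ('a \<Rightarrow> real) \<Rightarrow> ('a \<Rightarrow> real) \<Rightarrow> ('a \<Rightarrow> complex) \<Rightarrow>
     (real \<Rightarrow> 'a \<Rightarrow> complex) \<Rightarrow> bool" where
  "weak_solution T s \<alpha> \<beta> \<gamma> v0 v \<longleftrightarrow>
     v \<in> elts (L2_time T H1) \<and>
     has_initial_value T v v0 \<and>
     (\<exists>w. w \<in> elts (L2_time T (antidual H1)) \<and>
          has_weak_time_derivative T v w \<and>
          (AE t in lebesgue_on {0<..<T}. \<forall>\<phi>\<in>elts H1.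
             w t \<phi>
             + (\<Sum>i\<in>Basis. LINT x|lborel.
                  of_real (\<alpha> x) * weak_partial i (v t) x * cnj (weak_partial i \<phi> x))
             + (LINT x|lborel.
                  of_real (\<beta> x) * frac_laplacian s (v t) x * cnj (frac_laplacian s \<phi> x))
             + (LINT x|lborel. of_real (\<gamma> x) * v t x * cnj (\<phi> x)) = 0))"


section \<open>Moderate and negligible nets, regularisations\<close>

text \<open>Nets are indexed by (0,1]; values at other indices are irrelevant.\<close>

definition asymptotic_scale :: "(real \<Rightarrow> real) \<Rightarrow> bool" where
  "asymptotic_scale \<omega> \<longleftrightarrow> (\<forall>\<epsilon>\<in>{0<..1}. \<omega> \<epsilon> \<in> {0<..1}) \<and> (\<omega> \<longlongrightarrow> 0) (at_right 0)"

definition moderate :: "(real \<Rightarrow> real) \<Rightarrow> 'v nspace \<Rightarrow> (real \<Rightarrow> 'v) \<Rightarrow> bool" where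
  "moderate \<omega> X g \<longleftrightarrow>
     (\<forall>\<epsilon>\<in>{0<..1}. g \<epsilon> \<in> elts X) \<and>
     (\<exists>C>0. \<exists>N::nat. \<forall>\<epsilon>\<in>{0<..1}. nrm X (g \<epsilon>) \<le> C * \<omega> \<epsilon> powi (- int N))"

definition negligible_net :: "(real \<Rightarrow> real) \<Rightarrow> 'v nspace \<Rightarrow> (real \<Rightarrow> 'v) \<Rightarrow> bool" where
  "negligible_net \<omega> X g \<longleftrightarrow>
     (\<forall>\<epsilon>\<in>{0<..1}. g \<epsilon> \<in> elts X) \<and>
     (\<forall>q::nat. \<exists>C>0. \<forall>\<epsilon>\<in>{0<..1}. nrm X (g \<epsilon>) \<le> C * \<omega> \<epsilon> ^ q)"

definition moderate_regularisation ::
    "(real \<Rightarrow> real) \<Rightarrow> ('a::euclidean_space \<Rightarrow> 'k::{real_normed_field, banach, second_countable_topology}) nspace \<Rightarrow>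
     (('a \<Rightarrow> 'k) \<Rightarrow> 'k) \<Rightarrow> (real \<Rightarrow> 'a \<Rightarrow> 'k) \<Rightarrow> bool" where
  "moderate_regularisation \<omega> X u g \<longleftrightarrow>
     moderate \<omega> X g \<and>
     (\<forall>\<phi>\<in>test_functions UNIV. ((\<lambda>\<epsilon>. LINT x|lborel. g \<epsilon> x * \<phi> x) \<longlongrightarrow> u \<phi>) (at_right 0))"

end

theory Submission
  imports Defs "HOL-Real_Asymp.Real_Asymp" "HOL-Probability.Characteristic_Functions"
begin

(* The difference v of the two solutions solves the first equation with the right-hand side
   produced by a - a', b - b', c - c' acting on u'. Testing with v and using coercivity with
   m = min a0 c0 gives |v(t)|^2 + m int_0^t |v|_{H1}^2 <= |v(0)|^2 + C delta^2 / m int_0^T |u'|_{H1}^2,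
   where delta bounds the coefficient differences and C depends on the dimension only. As delta and
   |v(0)| are negligible and u' is moderate, the right-hand side is negligible.

   Two facts are needed for this: the fractional Laplacian is bounded from H1 to L2, and v may be
   used as a test function. The first requires of Plancherel's theorem only the inequality
   |F f|_2 <= (2 pi)^(d/2) |f|_2. For the second, only an inequality for the increments of |v(t)|^2
   is needed; it is obtained by summing the elementary estimate
   |v(t')|^2 - |v(t)|^2 <= 2 Re (v(t') - v(t), v(t')) over a fine grid. *)

section \<open>Smooth cut-off functions\<close>

text \<open>The coefficients may blow up with \<epsilon>, so the estimate must not see their size:
  the lower bounds enter the result, while the upper bound \<open>M\<close> occurs only in the error
  of replacing a test function and disappears in a limit. The obstacle to testing with
  \<open>v\<close> is that \<open>v\<close> moves in time, whereas the weak time derivative is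
  integrated against one fixed element of H1. Freezing the test function on a grid cell costs the H1
  distance between \<open>v\<close> at the grid point and \<open>v\<close> inside the cell, and
  \<open>v\<close> is merely square integrable in time, so its values on a prescribed grid are
  uncontrolled. Averaged over all translates of a grid, however, Riemann sums equal the integral;
  hence some translate behaves well, and it can also be chosen to avoid the null set where the
  equation fails. Weak derivatives and transforms are representatives picked by choice, so
  identities between them come from uniqueness almost everywhere, which requires a stock of concrete
  test functions. Constants depending only on the dimension are harmless and are not
  optimised.\<close>

definition cutoff :: "nat \<Rightarrow> real \<Rightarrow> real" where
  "cutoff k t = (if t > 0 then exp (- 1 / t) / t ^ k else 0)"

lemma cutoff_nonneg: "0 \<le> cutoff k t"
  by (simp add: cutoff_def)

text \<open>Differentiating exp (-1/t) / t^k gives the same expression with exponents k + 2 and k +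
  1. Keeping the exponent as a parameter closes the family under differentiation, so that all
  smoothness below rests on this one formula. At 0 the decay of the exponential beats every
  power.\<close>

lemma cutoff_has_real_derivative:
  "(cutoff k has_real_derivative (cutoff (k + 2) t - of_nat k * cutoff (k + 1) t)) (at t)"
proof -
  consider "t < 0" | "t = 0" | "t > 0" by linarith
  then show ?thesis
  proof cases
    case 1
    have "((\<lambda>_. 0) has_real_derivative 0) (at t)" by simp
    moreover have "eventually (\<lambda>x. 0 = cutoff k x) (nhds t)"
      using eventually_nhds_in_open[of "{..<0}" t] 1
      by (auto elim!: eventually_mono simp: cutoff_def)
    ultimately have "(cutoff k has_real_derivative 0) (at t)"
      using DERIV_cong_ev[of t t "\<lambda>_. 0" "cutoff k" 0 0] by simp
    then show ?thesis using 1 by (simp add: cutoff_def)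
  next
    case 2
    have "((\<lambda>h. (cutoff k (0 + h) - cutoff k 0) / h) \<longlongrightarrow> 0) (at 0)"
    proof (rule filterlim_split_at)
      have "eventually (\<lambda>h. (cutoff k (0 + h) - cutoff k 0) / h = 0) (at_left 0)"
        by (auto simp: eventually_at_filter cutoff_def)
      then show "((\<lambda>h. (cutoff k (0 + h) - cutoff k 0) / h) \<longlongrightarrow> 0) (at_left 0)"
        by (rule tendsto_eventually)
      \<comment> \<open>With y = 1/h this is y^(k+1) / exp y for y tending to infinity; the
        additional power of h comes from the difference quotient.\<close>
      have "((\<lambda>h::real. exp (- 1 / h) / h ^ Suc k) \<longlongrightarrow> 0) (at_right 0)"
      proof -
        have "((\<lambda>y::real. y ^ Suc k / exp y) \<longlongrightarrow> 0) at_top"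
          using tendsto_power_div_exp_0 by blast
        then have "((\<lambda>h::real. inverse h ^ Suc k / exp (inverse h)) \<longlongrightarrow> 0) (at_right 0)"
          by (rule filterlim_compose) (rule filterlim_inverse_at_top_right)
        then show ?thesis
          by (simp add: exp_minus divide_simps field_simps)
      qed
      moreover have "eventually (\<lambda>h. exp (- 1 / h) / h ^ Suc k = (cutoff k (0 + h) - cutoff k 0) / h) (at_right 0)"
        by (auto simp: eventually_at_filter cutoff_def field_simps)
      ultimately show "((\<lambda>h. (cutoff k (0 + h) - cutoff k 0) / h) \<longlongrightarrow> 0) (at_right 0)"
        by (rule Lim_transform_eventually)
    qed
    then show ?thesis using 2 by (simp add: DERIV_def cutoff_def)
  next
    case 3
    have "((\<lambda>t. exp (- 1 / t) / t ^ k) has_real_derivative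
       (cutoff (k + 2) t - of_nat k * cutoff (k + 1) t)) (at t)"
    proof -
      have "t * t ^ (j - Suc 0) = t ^ j" if "0 < j" for j
        using that by (cases j) auto
      then show ?thesis
        using 3 by (cases k) (auto intro!: derivative_eq_intros simp: cutoff_def field_simps power2_eq_square,
            metis not_gr_zero)
    qed
    moreover have "eventually (\<lambda>x. exp (- 1 / x) / x ^ k = cutoff k x) (nhds t)"
      using eventually_nhds_in_open[of "{0<..}" t] 3
      by (auto elim!: eventually_mono simp: cutoff_def)
    ultimately show ?thesis
      using DERIV_cong_ev[of t t "\<lambda>t. exp (- 1 / t) / t ^ k" "cutoff k"] by simp
  qed
qed

lemma cutoff_0_le_1: "cutoff 0 t \<le> 1"
  by (simp add: cutoff_def)

text \<open>\<open>cutoff 2\<close> is the derivative of \<open>cutoff 0\<close>, so this bounds the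
  slope of the cut-offs. Squaring y <= exp (y - 1) at y = 1/(2t) yields 1/t^2 <= 4 exp (-2) exp
  (1/t), and 4 <= exp 2.\<close>

lemma cutoff_2_le_1: "cutoff 2 t \<le> 1"
proof (cases "t > 0")
  case True
  have "(1 / t)\<^sup>2 \<le> exp (1 / t)"
  proof -
    have "1 / t / 2 \<le> exp (1 / t / 2 - 1)"
      using exp_ge_add_one_self[of "1 / t / 2 - 1"] by simp
    then have "(1 / t / 2)\<^sup>2 \<le> (exp (1 / t / 2 - 1))\<^sup>2"
      using True by (intro power_mono) auto
    also have "\<dots> = exp (1 / t) * exp (- 2)"
      by (simp add: power2_eq_square flip: exp_add)
    finally have "(1 / t)\<^sup>2 \<le> exp (1 / t) * (4 * exp (- 2))"
      by (simp add: power2_eq_square field_simps)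
    moreover have "4 \<le> exp (2::real)"
      using exp_ge_add_one_self[of "1::real"] mult_mono[of 2 "exp 1" 2 "exp (1::real)"]
      by (simp flip: exp_add)
    then have "4 * exp (- 2::real) \<le> 1" by (simp add: exp_minus field_simps)
    then have "exp (1 / t) * (4 * exp (- 2)) \<le> exp (1 / t)"
      by (intro mult_left_le) auto
    ultimately show ?thesis by (rule order_trans)
  qed
  then show ?thesis
    using True by (simp add: cutoff_def exp_minus field_simps power2_eq_square)
qed (simp add: cutoff_def)

lemma cutoff_0_scaled_tendsto: "(\<lambda>n. cutoff 0 (real (Suc n) * t)) \<longlonglongrightarrow> (if t > 0 then 1 else 0)"
proof (cases "t > 0")
  case True
  have "(\<lambda>n. exp (- 1 / (real (Suc n) * t))) \<longlonglongrightarrow> 1"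
    using True by real_asymp
  then show ?thesis using True by (simp add: cutoff_def)
qed (simp add: cutoff_def mult_less_0_iff not_less zero_less_mult_iff)

lemma cutoff_0_tendsto: "(cutoff 0 \<longlongrightarrow> 1) at_top"
proof -
  have "((\<lambda>t. exp (- 1 / t)) \<longlongrightarrow> (1::real)) at_top" by real_asymp
  moreover have "eventually (\<lambda>t. exp (- 1 / t) = cutoff 0 t) at_top"
    using eventually_gt_at_top[of 0] by eventually_elim (simp add: cutoff_def)
  ultimately show ?thesis by (rule Lim_transform_eventually)
qed

lemma continuous_cutoff[continuous_intros]:
  "continuous_on S f \<Longrightarrow> continuous_on S (\<lambda>x. cutoff k (f x))"
  by (metis DERIV_isCont UNIV_I continuous_at_imp_continuous_on continuous_on_compose2 cutoff_has_real_derivative subset_UNIV)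

lemma cutoff_measurable[measurable]: "cutoff k \<in> borel_measurable borel"
  by (intro borel_measurable_continuous_onI continuous_cutoff continuous_on_id)

text \<open>The generators are chosen such that the class is closed under partial derivatives.\<close>

inductive cutoff_algebra :: "('a::euclidean_space \<Rightarrow> 'b::{real_normed_field, banach}) \<Rightarrow> bool" where
  const: "cutoff_algebra (\<lambda>_. c)"
| exponential: "cutoff_algebra (\<lambda>x. exp (c * of_real (x \<bullet> v)))"
| cutoff: "cutoff_algebra (\<lambda>x. of_real (cutoff k (x \<bullet> v + m)))"
| add: "cutoff_algebra f \<Longrightarrow> cutoff_algebra g \<Longrightarrow> cutoff_algebra (\<lambda>x. f x + g x)"
| mult: "cutoff_algebra f \<Longrightarrow> cutoff_algebra g \<Longrightarrow> cutoff_algebra (\<lambda>x. f x * g x)"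

text \<open>The derivative is returned as a function of the base point whose value in each fixed
  direction stays in the algebra. Direction components such as \<open>i \<bullet> v\<close> are
  constants in this reading, which is why constants are generators.\<close>

lemma cutoff_algebra_derivative:
  fixes f :: "'a::euclidean_space \<Rightarrow> 'b::{real_normed_field, banach}"
  assumes "cutoff_algebra f"
  shows "\<exists>f'. (\<forall>x. (f has_derivative f' x) (at x)) \<and> (\<forall>i. cutoff_algebra (\<lambda>x. f' x i))"
  using assms
proof induction
  case (const c)
  show ?case
    by (rule exI[of _ "\<lambda>_ _. 0"]) (auto intro: cutoff_algebra.const)
next
  case (exponential c v)
  show ?case
  proof (intro exI[of _ "\<lambda>x i. (c * of_real (i \<bullet> v)) * exp (c * of_real (x \<bullet> v))"] conjI allI)
    show "((\<lambda>x. exp (c * of_real (x \<bullet> v))) has_derivative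
        (\<lambda>i. (c * of_real (i \<bullet> v)) * exp (c * of_real (x \<bullet> v)))) (at x)" for x :: 'a
    proof -
      have "((\<lambda>x. c * of_real (x \<bullet> v)) has_derivative (\<lambda>i. c * of_real (i \<bullet> v))) (at x)"
        by (auto intro!: derivative_eq_intros)
      from has_derivative_compose[OF this DERIV_exp[unfolded has_field_derivative_def]] show ?thesis
        by (simp add: mult_ac)
    qed
    show "cutoff_algebra (\<lambda>x. (c * of_real (i \<bullet> v)) * exp (c * of_real (x \<bullet> v)))" for i
      by (intro cutoff_algebra.intros)
  qed
next
  case (cutoff k v m)
  let ?d = "\<lambda>x i. (of_real (i \<bullet> v) :: 'b) *
       (of_real (cutoff (k + 2) (x \<bullet> v + m)) + of_real (- real k) * of_real (cutoff (k + 1) (x \<bullet> v + m)))"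
  show ?case
  proof (intro exI[of _ ?d] conjI allI)
    fix x :: 'a
    have "((\<lambda>x. cutoff k (x \<bullet> v + m)) has_derivative
       (\<lambda>i. (i \<bullet> v) * (cutoff (k + 2) (x \<bullet> v + m) - real k * cutoff (k + 1) (x \<bullet> v + m)))) (at x)"
    proof -
      have "((\<lambda>x. x \<bullet> v + m) has_derivative (\<lambda>i. i \<bullet> v)) (at x)"
        by (auto intro!: derivative_eq_intros)
      from has_derivative_compose[OF this cutoff_has_real_derivative[unfolded has_field_derivative_def]]
      show ?thesis by (simp add: mult_ac)
    qed
    from has_derivative_of_real[OF this]
    show "((\<lambda>x. of_real (cutoff k (x \<bullet> v + m))) has_derivative ?d x) (at x)"
      by simp
    show "cutoff_algebra (\<lambda>x. ?d x i)" for i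
      by (intro cutoff_algebra.intros)
  qed
next
  case (add f g)
  then obtain f' g' where "\<forall>x. (f has_derivative f' x) (at x)" "\<forall>i. cutoff_algebra (\<lambda>x. f' x i)"
    "\<forall>x. (g has_derivative g' x) (at x)" "\<forall>i. cutoff_algebra (\<lambda>x. g' x i)" by blast
  then show ?case
    by (intro exI[of _ "\<lambda>x i. f' x i + g' x i"]) (auto intro!: derivative_eq_intros cutoff_algebra.add)
next
  case (mult f g)
  then obtain f' g' where "\<forall>x. (f has_derivative f' x) (at x)" "\<forall>i. cutoff_algebra (\<lambda>x. f' x i)"
    "\<forall>x. (g has_derivative g' x) (at x)" "\<forall>i. cutoff_algebra (\<lambda>x. g' x i)" by blast
  with mult.hyps show ?case
    by (intro exI[of _ "\<lambda>x i. f x * g' x i + f' x i * g x"])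
       (auto intro!: derivative_eq_intros cutoff_algebra.add cutoff_algebra.mult)
qed

lemma cutoff_algebra_frechet_derivative:
  assumes "cutoff_algebra f"
  shows "f differentiable (at x)" and "cutoff_algebra (\<lambda>x. frechet_derivative f (at x) i)"
proof -
  obtain f' where f': "\<And>x. (f has_derivative f' x) (at x)" "\<And>i. cutoff_algebra (\<lambda>x. f' x i)"
    using cutoff_algebra_derivative[OF assms] by blast
  then show "f differentiable (at x)" using differentiable_def by blast
  have "frechet_derivative f (at x) = f' x" for x
    using f' frechet_derivative_at by metis
  then show "cutoff_algebra (\<lambda>x. frechet_derivative f (at x) i)" using f' by simp
qed

text \<open>By induction on the list of directions every iterated partial stays in the algebra, and
  all members of the algebra are differentiable.\<close>

lemma cutoff_algebra_smooth:
  assumes "cutoff_algebra f"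
  shows "smooth f"
proof -
  have "cutoff_algebra (iter_partial is f)" for "is"
    by (induction "is") (auto simp: assms cutoff_algebra_frechet_derivative)
  then show ?thesis
    unfolding smooth_def differentiable_on_def
    by (auto intro: differentiable_at_withinI cutoff_algebra_frechet_derivative)
qed

lemma cutoff_algebra_continuous: "cutoff_algebra f \<Longrightarrow> continuous_on S f"
  by (meson continuous_at_imp_continuous_on cutoff_algebra_frechet_derivative(1) differentiable_imp_continuous_within)

lemma cutoff_algebra_prod:
  assumes "finite I" "\<And>i. i \<in> I \<Longrightarrow> cutoff_algebra (f i)"
  shows "cutoff_algebra (\<lambda>x. \<Prod>i\<in>I. f i x)"
  using assms
proof (induction I)
  case empty
  show ?case by (simp add: cutoff_algebra.const)
next
  case (insert i I)
  then show ?case by (simp add: cutoff_algebra.mult)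
qed

text \<open>A smooth substitute for the indicator of \<open>box l u\<close>, supported in
  \<open>cbox l u\<close> for every positive scale; growing \<open>n\<close> sharpens the edges. It
  serves three purposes: testing on boxes, cutting off at infinity (with scale 1 and growing boxes),
  and, in dimension one, producing approximate point masses at the two ends through its
  derivative.\<close>

definition box_bump :: "real \<Rightarrow> 'a::euclidean_space \<Rightarrow> 'a \<Rightarrow> 'a \<Rightarrow> real" where
  "box_bump n l u x = (\<Prod>i\<in>Basis. cutoff 0 (n * (x \<bullet> i - l \<bullet> i)) * cutoff 0 (n * (u \<bullet> i - x \<bullet> i)))"

lemma box_bump_nonneg: "0 \<le> box_bump n l u x"
  by (simp add: box_bump_def prod_nonneg cutoff_nonneg)

lemma box_bump_le_1: "box_bump n l u x \<le> 1"
  unfolding box_bump_def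
  by (intro prod_le_1 conjI mult_nonneg_nonneg mult_le_one cutoff_nonneg cutoff_0_le_1)

lemma cutoff_algebra_box_bump:
  "cutoff_algebra (\<lambda>x. of_real (box_bump n l u x) :: 'b::{real_normed_field, banach})"
proof -
  have "cutoff_algebra (\<lambda>x. \<Prod>i\<in>Basis.
     (of_real (cutoff 0 (x \<bullet> (n *\<^sub>R i) + - n * (l \<bullet> i))) :: 'b) *
      of_real (cutoff 0 (x \<bullet> (- n *\<^sub>R i) + n * (u \<bullet> i))))"
    by (intro cutoff_algebra_prod cutoff_algebra.intros) auto
  then show ?thesis by (simp add: box_bump_def algebra_simps)
qed

lemma box_bump_measurable[measurable]: "box_bump n l u \<in> borel_measurable borel"
  unfolding box_bump_def by measurable

lemma box_bump_eq_0:
  assumes "0 < n" "x \<notin> cbox l u"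
  shows "box_bump n l u x = 0"
proof -
  obtain i where i: "i \<in> Basis" "x \<bullet> i < l \<bullet> i \<or> u \<bullet> i < x \<bullet> i"
    using assms(2) by (auto simp: mem_box)
  then have "cutoff 0 (n * (x \<bullet> i - l \<bullet> i)) * cutoff 0 (n * (u \<bullet> i - x \<bullet> i)) = 0"
    using assms(1) by (auto simp: cutoff_def zero_less_mult_iff)
  then show ?thesis using i(1) by (auto simp: box_bump_def)
qed

text \<open>The free factor \<open>f\<close> makes room for plane waves, with which weak derivatives
  are tested to compute their transform.\<close>

lemma box_bump_test_function:
  fixes f :: "'a::euclidean_space \<Rightarrow> 'b::{real_normed_field, banach}"
  assumes "cutoff_algebra f" "0 < n" "cbox l u \<subseteq> A"
  shows "(\<lambda>x. f x * of_real (box_bump n l u x)) \<in> test_functions A"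
proof -
  let ?S = "{x. f x * of_real (box_bump n l u x) \<noteq> 0}"
  have "?S \<subseteq> cbox l u" using box_bump_eq_0[OF assms(2)] by fastforce
  then have "closure ?S \<subseteq> cbox l u" using closed_cbox closure_minimal by blast
  moreover have "compact (closure ?S)"
    using \<open>?S \<subseteq> cbox l u\<close> bounded_cbox bounded_subset compact_closure by blast
  ultimately show ?thesis
    using assms by (auto simp: test_functions_def intro!: cutoff_algebra_smooth cutoff_algebra.mult
        cutoff_algebra_box_bump)
qed

lemma box_bump_tendsto_indicator:
  "(\<lambda>n. box_bump (real (Suc n)) l u x) \<longlonglongrightarrow> indicator (box l u) x"
proof -
  have "(\<lambda>n. box_bump (real (Suc n)) l u x) \<longlonglongrightarrow>
     (\<Prod>i\<in>Basis. (if x \<bullet> i - l \<bullet> i > 0 then 1 else 0) * (if u \<bullet> i - x \<bullet> i > 0 then 1 else 0))"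
    unfolding box_bump_def by (intro tendsto_prod tendsto_mult cutoff_0_scaled_tendsto)
  also have "(\<Prod>i\<in>Basis. (if x \<bullet> i - l \<bullet> i > 0 then 1 else 0) * (if u \<bullet> i - x \<bullet> i > 0 then 1 else 0))
     = (indicator (box l u) x :: real)"
  proof (cases "x \<in> box l u")
    case False
    then obtain i where "i \<in> Basis" "\<not> (l \<bullet> i < x \<bullet> i \<and> x \<bullet> i < u \<bullet> i)" by (auto simp: mem_box)
    then show ?thesis using False by (auto intro!: prod_zero)
  qed (auto simp: mem_box)
  finally show ?thesis .
qed

text \<open>The box grows while the profile at its faces keeps scale 1; therefore the partial
  derivatives stay bounded uniformly in \<open>n\<close>.\<close>

definition big_bump :: "nat \<Rightarrow> 'a::euclidean_space \<Rightarrow> real" where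
  "big_bump n = box_bump 1 (- real n *\<^sub>R One) (real n *\<^sub>R One)"

lemma big_bump_eq:
  "big_bump n x = (\<Prod>i\<in>Basis. cutoff 0 (real n + x \<bullet> i) * cutoff 0 (real n - x \<bullet> i))"
  by (simp add: big_bump_def box_bump_def algebra_simps)

lemma big_bump_tendsto: "(\<lambda>n. big_bump n x) \<longlonglongrightarrow> 1"
proof -
  have "(\<lambda>n. cutoff 0 (real n + c)) \<longlonglongrightarrow> 1" for c
    by (rule filterlim_compose[OF cutoff_0_tendsto]) real_asymp
  note this[of "x \<bullet> i" for i] this[of "- (x \<bullet> i)" for i]
  then have "(\<lambda>n. big_bump n x) \<longlonglongrightarrow> (\<Prod>i\<in>(Basis::'a set). 1 * 1)"
    unfolding big_bump_eq by (intro tendsto_prod tendsto_mult) auto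
  then show ?thesis by simp
qed

text \<open>Only the factor belonging to the direction \<open>i\<close> is differentiated; its
  derivative is a difference of two numbers in [0,1], and the remaining factors also lie in
  [0,1].\<close>

lemma big_bump_partial:
  fixes i :: "'a::euclidean_space"
  assumes i: "i \<in> Basis"
  shows "\<bar>frechet_derivative (big_bump n) (at x) i\<bar> \<le> 1"
proof -
  define F where "F n x j = cutoff 0 (real n + x \<bullet> j) * cutoff 0 (real n - x \<bullet> j)" for n j and x :: 'a
  define E where "E n x = (\<Prod>j\<in>Basis - {i}. F n x j)" for n x
  define G where "G n x = cutoff 2 (real n + x \<bullet> i) * cutoff 0 (real n - x \<bullet> i)
      - cutoff 0 (real n + x \<bullet> i) * cutoff 2 (real n - x \<bullet> i)" for n x
  have F01: "0 \<le> F n x j" "F n x j \<le> 1" for n x j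
    unfolding F_def by (intro mult_nonneg_nonneg mult_le_one cutoff_nonneg cutoff_0_le_1)+
  have E01: "0 \<le> E n x" "E n x \<le> 1" for n x
    unfolding E_def by (auto intro!: prod_nonneg prod_le_1 F01)
  have bE: "big_bump n x = F n x i * E n x" for n x
    using i by (simp add: big_bump_eq F_def E_def prod.remove)
  \<comment> \<open>On the line through \<open>x\<close> in direction \<open>i\<close> the product
    \<open>E\<close> of the other factors is constant, so the partial is the derivative of a
    function of one real variable.\<close>
  have key: "frechet_derivative (big_bump n) (at x) i = G n x * E n x" for n x
  proof -
    have diff: "big_bump n differentiable (at x)"
      using cutoff_algebra_frechet_derivative(1)[OF cutoff_algebra_box_bump[where 'b=real, of 1 "- real n *\<^sub>R One" "real n *\<^sub>R One"], of x]
      by (simp add: big_bump_def)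
    have line: "((\<lambda>t. x + t *\<^sub>R i) has_vector_derivative i) (at 0)"
      by (auto intro!: derivative_eq_intros)
    have "((\<lambda>t. big_bump n (x + t *\<^sub>R i)) has_vector_derivative frechet_derivative (big_bump n) (at x) i) (at 0)"
      using vector_derivative_diff_chain_within[OF line, of "big_bump n" "frechet_derivative (big_bump n) (at x)"]
        diff[unfolded frechet_derivative_works] has_derivative_at_withinI
      by (force simp: o_def)
    moreover have "big_bump n (x + t *\<^sub>R i) =
        cutoff 0 (real n + (x \<bullet> i + t)) * cutoff 0 (real n - (x \<bullet> i + t)) * E n x" for t
    proof -
      have "E n (x + t *\<^sub>R i) = E n x"
        unfolding E_def F_def using i by (intro prod.cong refl) (auto simp: inner_add_left inner_Basis)
      then show ?thesis unfolding bE using i by (simp add: F_def inner_add_left)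
    qed
    moreover have "((\<lambda>t. cutoff 0 (real n + (x \<bullet> i + t)) * cutoff 0 (real n - (x \<bullet> i + t)) * E n x)
        has_real_derivative G n x * E n x) (at 0)"
    proof -
      have c: "(cutoff 0 has_real_derivative cutoff 2 t) (at t)" for t
        using cutoff_has_real_derivative[of 0 t] by (simp add: numeral_2_eq_2)
      have "((\<lambda>t. cutoff 0 (real n + (x \<bullet> i + t))) has_real_derivative cutoff 2 (real n + x \<bullet> i) * 1) (at 0)"
        by (rule DERIV_chain2) (auto intro!: derivative_eq_intros simp: c)
      moreover have "((\<lambda>t. cutoff 0 (real n - (x \<bullet> i + t))) has_real_derivative cutoff 2 (real n - x \<bullet> i) * - 1) (at 0)"
        by (rule DERIV_chain2) (auto intro!: derivative_eq_intros simp: c)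
      ultimately show ?thesis
        by (auto intro!: derivative_eq_intros simp: G_def algebra_simps)
    qed
    ultimately show ?thesis
      using vector_derivative_unique_at has_real_derivative_iff_has_vector_derivative by fastforce
  qed
  have "\<bar>G n x\<bar> \<le> 1"
  proof -
    have "0 \<le> cutoff 2 a * cutoff 0 b" "cutoff 2 a * cutoff 0 b \<le> 1" for a b
      by (intro mult_nonneg_nonneg mult_le_one cutoff_nonneg cutoff_0_le_1 cutoff_2_le_1)+
    note this[of "real n + x \<bullet> i" "real n - x \<bullet> i"] this[of "real n - x \<bullet> i" "real n + x \<bullet> i"]
    then show ?thesis unfolding G_def by (simp add: mult.commute abs_le_iff)
  qed
  then show ?thesis
    using E01[of n x] by (simp add: key abs_mult mult_le_one)
qed

section \<open>The space of square-integrable functions\<close>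

lemma integral_Cauchy_Schwarz:
  fixes f g :: "'x \<Rightarrow> real"
  assumes [measurable]: "f \<in> borel_measurable M" "g \<in> borel_measurable M"
    and f: "integrable M (\<lambda>x. (f x)\<^sup>2)" and g: "integrable M (\<lambda>x. (g x)\<^sup>2)"
  shows "integrable M (\<lambda>x. f x * g x)"
    and "(LINT x|M. \<bar>f x * g x\<bar>) \<le> sqrt (LINT x|M. (f x)\<^sup>2) * sqrt (LINT x|M. (g x)\<^sup>2)"
proof -
  have "\<bar>f x * g x\<bar> \<le> \<bar>(f x)\<^sup>2 + (g x)\<^sup>2\<bar>" for x
  proof -
    have "2 * \<bar>f x\<bar> * \<bar>g x\<bar> \<le> \<bar>f x\<bar>\<^sup>2 + \<bar>g x\<bar>\<^sup>2" by (rule sum_squares_bound)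
    moreover have "0 \<le> \<bar>f x\<bar> * \<bar>g x\<bar>" by simp
    ultimately have "\<bar>f x\<bar> * \<bar>g x\<bar> \<le> \<bar>f x\<bar>\<^sup>2 + \<bar>g x\<bar>\<^sup>2" by linarith
    then show ?thesis by (simp add: abs_mult)
  qed
  then show fg: "integrable M (\<lambda>x. f x * g x)"
    by (intro Bochner_Integration.integrable_bound[OF Bochner_Integration.integrable_add[OF f g]]) auto
  have "(\<integral>\<^sup>+x. ennreal \<bar>f x\<bar> * ennreal \<bar>g x\<bar> \<partial>M)\<^sup>2 \<le> (\<integral>\<^sup>+x. (ennreal \<bar>f x\<bar>)\<^sup>2 \<partial>M) * (\<integral>\<^sup>+x. (ennreal \<bar>g x\<bar>)\<^sup>2 \<partial>M)"
    by (rule Cauchy_Schwarz_nn_integral) auto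
  also have "(\<integral>\<^sup>+x. ennreal \<bar>f x\<bar> * ennreal \<bar>g x\<bar> \<partial>M) = ennreal (LINT x|M. \<bar>f x * g x\<bar>)"
    using integrable_abs[OF fg]
    by (subst nn_integral_eq_integral[symmetric]) (auto simp: abs_mult ennreal_mult)
  also have "(\<integral>\<^sup>+x. (ennreal \<bar>f x\<bar>)\<^sup>2 \<partial>M) = ennreal (LINT x|M. (f x)\<^sup>2)"
    using f by (subst nn_integral_eq_integral[symmetric]) (auto simp: ennreal_power)
  also have "(\<integral>\<^sup>+x. (ennreal \<bar>g x\<bar>)\<^sup>2 \<partial>M) = ennreal (LINT x|M. (g x)\<^sup>2)"
    using g by (subst nn_integral_eq_integral[symmetric]) (auto simp: ennreal_power)
  finally have "(LINT x|M. \<bar>f x * g x\<bar>)\<^sup>2 \<le> (LINT x|M. (f x)\<^sup>2) * (LINT x|M. (g x)\<^sup>2)"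
    by (simp add: ennreal_power flip: ennreal_mult)
  then have "sqrt ((LINT x|M. \<bar>f x * g x\<bar>)\<^sup>2) \<le> sqrt ((LINT x|M. (f x)\<^sup>2) * (LINT x|M. (g x)\<^sup>2))"
    by (rule real_sqrt_le_mono)
  then show "(LINT x|M. \<bar>f x * g x\<bar>) \<le> sqrt (LINT x|M. (f x)\<^sup>2) * sqrt (LINT x|M. (g x)\<^sup>2)"
    by (simp add: real_sqrt_mult)
qed

lemma elts_L2: "f \<in> elts L2 \<longleftrightarrow> f \<in> borel_measurable lborel \<and> integrable lborel (\<lambda>x. (norm (f x))\<^sup>2)"
  by (simp add: L2_def)

lemma nrm_L2: "nrm L2 f = sqrt (LINT x|lborel. (norm (f x))\<^sup>2)"
  by (simp add: L2_def)

lemma nrm_L2_nonneg[simp]: "0 \<le> nrm L2 f"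
  by (simp add: nrm_L2)

lemma nrm_L2_power2: "(nrm L2 f)\<^sup>2 = (LINT x|lborel. (norm (f x))\<^sup>2)"
  by (simp add: nrm_L2)

lemma L2_measurable: "f \<in> elts L2 \<Longrightarrow> f \<in> borel_measurable borel"
  by (simp add: elts_L2)

lemma nrm_L2_cong_AE:
  assumes "f \<in> borel_measurable borel" "g \<in> borel_measurable borel" "AE x in lborel. f x = g x"
  shows "nrm L2 f = nrm L2 g"
  unfolding nrm_L2 using assms by (intro arg_cong[where f=sqrt] integral_cong_AE) auto

lemma L2_dominated:
  assumes "g \<in> elts L2" "f \<in> borel_measurable borel" "0 \<le> C" "AE x in lborel. norm (f x) \<le> C * norm (g x)"
  shows "f \<in> elts L2" and "nrm L2 f \<le> C * nrm L2 g"
proof -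
  have i: "integrable lborel (\<lambda>x. C\<^sup>2 * (norm (g x))\<^sup>2)" using assms(1) by (simp add: elts_L2)
  have le: "AE x in lborel. (norm (f x))\<^sup>2 \<le> C\<^sup>2 * (norm (g x))\<^sup>2"
    using assms(4) by eventually_elim (metis norm_ge_zero power_mono power_mult_distrib)
  have f: "integrable lborel (\<lambda>x. (norm (f x))\<^sup>2)"
    by (rule Bochner_Integration.integrable_bound[OF i]) (use assms(2) le in auto)
  then show "f \<in> elts L2" using assms(2) by (simp add: elts_L2)
  have "(LINT x|lborel. (norm (f x))\<^sup>2) \<le> (LINT x|lborel. C\<^sup>2 * (norm (g x))\<^sup>2)"
    by (rule integral_mono_AE[OF f i le])
  then have "sqrt (LINT x|lborel. (norm (f x))\<^sup>2) \<le> sqrt (C\<^sup>2 * (LINT x|lborel. (norm (g x))\<^sup>2))"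
    by simp
  then show "nrm L2 f \<le> C * nrm L2 g" using assms(3) by (simp add: nrm_L2 real_sqrt_mult)
qed

lemma L2_mult_integrable:
  fixes f g :: "'a::euclidean_space \<Rightarrow> 'b::{real_normed_field, banach, second_countable_topology}"
  assumes f: "f \<in> elts L2" and g: "g \<in> elts L2"
  shows "integrable lborel (\<lambda>x. f x * g x)"
    and "(LINT x|lborel. norm (f x * g x)) \<le> nrm L2 f * nrm L2 g"
    and "norm (LINT x|lborel. f x * g x) \<le> nrm L2 f * nrm L2 g"
proof -
  note [measurable] = L2_measurable[OF f] L2_measurable[OF g]
  have *: "integrable lborel (\<lambda>x. norm (f x) * norm (g x))"
    by (rule integral_Cauchy_Schwarz) (use f g in \<open>auto simp: elts_L2\<close>)
  then show "integrable lborel (\<lambda>x. f x * g x)"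
    by (rule Bochner_Integration.integrable_bound) (auto simp: norm_mult)
  show "(LINT x|lborel. norm (f x * g x)) \<le> nrm L2 f * nrm L2 g"
    using integral_Cauchy_Schwarz(2)[of "\<lambda>x. norm (f x)" lborel "\<lambda>x. norm (g x)"] f g
    by (simp add: nrm_L2 elts_L2 norm_mult)
  then show "norm (LINT x|lborel. f x * g x) \<le> nrm L2 f * nrm L2 g"
    using integral_norm_bound[of lborel "\<lambda>x. f x * g x"] by linarith
qed

lemma L2_add:
  assumes f: "f \<in> elts L2" and g: "g \<in> elts L2"
  shows "(\<lambda>x. f x + g x) \<in> elts L2" and "nrm L2 (\<lambda>x. f x + g x) \<le> nrm L2 f + nrm L2 g"
proof -
  note [measurable] = L2_measurable[OF f] L2_measurable[OF g]
  have i: "integrable lborel (\<lambda>x. (norm (f x))\<^sup>2)" "integrable lborel (\<lambda>x. (norm (g x))\<^sup>2)"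
    using f g by (auto simp: elts_L2)
  have m: "integrable lborel (\<lambda>x. norm (f x) * norm (g x))"
    by (rule integral_Cauchy_Schwarz) (use i in auto)
  have le: "(norm (f x + g x))\<^sup>2 \<le> (norm (f x))\<^sup>2 + 2 * (norm (f x) * norm (g x)) + (norm (g x))\<^sup>2" for x
    using power_mono[OF norm_triangle_ineq[of "f x" "g x"], of 2] by (simp add: power2_sum)
  have ib: "integrable lborel (\<lambda>x. (norm (f x))\<^sup>2 + 2 * (norm (f x) * norm (g x)) + (norm (g x))\<^sup>2)"
    using i m by simp
  have ifg: "integrable lborel (\<lambda>x. (norm (f x + g x))\<^sup>2)"
    by (rule Bochner_Integration.integrable_bound[OF ib]) (auto intro!: order_trans[OF le])
  then show "(\<lambda>x. f x + g x) \<in> elts L2" by (simp add: elts_L2)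
  have "(nrm L2 (\<lambda>x. f x + g x))\<^sup>2 \<le> (LINT x|lborel. (norm (f x))\<^sup>2 + 2 * (norm (f x) * norm (g x)) + (norm (g x))\<^sup>2)"
    unfolding nrm_L2_power2 by (rule integral_mono[OF ifg ib le])
  also have "\<dots> = (nrm L2 f)\<^sup>2 + 2 * (LINT x|lborel. norm (f x) * norm (g x)) + (nrm L2 g)\<^sup>2"
    using i m by (simp add: nrm_L2_power2)
  also have "(LINT x|lborel. norm (f x) * norm (g x)) \<le> nrm L2 f * nrm L2 g"
    using integral_Cauchy_Schwarz(2)[of "\<lambda>x. norm (f x)" lborel "\<lambda>x. norm (g x)"] i
    by (simp add: nrm_L2)
  finally have "(nrm L2 (\<lambda>x. f x + g x))\<^sup>2 \<le> (nrm L2 f + nrm L2 g)\<^sup>2"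
    by (simp add: power2_sum)
  then show "nrm L2 (\<lambda>x. f x + g x) \<le> nrm L2 f + nrm L2 g"
    by (rule power2_le_imp_le) simp
qed

lemma L2_scale:
  fixes f :: "'a::euclidean_space \<Rightarrow> complex"
  assumes f: "f \<in> elts L2"
  shows "(\<lambda>x. c * f x) \<in> elts L2" and "nrm L2 (\<lambda>x. c * f x) = cmod c * nrm L2 f"
  using f by (auto simp: elts_L2 nrm_L2 norm_mult power_mult_distrib real_sqrt_mult)

lemma L2_uminus:
  assumes f: "f \<in> elts L2"
  shows "(\<lambda>x. - f x) \<in> elts L2" and "nrm L2 (\<lambda>x. - f x) = nrm L2 f"
  using f by (auto simp: elts_L2 nrm_L2)

lemma L2_cnj:
  assumes f: "f \<in> elts L2"
  shows "(\<lambda>x. cnj (f x)) \<in> elts L2" and "nrm L2 (\<lambda>x. cnj (f x)) = nrm L2 f"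
  using f by (auto simp: elts_L2 nrm_L2 intro: borel_measurable_continuous_on[of cnj f] continuous_intros)

lemma L2_zero: "(\<lambda>_. 0) \<in> elts L2" "nrm L2 (\<lambda>_. 0) = 0"
  by (auto simp: elts_L2 nrm_L2)

lemma L2_diff:
  assumes f: "f \<in> elts L2" and g: "g \<in> elts L2"
  shows "(\<lambda>x. f x - g x) \<in> elts L2" and "nrm L2 (\<lambda>x. f x - g x) \<le> nrm L2 f + nrm L2 g"
  using L2_add[OF f L2_uminus(1)[OF g]] by (auto simp: L2_uminus[OF g])

lemma L2_triangle:
  assumes f: "f \<in> elts L2" and g: "g \<in> elts L2" and h: "h \<in> elts L2"
  shows "nrm L2 (\<lambda>x. f x - h x) \<le> nrm L2 (\<lambda>x. f x - g x) + nrm L2 (\<lambda>x. g x - h x)"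
  using L2_add(2)[OF L2_diff(1)[OF f g] L2_diff(1)[OF g h]] by simp

lemma nrm_L2_diff_commute: "nrm L2 (\<lambda>x. f x - g x) = nrm L2 (\<lambda>x. g x - f x)"
  by (simp add: nrm_L2 norm_minus_commute)

lemma nrm_L2_eq_0:
  assumes f: "f \<in> elts L2"
  shows "nrm L2 f = 0 \<longleftrightarrow> (AE x in lborel. f x = 0)"
  using f integral_nonneg_eq_0_iff_AE[of lborel "\<lambda>x. (norm (f x))\<^sup>2"] by (simp add: elts_L2 nrm_L2)

text \<open>Transfers both membership in L2 and the norm bound to a pointwise limit. It is the
  device for removing auxiliary weights and cut-offs: a bound that is uniform in the auxiliary
  parameter survives.\<close>

lemma L2_Fatou:
  assumes F: "\<And>k::nat. F k \<in> elts L2" and B: "\<And>k. nrm L2 (F k) \<le> B"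
    and G: "G \<in> borel_measurable borel" and lim: "AE x in lborel. (\<lambda>k. F k x) \<longlonglongrightarrow> G x"
  shows "G \<in> elts L2" and "nrm L2 G \<le> B"
proof -
  have "0 \<le> B" using B[of 0] nrm_L2_nonneg order_trans by blast
  note [measurable] = L2_measurable[OF F] G
  have "(\<integral>\<^sup>+x. ennreal ((norm (G x))\<^sup>2) \<partial>lborel) = (\<integral>\<^sup>+x. liminf (\<lambda>k. ennreal ((norm (F k x))\<^sup>2)) \<partial>lborel)"
  proof (rule nn_integral_cong_AE, use lim in eventually_elim)
    fix x assume "(\<lambda>k. F k x) \<longlonglongrightarrow> G x"
    then have "(\<lambda>k. ennreal ((norm (F k x))\<^sup>2)) \<longlonglongrightarrow> ennreal ((norm (G x))\<^sup>2)"
      by (intro tendsto_ennrealI tendsto_intros)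
    then show "ennreal ((norm (G x))\<^sup>2) = liminf (\<lambda>k. ennreal ((norm (F k x))\<^sup>2))"
      by (rule lim_imp_Liminf[OF sequentially_bot, symmetric])
  qed
  also have "\<dots> \<le> liminf (\<lambda>k. \<integral>\<^sup>+x. ennreal ((norm (F k x))\<^sup>2) \<partial>lborel)"
    by (rule nn_integral_liminf) auto
  also have "\<dots> \<le> liminf (\<lambda>k::nat. ennreal (B\<^sup>2))"
  proof (rule Liminf_mono, rule always_eventually, rule allI)
    fix k
    have "(\<integral>\<^sup>+x. ennreal ((norm (F k x))\<^sup>2) \<partial>lborel) = ennreal ((nrm L2 (F k))\<^sup>2)"
      using F by (subst nn_integral_eq_integral) (auto simp: elts_L2 nrm_L2_power2)
    then show "(\<integral>\<^sup>+x. ennreal ((norm (F k x))\<^sup>2) \<partial>lborel) \<le> ennreal (B\<^sup>2)"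
      using B[of k] by (simp add: ennreal_leI power_mono)
  qed
  also have "\<dots> = ennreal (B\<^sup>2)" by (simp add: Liminf_const)
  finally have le: "(\<integral>\<^sup>+x. ennreal ((norm (G x))\<^sup>2) \<partial>lborel) \<le> ennreal (B\<^sup>2)" .
  then have int: "integrable lborel (\<lambda>x. (norm (G x))\<^sup>2)"
    by (intro integrableI_bounded) (auto intro: le_less_trans)
  then show "G \<in> elts L2" by (simp add: elts_L2)
  have "(nrm L2 G)\<^sup>2 \<le> B\<^sup>2"
    using le int by (simp add: nn_integral_eq_integral nrm_L2_power2)
  then show "nrm L2 G \<le> B" using \<open>0 \<le> B\<close> by (rule power2_le_imp_le)
qed

lemma L2_dominated_tendsto:
  assumes f: "f \<in> elts L2" and g: "\<And>n::nat. g n \<in> borel_measurable borel"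
    and dom: "\<And>n. AE x in lborel. norm (g n x) \<le> norm (f x)"
    and lim: "AE x in lborel. (\<lambda>n. g n x) \<longlonglongrightarrow> 0"
  shows "(\<lambda>n. nrm L2 (g n)) \<longlonglongrightarrow> 0"
proof -
  note [measurable] = L2_measurable[OF f] g
  have "(\<lambda>n. LINT x|lborel. (norm (g n x))\<^sup>2) \<longlonglongrightarrow> (LINT x|(lborel::'a measure). 0)"
  proof (rule integral_dominated_convergence[where w="\<lambda>x. (norm (f x))\<^sup>2"])
    show "AE x in lborel. (\<lambda>n. (norm (g n x))\<^sup>2) \<longlonglongrightarrow> 0"
      using lim by eventually_elim (auto intro!: tendsto_eq_intros)
    show "AE x in lborel. norm ((norm (g n x))\<^sup>2) \<le> (norm (f x))\<^sup>2" for n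
      using dom[of n] by eventually_elim (simp add: power_mono)
  qed (use f in \<open>auto simp: elts_L2\<close>)
  then show ?thesis unfolding nrm_L2 by (auto intro!: tendsto_eq_intros)
qed

text \<open>The squared distances converge to 0 in L1, hence almost everywhere along a subsequence.
  This supplies the pointwise convergence that Fatou's lemma asks for when only norm convergence is
  known.\<close>

lemma L2_tendsto_AE_subseq:
  assumes F: "\<And>n::nat. F n \<in> elts L2" and G: "G \<in> elts L2"
    and lim: "(\<lambda>n. nrm L2 (\<lambda>x. F n x - G x)) \<longlonglongrightarrow> 0"
  shows "\<exists>r::nat \<Rightarrow> nat. strict_mono r \<and> (AE x in lborel. (\<lambda>n. F (r n) x) \<longlonglongrightarrow> G x)"
proof -
  have "(\<lambda>n. (nrm L2 (\<lambda>x. F n x - G x))\<^sup>2) \<longlonglongrightarrow> 0\<^sup>2"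
    by (intro tendsto_intros lim)
  then have "(\<lambda>n. LINT x|lborel. norm ((norm (F n x - G x))\<^sup>2)) \<longlonglongrightarrow> 0"
    by (simp add: nrm_L2_power2)
  moreover have "integrable lborel (\<lambda>x. (norm (F n x - G x))\<^sup>2)" for n
    using L2_diff(1)[OF F G] by (simp add: elts_L2)
  ultimately obtain r where r: "strict_mono r" "AE x in lborel. (\<lambda>n. (norm (F (r n) x - G x))\<^sup>2) \<longlonglongrightarrow> 0"
    using tendsto_L1_AE_subseq[of lborel "\<lambda>n x. (norm (F n x - G x))\<^sup>2"] by auto
  have "AE x in lborel. (\<lambda>n. F (r n) x) \<longlonglongrightarrow> G x"
    using r(2)
  proof eventually_elim
    fix x assume "(\<lambda>n. (norm (F (r n) x - G x))\<^sup>2) \<longlonglongrightarrow> 0"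
    then have "(\<lambda>n. sqrt ((norm (F (r n) x - G x))\<^sup>2)) \<longlonglongrightarrow> sqrt 0" by (rule tendsto_real_sqrt)
    then show "(\<lambda>n. F (r n) x) \<longlonglongrightarrow> G x" by (simp add: LIM_zero_cancel tendsto_norm_zero_iff)
  qed
  then show ?thesis using r(1) by blast
qed

text \<open>The Riesz-Fischer argument. Along a rapidly converging subsequence the weighted squares
  2^k (D k)^2 still have summable integrals, so they are summable at almost every point; then 2 D k
  <= 2^-k + 2^k (D k)^2 makes the increments summable there.\<close>

lemma L2_complete:
  fixes F :: "nat \<Rightarrow> 'a::euclidean_space \<Rightarrow> 'b::{banach, second_countable_topology}"
  assumes F: "\<And>n. F n \<in> elts L2"
    and Cauchy: "\<And>e. 0 < e \<Longrightarrow> \<exists>N. \<forall>m\<ge>N. \<forall>n\<ge>N. nrm L2 (\<lambda>x. F m x - F n x) < e"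
  obtains G where "G \<in> elts L2" "(\<lambda>n. nrm L2 (\<lambda>x. F n x - G x)) \<longlonglongrightarrow> 0"
proof -
  note [measurable] = L2_measurable[OF F]
  have "\<exists>N. \<forall>m\<ge>N. \<forall>n\<ge>N. nrm L2 (\<lambda>x. F m x - F n x) < (1 / 2) ^ k" for k
    using Cauchy[of "(1 / 2) ^ k"] by simp
  then obtain N where N: "\<And>k m n. m \<ge> N k \<Longrightarrow> n \<ge> N k \<Longrightarrow> nrm L2 (\<lambda>x. F m x - F n x) < (1 / 2) ^ k"
    by metis
  \<comment> \<open>Adding all thresholds up to \<open>k\<close> makes the indices monotone and at
    least \<open>N k\<close>; the summand \<open>k\<close> makes them tend to infinity.\<close>
  define r where "r k = k + (\<Sum>j\<le>k. N j)" for k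
  have rN: "N k \<le> r k" "r k \<le> r (Suc k)" "k \<le> r k" for k
    using member_le_sum[of k "{..k}" N] by (auto simp: r_def)
  define D where "D k x = norm (F (r (Suc k)) x - F (r k) x)" for k x
  have D[measurable]: "D k \<in> borel_measurable borel" for k unfolding D_def by measurable
  \<comment> \<open>The integral of (D k)^2 is at most 4^-k, which leaves room for the weight
    2^k.\<close>
  have Dint: "(\<integral>\<^sup>+x. ennreal (2 ^ k * (D k x)\<^sup>2) \<partial>lborel) \<le> ennreal ((1 / 2) ^ k)" for k
  proof -
    have *: "nrm L2 (\<lambda>x. F (r (Suc k)) x - F (r k) x) < (1 / 2) ^ k"
      using rN[of k] by (intro N) auto
    have "(nrm L2 (\<lambda>x. F (r (Suc k)) x - F (r k) x))\<^sup>2 \<le> ((1 / 2) ^ k)\<^sup>2"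
      using * by (intro power_mono) auto
    then have "2 ^ k * (nrm L2 (\<lambda>x. F (r (Suc k)) x - F (r k) x))\<^sup>2 \<le> 2 ^ k * ((1 / 2) ^ k)\<^sup>2"
      by simp
    also have "\<dots> = (1 / 2 :: real) ^ k"
      by (simp add: power2_eq_square power_divide)
    finally have "2 ^ k * (nrm L2 (\<lambda>x. F (r (Suc k)) x - F (r k) x))\<^sup>2 \<le> (1 / 2) ^ k" .
    moreover have "integrable lborel (\<lambda>x. 2 ^ k * (D k x)\<^sup>2)"
      using L2_diff(1)[OF F F, of "r (Suc k)" "r k"] by (simp add: D_def elts_L2)
    ultimately show ?thesis
      by (subst nn_integral_eq_integral) (auto simp: nrm_L2_power2 D_def ennreal_leI)
  qed
  have "(\<integral>\<^sup>+x. (\<Sum>k. ennreal (2 ^ k * (D k x)\<^sup>2)) \<partial>lborel) = (\<Sum>k. \<integral>\<^sup>+x. ennreal (2 ^ k * (D k x)\<^sup>2) \<partial>lborel)"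
    by (rule nn_integral_suminf) auto
  also have "\<dots> \<le> (\<Sum>k. ennreal ((1 / 2) ^ k))"
    by (intro suminf_le Dint) auto
  also have "\<dots> = ennreal (\<Sum>k. (1 / 2) ^ k)"
    by (rule suminf_ennreal2) (auto intro: summable_geometric)
  finally have "(\<integral>\<^sup>+x. (\<Sum>k. ennreal (2 ^ k * (D k x)\<^sup>2)) \<partial>lborel) < \<infinity>"
    by (simp add: le_less_trans)
  then have "AE x in lborel. (\<Sum>k. ennreal (2 ^ k * (D k x)\<^sup>2)) \<noteq> \<infinity>"
    by (intro nn_integral_noteq_infinite) auto
  then have conv: "AE x in lborel. convergent (\<lambda>k. F (r k) x)"
  proof eventually_elim
    fix x assume "(\<Sum>k. ennreal (2 ^ k * (D k x)\<^sup>2)) \<noteq> \<infinity>"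
    then have s: "summable (\<lambda>k. 2 ^ k * (D k x)\<^sup>2)"
      by (intro summable_suminf_not_top) auto
    have s2: "summable (\<lambda>k. (1 / 2) ^ k + 2 ^ k * (D k x)\<^sup>2)"
      by (intro summable_add s) (auto intro: summable_geometric)
    have "summable (\<lambda>k. D k x)"
    proof (rule summable_comparison_test'[OF s2, of 0])
      fix k :: nat
      have D0: "0 \<le> D k x" by (simp add: D_def)
      have "2 * (1 / 2) ^ k * D k x * 2 ^ k \<le> (1 / 2) ^ k * (1 + (2 ^ k * D k x)\<^sup>2)"
        using sum_squares_bound[of 1 "2 ^ k * D k x"] by (simp add: field_simps)
      then have "2 * D k x \<le> (1 / 2) ^ k + 2 ^ k * (D k x)\<^sup>2"
        by (simp add: field_simps power2_eq_square)
      then show "norm (D k x) \<le> (1 / 2) ^ k + 2 ^ k * (D k x)\<^sup>2"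
        using D0 by simp
    qed
    then have "summable (\<lambda>k. F (r (Suc k)) x - F (r k) x)"
      unfolding D_def by (rule summable_norm_cancel)
    then have "convergent (\<lambda>n. \<Sum>k<n. F (r (Suc k)) x - F (r k) x)"
      by (simp add: summable_iff_convergent)
    then have "convergent (\<lambda>n. F (r n) x - F (r 0) x)"
      by (simp add: sum_lessThan_telescope[of "\<lambda>k. F (r k) x"])
    then have "convergent (\<lambda>n. F (r n) x - F (r 0) x + F (r 0) x)"
      by (intro convergent_add convergent_const)
    then show "convergent (\<lambda>k. F (r k) x)" by simp
  qed
  define G where "G x = lim (\<lambda>k. F (r k) x)" for x
  have G[measurable]: "G \<in> borel_measurable borel" unfolding G_def by measurable
  have lim: "AE x in lborel. (\<lambda>k. F (r k) x) \<longlonglongrightarrow> G x"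
    using conv by eventually_elim (simp add: G_def convergent_LIMSEQ_iff)
  \<comment> \<open>Fatou's lemma is applied to the differences with a later member of the
    subsequence. The shift by \<open>N j\<close> puts every index used beyond the threshold
    \<open>N j\<close>.\<close>
  have tail: "(\<lambda>x. F n x - G x) \<in> elts L2 \<and> nrm L2 (\<lambda>x. F n x - G x) \<le> (1 / 2) ^ j" if "n \<ge> N j" for n j
  proof -
    have "(\<lambda>x. F n x - F (r (k + N j)) x) \<in> elts L2" for k by (intro L2_diff F)
    moreover have "nrm L2 (\<lambda>x. F n x - F (r (k + N j)) x) \<le> (1 / 2) ^ j" for k
      using that rN(3)[of "k + N j"] by (intro less_imp_le[OF N]) auto
    moreover have "AE x in lborel. (\<lambda>k. F n x - F (r (k + N j)) x) \<longlonglongrightarrow> F n x - G x"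
      using lim by eventually_elim (intro tendsto_intros LIMSEQ_ignore_initial_segment)
    ultimately show ?thesis
      using L2_Fatou[of "\<lambda>k x. F n x - F (r (k + N j)) x" "(1/2)^j" "\<lambda>x. F n x - G x"] by auto
  qed
  have "(\<lambda>x. F (N 0) x - (F (N 0) x - G x)) \<in> elts L2"
    by (rule L2_diff(1)[OF F conjunct1[OF tail[of 0 "N 0"]]]) simp
  then have "G \<in> elts L2" by simp
  moreover have "(\<lambda>n. nrm L2 (\<lambda>x. F n x - G x)) \<longlonglongrightarrow> 0"
  proof (rule LIMSEQ_I)
    fix e :: real assume "0 < e"
    then obtain j where "(1 / 2) ^ j < e" using real_arch_pow_inv[of e "1/2"] by auto
    then show "\<exists>no. \<forall>n\<ge>no. norm (nrm L2 (\<lambda>x. F n x - G x) - 0) < e"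
      using tail[of j] by (intro exI[of _ "N j"]) (auto intro: le_less_trans)
  qed
  ultimately show ?thesis by (rule that)
qed

section \<open>Half of Plancherel's theorem\<close>

lemma cis_measurable[measurable]: "cis \<in> borel_measurable borel"
  by (intro borel_measurable_continuous_onI continuous_intros)

lemma cnj_measurable[measurable]: "cnj \<in> borel_measurable borel"
  by (intro borel_measurable_continuous_onI continuous_intros)

lemma integral_pair_mult:
  fixes f g :: "'a::euclidean_space \<Rightarrow> complex"
  assumes f: "integrable lborel f" and g: "integrable lborel g"
  shows "integrable (lborel \<Otimes>\<^sub>M lborel) (\<lambda>p. f (fst p) * g (snd p))"
    and "(LINT p|(lborel \<Otimes>\<^sub>M lborel). f (fst p) * g (snd p)) = (LINT x|lborel. f x) * (LINT y|lborel. g y)"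
proof -
  note [measurable] = borel_measurable_integrable[OF f] borel_measurable_integrable[OF g]
  show i: "integrable (lborel \<Otimes>\<^sub>M lborel) (\<lambda>p. f (fst p) * g (snd p))"
    by (rule lborel_pair.Fubini_integrable) (use f g in \<open>auto simp: norm_mult\<close>)
  show "(LINT p|(lborel \<Otimes>\<^sub>M lborel). f (fst p) * g (snd p)) = (LINT x|lborel. f x) * (LINT y|lborel. g y)"
    using lborel_pair.integral_fst'[OF i] by simp
qed

section \<open>Gaussians and their Fourier transforms\<close>

lemma lborel_integral_prod:
  fixes f :: "'a::euclidean_space \<Rightarrow> real \<Rightarrow> complex"
  assumes f: "\<And>b. b \<in> Basis \<Longrightarrow> integrable lborel (f b)"
  shows "integrable lborel (\<lambda>x. \<Prod>b\<in>Basis. f b (x \<bullet> b))"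
    and "(LINT x|lborel. (\<Prod>b\<in>Basis. f b (x \<bullet> b))) = (\<Prod>b\<in>Basis. LINT t|lborel. f b t)"
proof -
  interpret P: product_sigma_finite "\<lambda>_::'a. lborel :: real measure" ..
  have [measurable]: "\<And>b. b \<in> Basis \<Longrightarrow> f b \<in> borel_measurable borel"
    using f borel_measurable_integrable by fastforce
  have eq: "(\<Prod>b\<in>Basis. f b ((\<Sum>c\<in>Basis. x c *\<^sub>R c) \<bullet> b)) = (\<Prod>b\<in>Basis. f b (x b))" for x
    by (intro prod.cong refl) simp
  show "integrable lborel (\<lambda>x. \<Prod>b\<in>Basis. f b (x \<bullet> b))"
    by (subst lborel_eq, subst integrable_distr_eq)
       (use P.product_integrable_prod[of Basis f] f in \<open>auto simp: eq\<close>)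
  show "(LINT x|lborel. (\<Prod>b\<in>Basis. f b (x \<bullet> b))) = (\<Prod>b\<in>Basis. LINT t|lborel. f b t)"
    by (subst lborel_eq, subst integral_distr)
       (use P.product_integral_prod[of Basis f] f in \<open>auto simp: eq\<close>)
qed

text \<open>This is the characteristic function of the standard normal distribution at -z/d, after
  the substitution x = d t.\<close>

lemma gaussian_fourier_real:
  assumes d: "0 < (d::real)"
  shows "integrable lborel (\<lambda>t. cis (- (z * t)) * complex_of_real (exp (- (d * t)\<^sup>2 / 2)))"
    and "(LINT t|lborel. cis (- (z * t)) * complex_of_real (exp (- (d * t)\<^sup>2 / 2))) = complex_of_real (sqrt (2 * pi) / d * exp (- (z / d)\<^sup>2 / 2))"
proof -
  have "integrable lborel (\<lambda>x. complex_of_real (std_normal_density x))"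
    by (intro integrable_of_real integrable_normal_density) simp
  then have "integrable lborel (\<lambda>x. cis (- (z / d) * x) * complex_of_real (std_normal_density x))"
    by (rule Bochner_Integration.integrable_bound) (auto simp: norm_mult)
  then have "integrable lborel (\<lambda>x. sqrt (2 * pi) * (cis (- (z / d) * x) * complex_of_real (std_normal_density x)))"
    by (rule integrable_mult_right)
  moreover have eq: "sqrt (2 * pi) * (cis (- (z / d) * x) * complex_of_real (std_normal_density x))
     = cis (- (z / d) * x) * complex_of_real (exp (- x\<^sup>2 / 2))" for x
    by (simp add: std_normal_density_def)
  ultimately have i: "integrable lborel (\<lambda>x. cis (- (z / d) * x) * complex_of_real (exp (- x\<^sup>2 / 2)))"
    by (simp only: eq)
  have "complex_of_real (exp (- (z / d)\<^sup>2 / 2)) = char std_normal_distribution (- (z / d))"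
    by (simp add: char_std_normal_distribution)
  also have "\<dots> = (LINT x|lborel. std_normal_density x *\<^sub>R cis (- (z / d) * x))"
    by (simp add: char_def integral_density cis_conv_exp)
  finally have "sqrt (2 * pi) * complex_of_real (exp (- (z / d)\<^sup>2 / 2)) =
      (LINT x|lborel. sqrt (2 * pi) * (cis (- (z / d) * x) * complex_of_real (std_normal_density x)))"
    by (simp add: scaleR_conv_of_real mult.commute)
  also have "\<dots> = (LINT x|lborel. cis (- (z / d) * x) * complex_of_real (exp (- x\<^sup>2 / 2)))"
    by (simp only: eq)
  also have "\<dots> = d * (LINT t|lborel. cis (- (z * t)) * complex_of_real (exp (- (d * t)\<^sup>2 / 2)))"
    using lborel_integral_real_affine[of d "\<lambda>x. cis (- (z / d) * x) * complex_of_real (exp (- x\<^sup>2 / 2))" 0] d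
    by (simp add: scaleR_conv_of_real)
  finally show "(LINT t|lborel. cis (- (z * t)) * complex_of_real (exp (- (d * t)\<^sup>2 / 2))) = complex_of_real (sqrt (2 * pi) / d * exp (- (z / d)\<^sup>2 / 2))"
    using d by (simp add: field_simps)
  show "integrable lborel (\<lambda>t. cis (- (z * t)) * complex_of_real (exp (- (d * t)\<^sup>2 / 2)))"
    using lborel_integrable_real_affine[OF i, of d 0] d by simp
qed

text \<open>The parameter is an inverse width: as \<open>d\<close> decreases to 0 the function
  increases to 1, which is how the weight is removed in the end. The Fourier transform exchanges
  \<open>d\<close> and \<open>1 / d\<close>.\<close>

definition gaussian :: "real \<Rightarrow> 'a::euclidean_space \<Rightarrow> real" where
  "gaussian d x = exp (- (d * norm x)\<^sup>2 / 2)"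

lemma gaussian_prod: "gaussian d x = (\<Prod>b\<in>Basis. exp (- (d * (x \<bullet> b))\<^sup>2 / 2))"
proof -
  have "(norm x)\<^sup>2 = (\<Sum>b\<in>Basis. (x \<bullet> b)\<^sup>2)"
    by (metis (no_types, lifting) euclidean_inner power2_eq_square power2_norm_eq_inner sum.cong)
  then show ?thesis
    by (simp add: gaussian_def power_mult_distrib sum_distrib_left exp_sum[symmetric] sum_negf sum_divide_distrib)
qed

lemma gaussian_measurable[measurable]: "gaussian d \<in> borel_measurable borel"
  unfolding gaussian_def by measurable

lemma gaussian_pos: "0 < gaussian d x"
  by (simp add: gaussian_def)

lemma cis_sum: "finite I \<Longrightarrow> cis (sum f I) = (\<Prod>i\<in>I. cis (f i))"
  by (induction I rule: finite_induct) (auto simp flip: cis_mult)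

lemma gaussian_fourier:
  fixes z :: "'a::euclidean_space"
  assumes d: "0 < d"
  shows "integrable lborel (\<lambda>\<xi>. cis (- (z \<bullet> \<xi>)) * gaussian d \<xi>)"
    and "(LINT \<xi>|lborel. cis (- (z \<bullet> \<xi>)) * gaussian d \<xi>) = (sqrt (2 * pi) / d) ^ DIM('a) * gaussian (1 / d) z"
proof -
  have eq: "cis (- (z \<bullet> \<xi>)) * gaussian d \<xi> =
      (\<Prod>b\<in>Basis. cis (- ((z \<bullet> b) * (\<xi> \<bullet> b))) * complex_of_real (exp (- (d * (\<xi> \<bullet> b))\<^sup>2 / 2)))" for \<xi>
    by (simp add: gaussian_prod prod.distrib euclidean_inner[of z \<xi>] cis_sum flip: sum_negf)
  show "integrable lborel (\<lambda>\<xi>. cis (- (z \<bullet> \<xi>)) * gaussian d \<xi>)"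
    unfolding eq by (intro lborel_integral_prod(1) gaussian_fourier_real d)
  have "(LINT \<xi>|lborel. cis (- (z \<bullet> \<xi>)) * gaussian d \<xi>) =
      (\<Prod>b\<in>Basis. complex_of_real (sqrt (2 * pi) / d * exp (- ((z \<bullet> b) / d)\<^sup>2 / 2)))"
    unfolding eq using gaussian_fourier_real[OF d]
    by (subst lborel_integral_prod(2)) auto
  also have "\<dots> = (sqrt (2 * pi) / d) ^ DIM('a) * gaussian (1 / d) z"
    by (simp only: prod.distrib of_real_mult gaussian_prod of_real_prod prod_constant divide_inverse mult_1_left of_real_power)
       (simp add: field_simps)
  finally show "(LINT \<xi>|lborel. cis (- (z \<bullet> \<xi>)) * gaussian d \<xi>) = (sqrt (2 * pi) / d) ^ DIM('a) * gaussian (1 / d) z" .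
qed

lemma gaussian_integral:
  assumes d: "0 < d"
  shows "integrable lborel (gaussian d :: 'a::euclidean_space \<Rightarrow> real)"
    and "(LINT x|lborel. gaussian d (x::'a)) = (sqrt (2 * pi) / d) ^ DIM('a)"
proof -
  have "integrable lborel (\<lambda>x. complex_of_real (gaussian d (x::'a)))"
    using gaussian_fourier(1)[OF d, of 0] by simp
  from integrable_Re[OF this] show i: "integrable lborel (gaussian d :: 'a \<Rightarrow> real)"
    by simp
  have "complex_of_real (LINT x|lborel. gaussian d (x::'a)) = complex_of_real ((sqrt (2 * pi) / d) ^ DIM('a))"
    using gaussian_fourier(2)[OF d, of 0] by (simp add: gaussian_def)
  then show "(LINT x|lborel. gaussian d (x::'a)) = (sqrt (2 * pi) / d) ^ DIM('a)"
    using of_real_eq_iff by blast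
qed

lemma nn_integral_lborel_reflect:
  fixes f :: "'a::euclidean_space \<Rightarrow> ennreal"
  assumes [measurable]: "f \<in> borel_measurable borel"
  shows "(\<integral>\<^sup>+y. f (x - y) \<partial>lborel) = (\<integral>\<^sup>+y. f y \<partial>lborel)"
proof -
  have "lborel = density (distr lborel borel (\<lambda>y. x + (-1) *\<^sub>R y)) (\<lambda>_. ennreal (\<bar>-1\<bar> ^ DIM('a)))"
    by (rule lborel_affine) simp
  then have "lborel = distr lborel borel (\<lambda>y. x - y)"
    by (simp add: density_1)
  then have "(\<integral>\<^sup>+y. f y \<partial>lborel) = (\<integral>\<^sup>+y. f y \<partial>distr lborel borel (\<lambda>y. x - y))"
    by simp
  also have "\<dots> = (\<integral>\<^sup>+y. f (x - y) \<partial>lborel)"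
    by (rule nn_integral_distr) auto
  finally show ?thesis by simp
qed

definition fourier_int :: "('a::euclidean_space \<Rightarrow> complex) \<Rightarrow> 'a \<Rightarrow> complex" where
  "fourier_int f \<xi> = (LINT x|lborel. cis (- (x \<bullet> \<xi>)) * f x)"

lemma fourier_int_measurable[measurable]:
  assumes [measurable]: "f \<in> borel_measurable borel"
  shows "fourier_int f \<in> borel_measurable borel"
proof -
  have "(\<lambda>\<xi>. LINT x|lborel. cis (- (x \<bullet> \<xi>)) * f x) \<in> borel_measurable lborel"
    by (rule lborel.borel_measurable_lebesgue_integral) measurable
  then show ?thesis unfolding fourier_int_def by simp
qed

text \<open>The Gaussian weight turns the left-hand side into a convolution with a kernel of mass (2 pi)^d.\<close>

lemma fourier_int_gaussian_bound:
  fixes f :: "'a::euclidean_space \<Rightarrow> complex"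
  assumes f: "integrable lborel f" and f2: "f \<in> elts L2" and d: "0 < d"
  shows "(LINT \<xi>|lborel. (cmod (fourier_int f \<xi>))\<^sup>2 * gaussian d \<xi>) \<le> (2 * pi) ^ DIM('a) * (nrm L2 f)\<^sup>2"
proof -
  note [measurable] = borel_measurable_integrable[OF f, simplified]
  \<comment> \<open>\<open>G\<close> will be the Fourier transform of the Gaussian weight, with the
    prefactor \<open>c\<close> of \<open>gaussian_fourier\<close>. Its mass is (2 pi)^DIM, whatever
    the value of \<open>d\<close>.\<close>
  define c where "c = (sqrt (2 * pi) / d) ^ DIM('a)"
  define G where "G z = c * gaussian (1 / d) (z :: 'a)" for z
  have [measurable]: "G \<in> borel_measurable borel" unfolding G_def by measurable
  have c: "0 \<le> c" using d by (simp add: c_def)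
  have G0: "0 \<le> G z" for z using c gaussian_pos[of "1 / d" z] by (simp add: G_def)
  have G: "(\<integral>\<^sup>+z. ennreal (G z) \<partial>lborel) = ennreal ((2 * pi) ^ DIM('a))"
  proof -
    have "(\<integral>\<^sup>+z. ennreal (G z) \<partial>lborel) = ennreal (LINT z|lborel. G z)"
      using G0 gaussian_integral[of "1 / d", where 'a='a] d
      by (intro nn_integral_eq_integral) (auto simp: G_def)
    also have "(LINT z|lborel. G z) = c * (sqrt (2 * pi) * d) ^ DIM('a)"
      using gaussian_integral[of "1 / d", where 'a='a] d by (simp add: G_def)
    also have "\<dots> = (sqrt (2 * pi) / d * (sqrt (2 * pi) * d)) ^ DIM('a)"
      by (simp only: c_def power_mult_distrib)
    also have "sqrt (2 * pi) / d * (sqrt (2 * pi) * d) = 2 * pi"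
      using d by simp
    finally show ?thesis .
  qed
  \<comment> \<open>The squared modulus of the transform is a double integral over pairs of points.
    The Gaussian weight makes the triple integral including \<xi> absolutely convergent, so the
    \<xi>-integral can be carried out first and leaves \<open>G\<close> at the difference of the two
    points.\<close>
  define k where "k p = f (fst p) * cnj (f (snd p))" for p
  define K where "K \<xi> p = gaussian d \<xi> * (cis (- ((fst p - snd p) \<bullet> \<xi>)) * k p)" for \<xi> p
  have f': "integrable lborel (\<lambda>x. cnj (f x))" using f by simp
  have k: "integrable (lborel \<Otimes>\<^sub>M lborel) k"
    unfolding k_def by (rule integral_pair_mult(1)[OF f f'])
  note [measurable] = borel_measurable_integrable[OF k]
  have Km: "(\<lambda>(\<xi>, p). K \<xi> p) \<in> borel_measurable (lborel \<Otimes>\<^sub>M (lborel \<Otimes>\<^sub>M lborel))"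
    unfolding K_def k_def by measurable
  have intk: "integrable lborel (\<lambda>\<xi>::'a. gaussian d \<xi> * (LINT p|(lborel \<Otimes>\<^sub>M lborel). norm (k p)))"
    using gaussian_integral(1)[OF d, where 'a='a] by simp
  have nK: "norm (K \<xi> p) = gaussian d \<xi> * norm (k p)" for \<xi> p
    using gaussian_pos[of d \<xi>] by (simp add: K_def norm_mult)
  interpret P: pair_sigma_finite "lborel :: 'a measure" "lborel \<Otimes>\<^sub>M lborel :: ('a \<times> 'a) measure"
    by (simp add: lborel_prod) standard
  have Kint: "integrable (lborel \<Otimes>\<^sub>M (lborel \<Otimes>\<^sub>M lborel)) (\<lambda>(\<xi>, p). K \<xi> p)"
  proof (rule P.Fubini_integrable[OF Km])
    show "integrable lborel (\<lambda>\<xi>. LINT p|(lborel \<Otimes>\<^sub>M lborel). norm (case (\<xi>, p) of (\<xi>, p) \<Rightarrow> K \<xi> p))"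
      using intk by (simp add: nK)
    have "integrable (lborel \<Otimes>\<^sub>M lborel) (K \<xi>)" for \<xi>
      unfolding K_def by (intro integrable_mult_right Bochner_Integration.integrable_bound[OF k])
        (auto simp: norm_mult)
    then show "AE \<xi> in lborel. integrable (lborel \<Otimes>\<^sub>M lborel) (\<lambda>p. case (\<xi>, p) of (\<xi>, p) \<Rightarrow> K \<xi> p)"
      by simp
  qed
  have F2: "complex_of_real ((cmod (fourier_int f \<xi>))\<^sup>2 * gaussian d \<xi>) = (LINT p|(lborel \<Otimes>\<^sub>M lborel). K \<xi> p)" for \<xi>
  proof -
    have i1: "integrable lborel (\<lambda>x. cis (- (x \<bullet> \<xi>)) * f x)"
      by (rule Bochner_Integration.integrable_bound[OF f]) (auto simp: norm_mult)
    then have i2: "integrable lborel (\<lambda>x. cnj (cis (- (x \<bullet> \<xi>)) * f x))"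
      by (rule integrable_bounded_linear[OF bounded_linear_cnj])
    have "complex_of_real ((cmod (fourier_int f \<xi>))\<^sup>2) = fourier_int f \<xi> * cnj (fourier_int f \<xi>)"
      by (rule complex_norm_square)
    also have "\<dots> = (LINT x|lborel. cis (- (x \<bullet> \<xi>)) * f x) * (LINT x|lborel. cnj (cis (- (x \<bullet> \<xi>)) * f x))"
      unfolding fourier_int_def using integral_bounded_linear[OF bounded_linear_cnj i1] by simp
    also have "\<dots> = (LINT p|(lborel \<Otimes>\<^sub>M lborel). cis (- (fst p \<bullet> \<xi>)) * f (fst p) * cnj (cis (- (snd p \<bullet> \<xi>)) * f (snd p)))"
      by (rule integral_pair_mult(2)[OF i1 i2, symmetric])
    also have "\<dots> = (LINT p|(lborel \<Otimes>\<^sub>M lborel). cis (- ((fst p - snd p) \<bullet> \<xi>)) * k p)"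
    proof (intro Bochner_Integration.integral_cong refl)
      fix p :: "'a \<times> 'a"
      have "cis (- (fst p \<bullet> \<xi>)) * cis (snd p \<bullet> \<xi>) = cis (- ((fst p - snd p) \<bullet> \<xi>))"
        by (simp add: cis_mult inner_diff_left)
      then show "cis (- (fst p \<bullet> \<xi>)) * f (fst p) * cnj (cis (- (snd p \<bullet> \<xi>)) * f (snd p)) =
          cis (- ((fst p - snd p) \<bullet> \<xi>)) * k p"
        by (simp add: k_def cis_cnj mult_ac)
    qed
    finally show ?thesis by (simp add: K_def mult.commute)
  qed
  \<comment> \<open>Schur's test: 2 |f(x)| |f(y)| <= |f(x)|^2 + |f(y)|^2, and in each half the
    integration over the other variable just gives the mass of \<open>G\<close>.\<close>
  have kG: "norm (LINT p|(lborel \<Otimes>\<^sub>M lborel). k p * G (fst p - snd p)) \<le> (2 * pi) ^ DIM('a) * (nrm L2 f)\<^sup>2"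
  proof -
    have le: "ennreal (norm (k p * G (fst p - snd p))) \<le>
        ennreal ((norm (f (fst p)))\<^sup>2 / 2) * ennreal (G (fst p - snd p))
        + ennreal ((norm (f (snd p)))\<^sup>2 / 2) * ennreal (G (fst p - snd p))" for p
    proof -
      have "2 * cmod (f (fst p)) * cmod (f (snd p)) \<le> (cmod (f (fst p)))\<^sup>2 + (cmod (f (snd p)))\<^sup>2"
        by (rule sum_squares_bound)
      then have "norm (k p * G (fst p - snd p)) \<le> ((norm (f (fst p)))\<^sup>2 / 2 + (norm (f (snd p)))\<^sup>2 / 2) * G (fst p - snd p)"
        using G0[of "fst p - snd p"] unfolding k_def norm_mult
        by (intro mult_mono) auto
      then have "ennreal (norm (k p * G (fst p - snd p))) \<le> ennreal (((norm (f (fst p)))\<^sup>2 / 2 + (norm (f (snd p)))\<^sup>2 / 2) * G (fst p - snd p))"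
        by (rule ennreal_leI)
      also have "\<dots> = ennreal ((norm (f (fst p)))\<^sup>2 / 2) * ennreal (G (fst p - snd p))
        + ennreal ((norm (f (snd p)))\<^sup>2 / 2) * ennreal (G (fst p - snd p))"
        using G0 by (simp add: distrib_right flip: ennreal_mult ennreal_plus)
      finally show ?thesis .
    qed
    have half: "(\<integral>\<^sup>+x. ennreal ((norm (f x))\<^sup>2 / 2) \<partial>lborel) = ennreal ((nrm L2 f)\<^sup>2 / 2)"
      using f2 by (subst nn_integral_eq_integral) (auto simp: elts_L2 nrm_L2_power2)
    have refl1: "(\<integral>\<^sup>+y. ennreal (G (x - y)) \<partial>lborel) = ennreal ((2 * pi) ^ DIM('a))" for x
      using nn_integral_lborel_reflect[of "\<lambda>y. ennreal (G y)" x] G by simp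
    have sym: "G (x - y) = G (y - x)" for x y
      by (simp add: G_def gaussian_def norm_minus_commute)
    have refl2: "(\<integral>\<^sup>+x. ennreal (G (x - y)) \<partial>lborel) = ennreal ((2 * pi) ^ DIM('a))" for y
    proof -
      have "(\<lambda>x. ennreal (G (x - y))) = (\<lambda>x. ennreal (G (y - x)))" by (rule ext) (metis sym)
      then show ?thesis using refl1[of y] by simp
    qed
    have 1: "(\<integral>\<^sup>+p. ennreal ((norm (f (fst p)))\<^sup>2 / 2) * ennreal (G (fst p - snd p)) \<partial>(lborel \<Otimes>\<^sub>M lborel))
        = ennreal ((nrm L2 f)\<^sup>2 / 2) * ennreal ((2 * pi) ^ DIM('a))"
      by (subst lborel.nn_integral_fst[symmetric])
         (auto simp: nn_integral_cmult refl1 nn_integral_multc half)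
    have 2: "(\<integral>\<^sup>+p. ennreal ((norm (f (snd p)))\<^sup>2 / 2) * ennreal (G (fst p - snd p)) \<partial>(lborel \<Otimes>\<^sub>M lborel))
        = ennreal ((nrm L2 f)\<^sup>2 / 2) * ennreal ((2 * pi) ^ DIM('a))"
      by (subst lborel_pair.nn_integral_snd[symmetric])
         (auto simp: nn_integral_cmult refl2 nn_integral_multc half)
    have "G z \<le> c" for z using c by (simp add: G_def gaussian_def mult_left_le)
    then have "cmod (k p) * \<bar>G z\<bar> \<le> c * cmod (k p)" for p z
      using G0[of z] mult_right_mono[of "G z" c "cmod (k p)"] by (simp add: mult.commute)
    then have i: "integrable (lborel \<Otimes>\<^sub>M lborel) (\<lambda>p. k p * G (fst p - snd p))"
      by (intro Bochner_Integration.integrable_bound[OF integrable_mult_right[OF k, of "complex_of_real c"]])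
         (use c in \<open>auto simp: norm_mult\<close>)
    have "ennreal (norm (LINT p|(lborel \<Otimes>\<^sub>M lborel). k p * G (fst p - snd p)))
       \<le> (\<integral>\<^sup>+p. ennreal (norm (k p * G (fst p - snd p))) \<partial>(lborel \<Otimes>\<^sub>M lborel))"
      by (rule integral_norm_bound_ennreal[OF i])
    also have "\<dots> \<le> (\<integral>\<^sup>+p. ennreal ((norm (f (fst p)))\<^sup>2 / 2) * ennreal (G (fst p - snd p))
        + ennreal ((norm (f (snd p)))\<^sup>2 / 2) * ennreal (G (fst p - snd p)) \<partial>(lborel \<Otimes>\<^sub>M lborel))"
      by (rule nn_integral_mono) (rule le)
    also have "\<dots> = ennreal ((nrm L2 f)\<^sup>2 / 2) * ennreal ((2 * pi) ^ DIM('a)) + ennreal ((nrm L2 f)\<^sup>2 / 2) * ennreal ((2 * pi) ^ DIM('a))"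
      by (subst nn_integral_add) (auto simp: 1 2)
    also have "\<dots> = ennreal ((2 * pi) ^ DIM('a) * (nrm L2 f)\<^sup>2)"
      by (simp add: field_simps flip: ennreal_mult ennreal_plus)
    finally show ?thesis by simp
  qed
  have "complex_of_real (LINT \<xi>|lborel. (cmod (fourier_int f \<xi>))\<^sup>2 * gaussian d \<xi>)
      = (LINT \<xi>|lborel. LINT p|(lborel \<Otimes>\<^sub>M lborel). K \<xi> p)"
    by (simp only: F2[symmetric] integral_complex_of_real)
  also have "\<dots> = (LINT p|(lborel \<Otimes>\<^sub>M lborel). LINT \<xi>|lborel. K \<xi> p)"
    by (rule P.Fubini_integral[OF Kint, symmetric])
  also have "\<dots> = (LINT p|(lborel \<Otimes>\<^sub>M lborel). k p * G (fst p - snd p))"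
  proof (intro Bochner_Integration.integral_cong refl)
    fix p :: "'a \<times> 'a"
    have "(LINT \<xi>|lborel. K \<xi> p) = (LINT \<xi>|lborel. (cis (- ((fst p - snd p) \<bullet> \<xi>)) * gaussian d \<xi>) * k p)"
      by (simp add: K_def mult_ac)
    also have "\<dots> = (LINT \<xi>|lborel. cis (- ((fst p - snd p) \<bullet> \<xi>)) * gaussian d \<xi>) * k p"
      by (rule integral_mult_left_zero)
    also have "\<dots> = complex_of_real ((sqrt (2 * pi) / d) ^ DIM('a) * gaussian (1 / d) (fst p - snd p)) * k p"
      by (simp only: gaussian_fourier(2)[OF d] of_real_mult of_real_power)
    finally show "(LINT \<xi>|lborel. K \<xi> p) = k p * G (fst p - snd p)"
      by (simp only: G_def c_def mult.commute)
  qed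
  finally have "norm (complex_of_real (LINT \<xi>|lborel. (cmod (fourier_int f \<xi>))\<^sup>2 * gaussian d \<xi>)) \<le> (2 * pi) ^ DIM('a) * (nrm L2 f)\<^sup>2"
    using kG by simp
  then show ?thesis by simp
qed

text \<open>The bound with Gaussian weight does not depend on the width, so Fatou's lemma removes
  the weight. This is the inequality half of Plancherel's theorem for functions that are both
  integrable and square integrable.\<close>

lemma fourier_int_L2:
  fixes f :: "'a::euclidean_space \<Rightarrow> complex"
  assumes f: "integrable lborel f" and f2: "f \<in> elts L2"
  shows "fourier_int f \<in> elts L2"
    and "nrm L2 (fourier_int f) \<le> sqrt ((2 * pi) ^ DIM('a)) * nrm L2 f"
proof -
  note [measurable] = borel_measurable_integrable[OF f, simplified]
  have bd: "cmod (fourier_int f \<xi>) \<le> (LINT x|lborel. norm (f x))" for \<xi>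
    unfolding fourier_int_def
    using integral_norm_bound[of lborel "\<lambda>x. cis (- (x \<bullet> \<xi>)) * f x"] by (simp add: norm_mult)
  \<comment> \<open>The factor sqrt 2 is chosen so that the square of the weight is the Gaussian
    with parameter 1/(n+1).\<close>
  define F where "F n \<xi> = fourier_int f \<xi> * gaussian (1 / (sqrt 2 * real (Suc n))) \<xi>" for n \<xi>
  have sq: "(cmod (F n \<xi>))\<^sup>2 = (cmod (fourier_int f \<xi>))\<^sup>2 * gaussian (1 / real (Suc n)) \<xi>" for n \<xi>
  proof -
    have "(gaussian (1 / (sqrt 2 * real (Suc n))) \<xi>)\<^sup>2 = gaussian (1 / real (Suc n)) \<xi>"
      by (simp add: gaussian_def power_mult_distrib power_divide flip: exp_of_nat_mult)
    then show ?thesis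
      by (simp add: F_def norm_mult power_mult_distrib)
  qed
  have int: "integrable lborel (\<lambda>\<xi>. (cmod (fourier_int f \<xi>))\<^sup>2 * gaussian (1 / real (Suc n)) \<xi>)" for n
  proof (rule Bochner_Integration.integrable_bound)
    show "integrable lborel (\<lambda>\<xi>. (LINT x|lborel. norm (f x))\<^sup>2 * gaussian (1 / real (Suc n)) (\<xi>::'a))"
      by (intro integrable_mult_right gaussian_integral) simp
    have "0 \<le> (LINT x|lborel. norm (f x))" by simp
    then show "AE \<xi> in lborel. norm ((cmod (fourier_int f \<xi>))\<^sup>2 * gaussian (1 / real (Suc n)) \<xi>)
        \<le> norm ((LINT x|lborel. norm (f x))\<^sup>2 * gaussian (1 / real (Suc n)) \<xi>)"
      using bd gaussian_pos[THEN less_imp_le]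
      by (auto simp: abs_mult intro!: mult_mono power_mono AE_I2)
  qed measurable
  have FL2: "F n \<in> elts L2" for n
  proof -
    have "F n \<in> borel_measurable borel" unfolding F_def by measurable
    then show ?thesis using int[of n] by (simp add: elts_L2 sq)
  qed
  have Fb: "nrm L2 (F n) \<le> sqrt ((2 * pi) ^ DIM('a)) * nrm L2 f" for n
  proof (rule power2_le_imp_le)
    show "(nrm L2 (F n))\<^sup>2 \<le> (sqrt ((2 * pi) ^ DIM('a)) * nrm L2 f)\<^sup>2"
      using fourier_int_gaussian_bound[OF f f2, of "1 / real (Suc n)"]
      by (simp add: nrm_L2_power2[of "F n"] sq power_mult_distrib)
  qed simp
  have lim: "AE \<xi> in lborel. (\<lambda>n. F n \<xi>) \<longlonglongrightarrow> fourier_int f \<xi>"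
  proof (rule AE_I2)
    fix \<xi> :: 'a
    have "(\<lambda>n. gaussian (1 / (sqrt 2 * real (Suc n))) \<xi>) \<longlonglongrightarrow> 1"
    proof -
      have "(\<lambda>n. norm \<xi> / sqrt 2 / real (Suc n)) \<longlonglongrightarrow> 0"
        by (rule LIMSEQ_Suc[OF lim_const_over_n])
      then have "(\<lambda>n. exp (- (norm \<xi> / sqrt 2 / real (Suc n))\<^sup>2 / 2)) \<longlonglongrightarrow> exp (- 0\<^sup>2 / 2)"
        by (intro tendsto_intros) auto
      then show ?thesis by (simp add: gaussian_def)
    qed
    then have "(\<lambda>n. F n \<xi>) \<longlonglongrightarrow> fourier_int f \<xi> * complex_of_real 1"
      unfolding F_def by (intro tendsto_intros tendsto_of_real)
    then show "(\<lambda>n. F n \<xi>) \<longlonglongrightarrow> fourier_int f \<xi>" by simp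
  qed
  show "fourier_int f \<in> elts L2" "nrm L2 (fourier_int f) \<le> sqrt ((2 * pi) ^ DIM('a)) * nrm L2 f"
    using L2_Fatou[OF FL2 Fb _ lim] by auto
qed

section \<open>The Fourier transform on square-integrable functions\<close>

definition truncate :: "real \<Rightarrow> ('a::euclidean_space \<Rightarrow> complex) \<Rightarrow> 'a \<Rightarrow> complex" where
  "truncate R f x = indicator (cball 0 R) x * f x"

lemma L2_indicator_mult_integrable:
  fixes f :: "'a::euclidean_space \<Rightarrow> complex"
  assumes f: "f \<in> elts L2" and A: "A \<in> sets borel" "emeasure lborel A < \<infinity>"
  shows "integrable lborel (\<lambda>x. indicator A x * f x)"
proof -
  have "(\<lambda>x. indicator A x :: complex) \<in> elts L2"
  proof -
    have "integrable lborel (\<lambda>x. indicator A x :: real)" using A by simp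
    moreover have "(cmod (indicator A x))\<^sup>2 = indicator A x" for x by (auto simp: indicator_def)
    ultimately show ?thesis using A by (simp add: elts_L2)
  qed
  from L2_mult_integrable(1)[OF this f] show ?thesis .
qed

lemma truncate_L2:
  fixes f :: "'a::euclidean_space \<Rightarrow> complex"
  assumes f: "f \<in> elts L2"
  shows "truncate R f \<in> elts L2" and "nrm L2 (truncate R f) \<le> nrm L2 f" and "integrable lborel (truncate R f)"
proof -
  note [measurable] = L2_measurable[OF f]
  have [measurable]: "cball (0::'a) R \<in> sets borel" by simp
  have "truncate R f \<in> borel_measurable borel" unfolding truncate_def by measurable
  moreover have "AE x in lborel. norm (truncate R f x) \<le> 1 * norm (f x)"
    by (auto simp: truncate_def indicator_def)
  ultimately show "truncate R f \<in> elts L2" "nrm L2 (truncate R f) \<le> nrm L2 f"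
    using L2_dominated[OF f, of "truncate R f" 1] by auto
  show "integrable lborel (truncate R f)"
    unfolding truncate_def using emeasure_lborel_cball_finite[of 0 R]
    by (intro L2_indicator_mult_integrable f) auto
qed

lemma fourier_ball_eq: "fourier_ball R f = fourier_int (truncate R f)"
  unfolding fourier_ball_def fourier_int_def set_lebesgue_integral_def truncate_def
  by (intro ext Bochner_Integration.integral_cong refl) (auto simp: indicator_def)

lemma fourier_int_integrable:
  assumes f: "integrable lborel f"
  shows "integrable lborel (\<lambda>x. cis (- (x \<bullet> \<xi>)) * f x)"
  using borel_measurable_integrable[OF f]
  by (intro Bochner_Integration.integrable_bound[OF f]) (auto simp: norm_mult)

lemma fourier_int_diff:
  assumes f: "integrable lborel f" and g: "integrable lborel g"
  shows "fourier_int (\<lambda>x. f x - g x) = (\<lambda>\<xi>. fourier_int f \<xi> - fourier_int g \<xi>)"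
  unfolding fourier_int_def right_diff_distrib
  by (intro ext Bochner_Integration.integral_diff fourier_int_integrable f g)

text \<open>The property by which \<open>fourier_L2\<close> is picked, stated for an arbitrary
  candidate. The chosen representative is known only through it, so identities are proved by
  verifying the property for the other side and using uniqueness almost everywhere.\<close>

definition is_fourier_L2 :: "('a::euclidean_space \<Rightarrow> complex) \<Rightarrow> ('a \<Rightarrow> complex) \<Rightarrow> bool" where
  "is_fourier_L2 f F \<longleftrightarrow> F \<in> elts L2 \<and> ((\<lambda>R. nrm L2 (\<lambda>\<xi>. fourier_ball R f \<xi> - F \<xi>)) \<longlongrightarrow> 0) at_top"

lemma fourier_ball_L2:
  fixes f :: "'a::euclidean_space \<Rightarrow> complex"
  assumes f: "f \<in> elts L2"
  shows "fourier_ball R f \<in> elts L2"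
    and "nrm L2 (fourier_ball R f) \<le> sqrt ((2 * pi) ^ DIM('a)) * nrm L2 f"
proof -
  show "fourier_ball R f \<in> elts L2"
    unfolding fourier_ball_eq by (intro fourier_int_L2 truncate_L2 f)
  have "nrm L2 (fourier_ball R f) \<le> sqrt ((2 * pi) ^ DIM('a)) * nrm L2 (truncate R f)"
    unfolding fourier_ball_eq by (intro fourier_int_L2 truncate_L2 f)
  also have "\<dots> \<le> sqrt ((2 * pi) ^ DIM('a)) * nrm L2 f"
    by (intro mult_left_mono truncate_L2 f) auto
  finally show "nrm L2 (fourier_ball R f) \<le> sqrt ((2 * pi) ^ DIM('a)) * nrm L2 f" .
qed

text \<open>Two ball integrals differ by the transform of \<open>f\<close> restricted to a shell,
  whose L2 norm is controlled by the part of \<open>f\<close> outside the smaller ball. Completeness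
  then provides a limit along integer radii.\<close>

lemma is_fourier_L2_exists:
  fixes f :: "'a::euclidean_space \<Rightarrow> complex"
  assumes f: "f \<in> elts L2"
  shows "\<exists>F. is_fourier_L2 f F"
proof -
  note [measurable] = L2_measurable[OF f]
  define C where "C = sqrt ((2 * pi) ^ DIM('a))"
  have C: "0 \<le> C" by (simp add: C_def)
  define t where "t n = (\<lambda>x. f x - truncate (real n) f x)" for n :: nat
  have [measurable]: "cball (0::'a) R \<in> sets borel" for R by simp
  have tm: "t n \<in> borel_measurable borel" for n unfolding t_def truncate_def by measurable
  have t0: "(\<lambda>n. nrm L2 (t n)) \<longlonglongrightarrow> 0"
  proof (rule L2_dominated_tendsto[OF f tm])
    show "AE x in lborel. norm (t n x) \<le> norm (f x)" for n
      by (auto simp: t_def truncate_def indicator_def)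
    have "(\<lambda>n. t n x) \<longlonglongrightarrow> 0" for x
    proof (rule tendsto_eventually)
      obtain N :: nat where "norm x \<le> real N" using real_arch_simple by blast
      then show "\<forall>\<^sub>F n in sequentially. t n x = 0"
        by (intro eventually_sequentiallyI[of N]) (auto simp: t_def truncate_def)
    qed
    then show "AE x in lborel. (\<lambda>n. t n x) \<longlonglongrightarrow> 0" by simp
  qed
  \<comment> \<open>The restriction to the shell is dominated by the whole tail \<open>t n\<close>,
    so the bound is uniform in the outer radius. This gives the Cauchy property and also handles
    non-integer radii.\<close>
  have step: "nrm L2 (\<lambda>\<xi>. fourier_ball R f \<xi> - fourier_ball (real n) f \<xi>) \<le> C * nrm L2 (t n)" if "real n \<le> R" for R n
  proof -
    let ?h = "\<lambda>x. truncate R f x - truncate (real n) f x"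
    have h: "?h \<in> elts L2" "integrable lborel ?h"
      by (intro L2_diff truncate_L2 f Bochner_Integration.integrable_diff)+
    have tL: "t n \<in> elts L2" unfolding t_def by (intro L2_diff truncate_L2 f)
    have "nrm L2 (fourier_int ?h) \<le> C * nrm L2 ?h"
      unfolding C_def by (rule fourier_int_L2(2)[OF h(2,1)])
    also have "nrm L2 ?h \<le> 1 * nrm L2 (t n)"
      using that by (intro L2_dominated(2)[OF tL L2_measurable[OF h(1)]])
        (auto simp: t_def truncate_def indicator_def)
    finally show ?thesis
      using C unfolding fourier_ball_eq
      by (simp add: fourier_int_diff[OF truncate_L2(3)[OF f] truncate_L2(3)[OF f]] mult_left_mono)
  qed
  have st0: "(\<lambda>n. C * nrm L2 (t n)) \<longlonglongrightarrow> 0" using tendsto_mult_right_zero[OF t0] by simp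
  have CauchyF: "\<exists>N. \<forall>m\<ge>N. \<forall>n\<ge>N. nrm L2 (\<lambda>x. fourier_ball (real m) f x - fourier_ball (real n) f x) < e"
    if e: "0 < e" for e
  proof -
    obtain N where N: "\<And>n. n \<ge> N \<Longrightarrow> C * nrm L2 (t n) < e"
      using order_tendstoD(2)[OF st0 e] by (auto simp: eventually_sequentially)
    have "nrm L2 (\<lambda>x. fourier_ball (real m) f x - fourier_ball (real n) f x) < e" if "m \<ge> N" "n \<ge> N" for m n
    proof (cases "n \<le> m")
      case True
      then show ?thesis using step[of n "real m"] N[OF \<open>n \<ge> N\<close>] by simp
    next
      case False
      then show ?thesis using step[of m "real n"] N[OF \<open>m \<ge> N\<close>]
        by (subst nrm_L2_diff_commute) simp
    qed
    then show ?thesis by blast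
  qed
  obtain F where F: "F \<in> elts L2" "(\<lambda>n. nrm L2 (\<lambda>x. fourier_ball (real n) f x - F x)) \<longlonglongrightarrow> 0"
    using L2_complete[OF fourier_ball_L2(1)[OF f] CauchyF] by blast
  \<comment> \<open>From integer to real radii: one fixed large integer \<open>n\<close> is inserted
    between \<open>R\<close> and the limit.\<close>
  have "((\<lambda>R. nrm L2 (\<lambda>\<xi>. fourier_ball R f \<xi> - F \<xi>)) \<longlongrightarrow> 0) at_top"
  proof (rule tendstoI)
    fix e :: real assume e: "0 < e"
    have "\<forall>\<^sub>F n in sequentially. C * nrm L2 (t n) < e / 2 \<and> nrm L2 (\<lambda>x. fourier_ball (real n) f x - F x) < e / 2"
      using e by (intro eventually_conj order_tendstoD(2)[OF st0] order_tendstoD(2)[OF F(2)]) auto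
    then obtain n where n: "C * nrm L2 (t n) < e / 2" "nrm L2 (\<lambda>x. fourier_ball (real n) f x - F x) < e / 2"
      using eventually_happens'[OF sequentially_bot] by blast
    show "\<forall>\<^sub>F R in at_top. dist (nrm L2 (\<lambda>\<xi>. fourier_ball R f \<xi> - F \<xi>)) 0 < e"
    proof (rule eventually_at_top_linorderI[of "real n"])
      fix R assume "real n \<le> R"
      then show "dist (nrm L2 (\<lambda>\<xi>. fourier_ball R f \<xi> - F \<xi>)) 0 < e"
        using step[of n R] n L2_triangle[OF fourier_ball_L2(1)[OF f] fourier_ball_L2(1)[OF f] F(1), of R "real n"]
        by simp
    qed
  qed
  then show ?thesis using F(1) by (auto simp: is_fourier_L2_def)
qed

lemma fourier_L2_spec:
  assumes f: "f \<in> elts L2"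
  shows "is_fourier_L2 f (fourier_L2 f)"
  using someI_ex[OF is_fourier_L2_exists[OF f]]
  unfolding fourier_L2_def is_fourier_L2_def fun_diff_def .

lemma is_fourier_L2_unique:
  assumes f: "f \<in> elts L2" and F: "is_fourier_L2 f F" and G: "is_fourier_L2 f G"
  shows "AE \<xi> in lborel. F \<xi> = G \<xi>"
proof -
  have FG: "F \<in> elts L2" "G \<in> elts L2" using F G by (auto simp: is_fourier_L2_def)
  have "((\<lambda>R. nrm L2 (\<lambda>\<xi>. fourier_ball R f \<xi> - F \<xi>) + nrm L2 (\<lambda>\<xi>. fourier_ball R f \<xi> - G \<xi>)) \<longlongrightarrow> 0 + 0) at_top"
    using F G by (intro tendsto_add) (auto simp: is_fourier_L2_def)
  moreover have "nrm L2 (\<lambda>\<xi>. F \<xi> - G \<xi>) \<le> nrm L2 (\<lambda>\<xi>. fourier_ball R f \<xi> - F \<xi>) + nrm L2 (\<lambda>\<xi>. fourier_ball R f \<xi> - G \<xi>)" for R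
    using L2_triangle[OF FG(1) fourier_ball_L2(1)[OF f] FG(2), of R] nrm_L2_diff_commute[of F "fourier_ball R f"] by simp
  ultimately have "nrm L2 (\<lambda>\<xi>. F \<xi> - G \<xi>) \<le> 0 + 0"
    by (intro tendsto_lowerbound[where F="at_top::real filter"]) (auto intro: always_eventually)
  then have "nrm L2 (\<lambda>\<xi>. F \<xi> - G \<xi>) = 0" by (simp add: antisym)
  then show ?thesis
    using nrm_L2_eq_0[OF L2_diff(1)[OF FG]] by simp
qed

lemma fourier_L2_L2:
  fixes f :: "'a::euclidean_space \<Rightarrow> complex"
  assumes f: "f \<in> elts L2"
  shows "fourier_L2 f \<in> elts L2"
    and "nrm L2 (fourier_L2 f) \<le> sqrt ((2 * pi) ^ DIM('a)) * nrm L2 f"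
proof -
  have F: "fourier_L2 f \<in> elts L2" "((\<lambda>R. nrm L2 (\<lambda>\<xi>. fourier_ball R f \<xi> - fourier_L2 f \<xi>)) \<longlongrightarrow> 0) at_top"
    using fourier_L2_spec[OF f] by (auto simp: is_fourier_L2_def)
  then show "fourier_L2 f \<in> elts L2" by simp
  have "nrm L2 (fourier_L2 f) \<le> nrm L2 (\<lambda>\<xi>. fourier_ball R f \<xi> - fourier_L2 f \<xi>) + sqrt ((2 * pi) ^ DIM('a)) * nrm L2 f" for R
    using L2_triangle[OF F(1) fourier_ball_L2(1)[OF f] L2_zero(1), of R] fourier_ball_L2(2)[OF f, of R]
      nrm_L2_diff_commute[of "fourier_L2 f" "fourier_ball R f"] by simp
  moreover have "((\<lambda>R. nrm L2 (\<lambda>\<xi>. fourier_ball R f \<xi> - fourier_L2 f \<xi>) + sqrt ((2 * pi) ^ DIM('a)) * nrm L2 f)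
      \<longlongrightarrow> 0 + sqrt ((2 * pi) ^ DIM('a)) * nrm L2 f) at_top"
    by (intro tendsto_add F(2) tendsto_const)
  ultimately have "nrm L2 (fourier_L2 f) \<le> 0 + sqrt ((2 * pi) ^ DIM('a)) * nrm L2 f"
    by (intro tendsto_lowerbound[where F="at_top::real filter"]) (auto intro: always_eventually)
  then show "nrm L2 (fourier_L2 f) \<le> sqrt ((2 * pi) ^ DIM('a)) * nrm L2 f" by simp
qed

lemma fourier_L2_diff:
  assumes f: "f \<in> elts L2" and g: "g \<in> elts L2"
  shows "AE \<xi> in lborel. fourier_L2 (\<lambda>x. f x - g x) \<xi> = fourier_L2 f \<xi> - fourier_L2 g \<xi>"
proof (rule is_fourier_L2_unique[OF L2_diff(1)[OF f g] fourier_L2_spec[OF L2_diff(1)[OF f g]]])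
  have F: "fourier_L2 f \<in> elts L2" "((\<lambda>R. nrm L2 (\<lambda>\<xi>. fourier_ball R f \<xi> - fourier_L2 f \<xi>)) \<longlongrightarrow> 0) at_top"
    and G: "fourier_L2 g \<in> elts L2" "((\<lambda>R. nrm L2 (\<lambda>\<xi>. fourier_ball R g \<xi> - fourier_L2 g \<xi>)) \<longlongrightarrow> 0) at_top"
    using fourier_L2_spec[OF f] fourier_L2_spec[OF g] by (auto simp: is_fourier_L2_def)
  have eq: "fourier_ball R (\<lambda>x. f x - g x) = (\<lambda>\<xi>. fourier_ball R f \<xi> - fourier_ball R g \<xi>)" for R
  proof -
    have "truncate R (\<lambda>x. f x - g x) = (\<lambda>x. truncate R f x - truncate R g x)"
      by (auto simp: truncate_def right_diff_distrib)
    then show ?thesis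
      unfolding fourier_ball_eq by (simp add: fourier_int_diff truncate_L2(3)[OF f] truncate_L2(3)[OF g])
  qed
  have le: "nrm L2 (\<lambda>\<xi>. fourier_ball R (\<lambda>x. f x - g x) \<xi> - (fourier_L2 f \<xi> - fourier_L2 g \<xi>))
      \<le> nrm L2 (\<lambda>\<xi>. fourier_ball R f \<xi> - fourier_L2 f \<xi>) + nrm L2 (\<lambda>\<xi>. fourier_ball R g \<xi> - fourier_L2 g \<xi>)" for R
    using L2_diff(2)[OF L2_diff(1)[OF fourier_ball_L2(1)[OF f] F(1)] L2_diff(1)[OF fourier_ball_L2(1)[OF g] G(1)], of R R]
    by (simp add: eq algebra_simps)
  have "((\<lambda>R. nrm L2 (\<lambda>\<xi>. fourier_ball R f \<xi> - fourier_L2 f \<xi>) + nrm L2 (\<lambda>\<xi>. fourier_ball R g \<xi> - fourier_L2 g \<xi>)) \<longlongrightarrow> 0) at_top"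
    using tendsto_add[OF F(2) G(2)] by simp
  then have "((\<lambda>R. nrm L2 (\<lambda>\<xi>. fourier_ball R (\<lambda>x. f x - g x) \<xi> - (fourier_L2 f \<xi> - fourier_L2 g \<xi>))) \<longlongrightarrow> 0) at_top"
    by (rule tendsto_sandwich[OF always_eventually always_eventually tendsto_const, rotated 2])
       (simp_all add: le)
  then show "is_fourier_L2 (\<lambda>x. f x - g x) (\<lambda>\<xi>. fourier_L2 f \<xi> - fourier_L2 g \<xi>)"
    using L2_diff(1)[OF F(1) G(1)] by (simp add: is_fourier_L2_def)
qed

text \<open>Truncation at any radius from \<open>R0\<close> on changes nothing, so the ball
  integrals are eventually constant. This ties the chosen representative to an explicit integral,
  with which one can calculate.\<close>

lemma fourier_L2_eq_fourier_int:
  assumes f: "f \<in> elts L2" and supp: "\<And>x. f x \<noteq> 0 \<Longrightarrow> norm x \<le> R0"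
  shows "AE \<xi> in lborel. fourier_L2 f \<xi> = fourier_int f \<xi>"
proof (rule is_fourier_L2_unique[OF f fourier_L2_spec[OF f]])
  have tr: "truncate R f = f" if "R0 \<le> R" for R
    using supp that by (force simp: truncate_def indicator_def)
  have int: "integrable lborel f" using truncate_L2(3)[OF f, of R0] by (simp add: tr)
  have "\<forall>\<^sub>F R in at_top. nrm L2 (\<lambda>\<xi>. fourier_ball R f \<xi> - fourier_int f \<xi>) = 0"
    by (rule eventually_at_top_linorderI[of R0]) (simp add: fourier_ball_eq tr L2_zero)
  then show "is_fourier_L2 f (fourier_int f)"
    using fourier_int_L2(1)[OF int f] by (auto simp: is_fourier_L2_def intro: tendsto_eventually)
qed

section \<open>The inverse transform\<close>

lemma inv_fourier_ball_eq:
  fixes f :: "'a::euclidean_space \<Rightarrow> complex"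
  shows "inv_fourier_ball R f x = cnj (fourier_ball R (\<lambda>\<xi>. cnj (f \<xi>)) x) / of_real ((2 * pi) ^ DIM('a))"
proof -
  have "(LINT \<xi>:cball 0 R|lborel. cis (x \<bullet> \<xi>) * f \<xi>) = cnj (fourier_ball R (\<lambda>\<xi>. cnj (f \<xi>)) x)"
    unfolding fourier_ball_def set_lebesgue_integral_def Bochner_Integration.integral_cnj[symmetric]
    by (intro Bochner_Integration.integral_cong refl) (simp add: cis_cnj inner_commute)
  then show ?thesis by (simp add: inv_fourier_ball_def)
qed

text \<open>Conjugating twice expresses the inverse transform by the forward one, at the level of
  ball integrals and hence for the limits; existence, bounds and linearity are thereby
  inherited.\<close>

lemma inv_fourier_L2_eq:
  fixes f :: "'a::euclidean_space \<Rightarrow> complex"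
  assumes f: "f \<in> elts L2"
  shows "inv_fourier_L2 f \<in> elts L2"
    and "AE x in lborel. inv_fourier_L2 f x = cnj (fourier_L2 (\<lambda>\<xi>. cnj (f \<xi>)) x) / of_real ((2 * pi) ^ DIM('a))"
proof -
  let ?c = "complex_of_real (1 / (2 * pi) ^ DIM('a))"
  let ?g = "\<lambda>\<xi>. cnj (f \<xi>)"
  let ?P = "\<lambda>F. F \<in> elts L2 \<and> ((\<lambda>R. nrm L2 (\<lambda>x. inv_fourier_ball R f x - F x)) \<longlongrightarrow> 0) at_top"
  have g: "?g \<in> elts L2" by (rule L2_cnj(1)[OF f])
  have fb: "inv_fourier_ball R f = (\<lambda>x. ?c * cnj (fourier_ball R ?g x))" for R
    by (simp add: fun_eq_iff inv_fourier_ball_eq)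
  have G: "fourier_L2 ?g \<in> elts L2" "((\<lambda>R. nrm L2 (\<lambda>\<xi>. fourier_ball R ?g \<xi> - fourier_L2 ?g \<xi>)) \<longlongrightarrow> 0) at_top"
    using fourier_L2_spec[OF g] by (auto simp: is_fourier_L2_def)
  have fbL: "fourier_ball R ?g \<in> elts L2" for R by (rule fourier_ball_L2(1)[OF g])
  have n: "nrm L2 (\<lambda>x. ?c * cnj (fourier_ball R ?g x) - ?c * cnj (H x)) = cmod ?c * nrm L2 (\<lambda>x. fourier_ball R ?g x - H x)"
    if "H \<in> elts L2" for R H
    using L2_scale(2)[OF L2_cnj(1)[OF L2_diff(1)[OF fbL[of R] that]], of ?c] L2_cnj(2)[OF L2_diff(1)[OF fbL[of R] that]]
    by (simp add: right_diff_distrib)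
  have "?P (\<lambda>x. ?c * cnj (fourier_L2 ?g x))"
    unfolding fb n[OF G(1)] using tendsto_mult_right_zero[OF G(2), of "cmod ?c"] L2_scale(1)[OF L2_cnj(1)[OF G(1)], of ?c]
    by blast
  then have P: "?P (inv_fourier_L2 f)"
    unfolding inv_fourier_L2_def fun_diff_def by (rule someI[of ?P])
  then show "inv_fourier_L2 f \<in> elts L2" by simp
  \<comment> \<open>Undoing the scalar and the conjugation on the chosen inverse transform gives a
    candidate for the forward transform of the conjugate of \<open>f\<close>; uniqueness identifies
    it.\<close>
  let ?H = "\<lambda>x. cnj (inv_fourier_L2 f x / ?c)"
  have H: "?H \<in> elts L2"
    using L2_cnj(1)[OF L2_scale(1)[OF conjunct1[OF P], of "inverse ?c"]] by (simp add: field_simps)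
  have "((\<lambda>R. cmod ?c * nrm L2 (\<lambda>x. fourier_ball R ?g x - ?H x)) \<longlongrightarrow> 0) at_top"
    using P unfolding n[OF H, symmetric] fb by simp
  from tendsto_mult_right_zero[OF this, of "inverse (cmod ?c)"] have "is_fourier_L2 ?g ?H"
    using H by (simp add: is_fourier_L2_def field_simps)
  from is_fourier_L2_unique[OF g this fourier_L2_spec[OF g]]
  show "AE x in lborel. inv_fourier_L2 f x = cnj (fourier_L2 ?g x) / of_real ((2 * pi) ^ DIM('a))"
  proof eventually_elim
    fix x assume "?H x = fourier_L2 ?g x"
    then have "cnj (fourier_L2 ?g x) = inv_fourier_L2 f x / ?c" by (metis complex_cnj_cnj)
    then show "inv_fourier_L2 f x = cnj (fourier_L2 ?g x) / of_real ((2 * pi) ^ DIM('a))" by simp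
  qed
qed

text \<open>The prefactor (2 pi)^-DIM is simply estimated by 1. The sharp constant would be (2
  pi)^(-DIM/2), but all that matters later is a constant depending on the dimension alone.\<close>

lemma inv_fourier_L2_bound:
  fixes f :: "'a::euclidean_space \<Rightarrow> complex"
  assumes f: "f \<in> elts L2"
  shows "nrm L2 (inv_fourier_L2 f) \<le> sqrt ((2 * pi) ^ DIM('a)) * nrm L2 f"
proof -
  have g: "(\<lambda>\<xi>. cnj (f \<xi>)) \<in> elts L2" by (rule L2_cnj(1)[OF f])
  have "1 \<le> 2 * pi" using pi_ge_two by linarith
  then have c: "1 \<le> (2 * pi) ^ DIM('a)" by (rule one_le_power)
  have "nrm L2 (inv_fourier_L2 f) \<le> 1 * nrm L2 (fourier_L2 (\<lambda>\<xi>. cnj (f \<xi>)))"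
  proof (rule L2_dominated(2)[OF fourier_L2_L2(1)[OF g] L2_measurable[OF inv_fourier_L2_eq(1)[OF f]]])
    show "AE x in lborel. norm (inv_fourier_L2 f x) \<le> 1 * norm (fourier_L2 (\<lambda>\<xi>. cnj (f \<xi>)) x)"
      using inv_fourier_L2_eq(2)[OF f]
    proof eventually_elim
      fix x assume "inv_fourier_L2 f x = cnj (fourier_L2 (\<lambda>\<xi>. cnj (f \<xi>)) x) / of_real ((2 * pi) ^ DIM('a))"
      then have "norm (inv_fourier_L2 f x) = norm (fourier_L2 (\<lambda>\<xi>. cnj (f \<xi>)) x) / (2 * pi) ^ DIM('a)"
        using c by (simp only: norm_divide norm_of_real complex_mod_cnj abs_of_nonneg)
      also have "\<dots> \<le> norm (fourier_L2 (\<lambda>\<xi>. cnj (f \<xi>)) x) / 1"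
        using c by (intro divide_left_mono) auto
      finally show "norm (inv_fourier_L2 f x) \<le> 1 * norm (fourier_L2 (\<lambda>\<xi>. cnj (f \<xi>)) x)" by simp
    qed
  qed simp
  also have "\<dots> \<le> sqrt ((2 * pi) ^ DIM('a)) * nrm L2 (\<lambda>\<xi>. cnj (f \<xi>))"
    using fourier_L2_L2(2)[OF g] by simp
  also have "nrm L2 (\<lambda>\<xi>. cnj (f \<xi>)) = nrm L2 f" by (rule L2_cnj(2)[OF f])
  finally show ?thesis .
qed

lemma fourier_L2_cong_AE:
  assumes f: "f \<in> elts L2" and g: "g \<in> elts L2" and eq: "AE x in lborel. f x = g x"
  shows "AE \<xi> in lborel. fourier_L2 f \<xi> = fourier_L2 g \<xi>"
proof -
  have "nrm L2 (\<lambda>x. f x - g x) = 0"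
    using eq nrm_L2_eq_0[OF L2_diff(1)[OF f g]] by simp
  then have "nrm L2 (fourier_L2 (\<lambda>x. f x - g x)) = 0"
    using fourier_L2_L2(2)[OF L2_diff(1)[OF f g]] by (simp add: antisym)
  then have "AE \<xi> in lborel. fourier_L2 (\<lambda>x. f x - g x) \<xi> = 0"
    using nrm_L2_eq_0[OF fourier_L2_L2(1)[OF L2_diff(1)[OF f g]]] by simp
  then show ?thesis using fourier_L2_diff[OF f g] by eventually_elim simp
qed

text \<open>The third function \<open>h\<close> is there because the transform of a difference
  equals the difference of the transforms only almost everywhere, so the argument of the inverse
  transform is not literally a difference.\<close>

lemma inv_fourier_L2_diff:
  fixes f g h :: "'a::euclidean_space \<Rightarrow> complex"
  assumes f: "f \<in> elts L2" and g: "g \<in> elts L2" and h: "h \<in> elts L2"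
    and eq: "AE \<xi> in lborel. h \<xi> = f \<xi> - g \<xi>"
  shows "AE x in lborel. inv_fourier_L2 h x = inv_fourier_L2 f x - inv_fourier_L2 g x"
proof -
  note L = L2_cnj(1)[OF f] L2_cnj(1)[OF g] L2_cnj(1)[OF h]
  have "AE \<xi> in lborel. fourier_L2 (\<lambda>\<xi>. cnj (h \<xi>)) \<xi> = fourier_L2 (\<lambda>\<xi>. cnj (f \<xi>) - cnj (g \<xi>)) \<xi>"
    using eq by (intro fourier_L2_cong_AE L L2_diff) (auto elim!: eventually_mono)
  then show ?thesis
    using fourier_L2_diff[OF L(1,2)] inv_fourier_L2_eq(2)[OF f] inv_fourier_L2_eq(2)[OF g] inv_fourier_L2_eq(2)[OF h]
    by eventually_elim (simp add: diff_divide_distrib)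
qed

section \<open>Weak derivatives\<close>

text \<open>The positive and the negative part of \<open>h\<close> are densities of two measures
  that agree, with finite values, on open boxes. These form an intersection-stable generator of the
  Borel sets, so the measures and then their densities coincide. As \<open>ennreal\<close> cuts off
  negative values, equality of the densities forces \<open>h\<close> to vanish.\<close>

lemma AE_eq_0_if_box_integrals_0:
  fixes h :: "'a::euclidean_space \<Rightarrow> real"
  assumes [measurable]: "h \<in> borel_measurable borel"
    and int: "\<And>l u. integrable lborel (\<lambda>x. h x * indicator (box l u) x)"
    and eq0: "\<And>l u. (LINT x|lborel. h x * indicator (box l u) x) = 0"
  shows "AE x in lborel. h x = 0"
proof -
  let ?M = "density lborel (\<lambda>x. ennreal (h x))" and ?N = "density lborel (\<lambda>x. ennreal (- h x))"
  have fin: "emeasure ?M (box l u) = (\<integral>\<^sup>+x. ennreal (h x * indicator (box l u) x) \<partial>lborel)"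
      "emeasure ?N (box l u) = (\<integral>\<^sup>+x. ennreal (- (h x * indicator (box l u) x)) \<partial>lborel)" for l u
    by (auto simp: emeasure_density indicator_def intro!: nn_integral_cong)
  have box: "emeasure ?M (box l u) = emeasure ?N (box l u)" "emeasure ?M (box l u) \<noteq> \<infinity>" for l u
  proof -
    from int[of l u] have lt: "(\<integral>\<^sup>+x. ennreal (h x * indicator (box l u) x) \<partial>lborel) \<noteq> \<infinity>"
       "(\<integral>\<^sup>+x. ennreal (- (h x * indicator (box l u) x)) \<partial>lborel) \<noteq> \<infinity>"
      by (auto simp: real_integrable_def)
    show "emeasure ?M (box l u) \<noteq> \<infinity>" unfolding fin(1) by (rule lt(1))
    have eq: "enn2real (\<integral>\<^sup>+x. ennreal (h x * indicator (box l u) x) \<partial>lborel)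
        = enn2real (\<integral>\<^sup>+x. ennreal (- (h x * indicator (box l u) x)) \<partial>lborel)"
      using real_lebesgue_integral_def[OF int[of l u]] eq0[of l u] by simp
    then show "emeasure ?M (box l u) = emeasure ?N (box l u)"
      unfolding fin using arg_cong[OF eq, of ennreal] lt
      by (subst (asm) (1 2) ennreal_enn2real) (simp_all add: less_top)
  qed
  have "?M = ?N"
  proof (rule measure_eqI_generator_eq[where E="range (\<lambda>(a, b). box a b::'a set)" and \<Omega>=UNIV
        and A="\<lambda>n::nat. box (- (real n *\<^sub>R One)) (real n *\<^sub>R One)"])
    show "Int_stable (range (\<lambda>(a, b). box a b::'a set))"
      by (auto simp: Int_stable_def box_Int_box)
    show "sets ?M = sigma_sets UNIV (range (\<lambda>(a, b). box a b))" "sets ?N = sigma_sets UNIV (range (\<lambda>(a, b). box a b))"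
      by (simp_all add: borel_eq_box)
    show "(\<Union>n::nat. box (- (real n *\<^sub>R One)) (real n *\<^sub>R One) :: 'a set) = UNIV"
      unfolding UN_box_eq_UNIV by auto
  qed (use box in auto)
  then have "AE x in lborel. ennreal (h x) = ennreal (- h x)"
    by (intro sigma_finite_measure.density_unique[OF lborel.sigma_finite_measure_axioms]) auto
  then show ?thesis
  proof eventually_elim
    fix x assume "ennreal (h x) = ennreal (- h x)"
    then show "h x = 0" by (cases "0 \<le> h x") (auto simp: ennreal_neg)
  qed
qed

text \<open>Bumps of growing sharpness converge to the indicator of an open box, dominated by the
  indicator of the closed one, so all box integrals of \<open>g\<close> vanish; real and imaginary
  part are then treated separately.\<close>

lemma fundamental_lemma_L2:
  fixes g :: "'a::euclidean_space \<Rightarrow> complex"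
  assumes g: "g \<in> elts L2" and eq0: "\<And>\<phi>. \<phi> \<in> test_functions UNIV \<Longrightarrow> (LINT x|lborel. g x * \<phi> x) = 0"
  shows "AE x in lborel. g x = 0"
proof -
  note [measurable] = L2_measurable[OF g]
  have icb: "integrable lborel (\<lambda>x. indicator (cbox l u) x * g x)" for l u
    using emeasure_lborel_cbox_eq[of l u] by (intro L2_indicator_mult_integrable g) (auto simp: less_top)
  have ibox: "integrable lborel (\<lambda>x. indicator (box l u) x * g x)" for l u
    using emeasure_lborel_box_eq[of l u] by (intro L2_indicator_mult_integrable g) (auto simp: less_top)
  have box0: "(LINT x|lborel. indicator (box l u) x * g x) = 0" for l u :: 'a
  proof -
    have "(\<lambda>n. LINT x|lborel. g x * complex_of_real (box_bump (real (Suc n)) l u x)) \<longlonglongrightarrow> (LINT x|lborel. indicator (box l u) x * g x)"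
    proof (rule integral_dominated_convergence[where w="\<lambda>x. norm (indicator (cbox l u) x * g x)"])
      show "AE x in lborel. (\<lambda>n. g x * complex_of_real (box_bump (real (Suc n)) l u x)) \<longlonglongrightarrow> indicator (box l u) x * g x"
      proof (rule AE_I2)
        fix x
        have "(\<lambda>n. g x * complex_of_real (box_bump (real (Suc n)) l u x)) \<longlonglongrightarrow> g x * complex_of_real (indicator (box l u) x)"
          by (intro tendsto_intros tendsto_of_real box_bump_tendsto_indicator)
        then show "(\<lambda>n. g x * complex_of_real (box_bump (real (Suc n)) l u x)) \<longlonglongrightarrow> indicator (box l u) x * g x"
          by (cases "x \<in> box l u") (simp_all add: mult.commute)
      qed
      show "AE x in lborel. norm (g x * complex_of_real (box_bump (real (Suc n)) l u x)) \<le> norm (indicator (cbox l u) x * g x)" for n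
      proof (rule AE_I2)
        fix x
        show "norm (g x * complex_of_real (box_bump (real (Suc n)) l u x)) \<le> norm (indicator (cbox l u) x * g x)"
        proof (cases "x \<in> cbox l u")
          case True
          then show ?thesis
            using box_bump_nonneg[of "real (Suc n)" l u x] box_bump_le_1[of "real (Suc n)" l u x]
            by (simp add: norm_mult mult_left_le)
        next
          case False
          then show ?thesis using box_bump_eq_0[of "real (Suc n)" x l u] by simp
        qed
      qed
    qed (use icb in \<open>auto simp del: of_nat_Suc\<close>)
    moreover have "(LINT x|lborel. g x * complex_of_real (box_bump (real (Suc n)) l u x)) = 0" for n
      using eq0[OF box_bump_test_function[OF cutoff_algebra.const[of 1], of "real (Suc n)" l u UNIV]] by simp
    ultimately show ?thesis by (simp add: LIMSEQ_const_iff)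
  qed
  have "AE x in lborel. Re (g x) = 0"
  proof (rule AE_eq_0_if_box_integrals_0)
    fix l u
    have eq: "Re (g x) * indicator (box l u) x = Re (indicator (box l u) x * g x)" for x
      by (auto simp: indicator_def)
    show "integrable lborel (\<lambda>x. Re (g x) * indicator (box l u) x)"
      unfolding eq by (intro integrable_Re ibox)
    show "(LINT x|lborel. Re (g x) * indicator (box l u) x) = 0"
      unfolding eq using integral_Re[OF ibox[of l u]] box0[of l u] by simp
  qed measurable
  moreover have "AE x in lborel. Im (g x) = 0"
  proof (rule AE_eq_0_if_box_integrals_0)
    fix l u
    have eq: "Im (g x) * indicator (box l u) x = Im (indicator (box l u) x * g x)" for x
      by (auto simp: indicator_def)
    show "integrable lborel (\<lambda>x. Im (g x) * indicator (box l u) x)"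
      unfolding eq by (intro integrable_Im ibox)
    show "(LINT x|lborel. Im (g x) * indicator (box l u) x) = 0"
      unfolding eq using integral_Im[OF ibox[of l u]] box0[of l u] by simp
  qed measurable
  ultimately show ?thesis by eventually_elim (simp add: complex_eq_iff)
qed

lemma continuous_compact_support_L2:
  fixes \<phi> :: "'a::euclidean_space \<Rightarrow> complex"
  assumes cont: "continuous_on UNIV \<phi>" and supp: "\<And>x. \<phi> x \<noteq> 0 \<Longrightarrow> x \<in> K" and K: "compact K"
  shows "\<phi> \<in> elts L2"
proof -
  have m[measurable]: "\<phi> \<in> borel_measurable borel" by (rule borel_measurable_continuous_onI[OF cont])
  have "compact (\<phi> ` K)" by (rule compact_continuous_image[OF continuous_on_subset[OF cont] K]) simp
  then obtain B where B: "\<And>x. x \<in> K \<Longrightarrow> norm (\<phi> x) \<le> B" using compact_imp_bounded bounded_iff by (metis imageI)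
  have [measurable]: "K \<in> sets borel" using K by (simp add: borel_compact)
  have "integrable lborel (\<lambda>x. B\<^sup>2 * indicator K x :: real)"
    using K emeasure_compact_finite[OF K] by (intro integrable_mult_right) simp
  then have "integrable lborel (\<lambda>x. (norm (\<phi> x))\<^sup>2)"
  proof (rule Bochner_Integration.integrable_bound)
    show "AE x in lborel. norm ((norm (\<phi> x))\<^sup>2) \<le> norm (B\<^sup>2 * indicator K x :: real)"
    proof (rule AE_I2)
      fix x show "norm ((norm (\<phi> x))\<^sup>2) \<le> norm (B\<^sup>2 * indicator K x :: real)"
        using supp[of x] B[of x] by (cases "x \<in> K") (auto intro!: power_mono)
    qed
  qed measurable
  then show ?thesis using m by (simp add: elts_L2)
qed

lemma smooth_iter_partial: "smooth f \<Longrightarrow> set is \<subseteq> Basis \<Longrightarrow> iter_partial is f differentiable (at x)"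
  by (simp add: smooth_def differentiable_on_def)

lemma test_function_L2:
  fixes \<phi> :: "'a::euclidean_space \<Rightarrow> complex"
  assumes \<phi>: "\<phi> \<in> test_functions A"
  shows "\<phi> \<in> elts L2" and "i \<in> Basis \<Longrightarrow> (\<lambda>x. frechet_derivative \<phi> (at x) i) \<in> elts L2"
proof -
  let ?K = "closure {x. \<phi> x \<noteq> 0}"
  have K: "compact ?K" and s: "smooth \<phi>" using \<phi> by (auto simp: test_functions_def)
  have c: "continuous_on UNIV (iter_partial is \<phi>)" if "set is \<subseteq> Basis" for "is"
    using smooth_iter_partial[OF s that] differentiable_imp_continuous_within continuous_at_imp_continuous_on by blast
  show "\<phi> \<in> elts L2"
    using c[of "[]"] closure_subset[of "{x. \<phi> x \<noteq> 0}"] by (intro continuous_compact_support_L2[OF _ _ K]) auto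
  assume i: "i \<in> Basis"
  show "(\<lambda>x. frechet_derivative \<phi> (at x) i) \<in> elts L2"
  proof (rule continuous_compact_support_L2[OF _ _ K])
    show "continuous_on UNIV (\<lambda>x. frechet_derivative \<phi> (at x) i)" using c[of "[i]"] i by simp
    fix x assume x: "frechet_derivative \<phi> (at x) i \<noteq> 0"
    show "x \<in> ?K"
    proof (rule ccontr)
      assume nx: "x \<notin> ?K"
      have "((\<lambda>_. 0) has_derivative (\<lambda>_. 0)) (at x)" by simp
      then have "(\<phi> has_derivative (\<lambda>_. 0)) (at x)"
      proof (rule has_derivative_transform_within_open[of _ _ _ _ "- ?K"])
        show "0 = \<phi> y" if "y \<in> - ?K" for y using that closure_subset[of "{x. \<phi> x \<noteq> 0}"] by auto
      qed (use nx in auto)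
      then have "frechet_derivative \<phi> (at x) = (\<lambda>_. 0)" by (rule frechet_derivative_at[symmetric])
      then show False using x by simp
    qed
  qed
qed

text \<open>Makes the choice in \<open>weak_partial\<close> harmless: any square integrable weak
  partial found by calculation agrees with the chosen one almost everywhere.\<close>

lemma has_weak_partial_unique:
  fixes f :: "'a::euclidean_space \<Rightarrow> complex"
  assumes "has_weak_partial i f g" "has_weak_partial i f h" and g: "g \<in> elts L2" and h: "h \<in> elts L2"
  shows "AE x in lborel. g x = h x"
proof -
  have "AE x in lborel. g x - h x = 0"
  proof (rule fundamental_lemma_L2[OF L2_diff(1)[OF g h]])
    fix \<phi> :: "'a \<Rightarrow> complex" assume \<phi>: "\<phi> \<in> test_functions UNIV"
    have "(LINT x|lborel. g x * \<phi> x) = (LINT x|lborel. h x * \<phi> x)"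
      using assms(1,2) \<phi> unfolding has_weak_partial_def by (metis neg_equal_iff_equal)
    then show "(LINT x|lborel. (g x - h x) * \<phi> x) = 0"
      using L2_mult_integrable(1)[OF g test_function_L2(1)[OF \<phi>]] L2_mult_integrable(1)[OF h test_function_L2(1)[OF \<phi>]]
      by (simp add: left_diff_distrib)
  qed
  then show ?thesis by simp
qed

lemma has_weak_partial_diff:
  fixes f g :: "'a::euclidean_space \<Rightarrow> complex"
  assumes i: "i \<in> Basis" and f: "has_weak_partial i f f'" "f \<in> elts L2" "f' \<in> elts L2"
    and g: "has_weak_partial i g g'" "g \<in> elts L2" "g' \<in> elts L2"
  shows "has_weak_partial i (\<lambda>x. f x - g x) (\<lambda>x. f' x - g' x)"
  unfolding has_weak_partial_def
proof
  fix \<phi> :: "'a \<Rightarrow> complex" assume \<phi>: "\<phi> \<in> test_functions UNIV"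
  note T = test_function_L2(1)[OF \<phi>] test_function_L2(2)[OF \<phi> i]
  show "(LINT x|lborel. (f x - g x) * frechet_derivative \<phi> (at x) i) = - (LINT x|lborel. (f' x - g' x) * \<phi> x)"
    using f(1) g(1) \<phi> L2_mult_integrable(1)[OF f(3) T(1)] L2_mult_integrable(1)[OF g(3) T(1)]
      L2_mult_integrable(1)[OF f(2) T(2)] L2_mult_integrable(1)[OF g(2) T(2)]
    by (simp add: left_diff_distrib has_weak_partial_def)
qed

lemma has_weak_partial_scale:
  fixes f :: "'a::euclidean_space \<Rightarrow> complex"
  assumes "has_weak_partial i f f'"
  shows "has_weak_partial i (\<lambda>x. c * f x) (\<lambda>x. c * f' x)"
  using assms by (simp add: has_weak_partial_def mult.assoc)

section \<open>The space H1\<close>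

lemma elts_H1: "f \<in> elts H1 \<longleftrightarrow> f \<in> elts L2 \<and> (\<forall>i\<in>Basis. \<exists>g\<in>elts L2. has_weak_partial i f g)"
  by (simp add: H1_def)

lemma nrm_H1: "nrm H1 f = sqrt ((nrm L2 f)\<^sup>2 + (\<Sum>i\<in>Basis. (nrm L2 (weak_partial i f))\<^sup>2))"
  by (simp add: H1_def)

lemma nrm_H1_nonneg[simp]: "0 \<le> nrm H1 f"
  by (simp add: nrm_H1 sum_nonneg)

lemma nrm_H1_power2: "(nrm H1 f)\<^sup>2 = (nrm L2 f)\<^sup>2 + (\<Sum>i\<in>Basis. (nrm L2 (weak_partial i f))\<^sup>2)"
  by (simp add: nrm_H1 sum_nonneg)

lemma H1_L2: "f \<in> elts H1 \<Longrightarrow> f \<in> elts L2"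
  by (simp add: elts_H1)

lemma weak_partial_spec:
  assumes f: "f \<in> elts H1" and i: "i \<in> Basis"
  shows "weak_partial i f \<in> elts L2" and "has_weak_partial i f (weak_partial i f)"
proof -
  have "\<exists>g. g \<in> elts L2 \<and> has_weak_partial i f g" using f i by (auto simp: elts_H1)
  then have "weak_partial i f \<in> elts L2 \<and> has_weak_partial i f (weak_partial i f)"
    unfolding weak_partial_def by (rule someI_ex)
  then show "weak_partial i f \<in> elts L2" "has_weak_partial i f (weak_partial i f)" by auto
qed

lemma nrm_L2_le_H1: "nrm L2 f \<le> nrm H1 f"
  by (rule power2_le_imp_le) (simp_all add: nrm_H1_power2 sum_nonneg)

lemma nrm_weak_partial_le_H1:
  assumes "i \<in> Basis"
  shows "nrm L2 (weak_partial i f) \<le> nrm H1 f"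
proof (rule power2_le_imp_le)
  have "(nrm L2 (weak_partial i f))\<^sup>2 \<le> (\<Sum>i\<in>Basis. (nrm L2 (weak_partial i f))\<^sup>2)"
    using assms by (intro member_le_sum) auto
  then show "(nrm L2 (weak_partial i f))\<^sup>2 \<le> (nrm H1 f)\<^sup>2"
    unfolding nrm_H1_power2 by (simp add: add_increasing)
qed simp

lemma H1_diff:
  assumes f: "f \<in> elts H1" and g: "g \<in> elts H1"
  shows "(\<lambda>x. f x - g x) \<in> elts H1"
    and "i \<in> Basis \<Longrightarrow> AE x in lborel. weak_partial i (\<lambda>x. f x - g x) x = weak_partial i f x - weak_partial i g x"
    and "nrm H1 (\<lambda>x. f x - g x) \<le> nrm H1 f + nrm H1 g"
proof -
  note D = has_weak_partial_diff[OF _ weak_partial_spec(2)[OF f] H1_L2[OF f] weak_partial_spec(1)[OF f]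
      weak_partial_spec(2)[OF g] H1_L2[OF g] weak_partial_spec(1)[OF g]]
  show H: "(\<lambda>x. f x - g x) \<in> elts H1"
    using L2_diff(1)[OF H1_L2[OF f] H1_L2[OF g]] D L2_diff(1)[OF weak_partial_spec(1)[OF f] weak_partial_spec(1)[OF g]]
    by (fastforce simp: elts_H1)
  show ae: "AE x in lborel. weak_partial i (\<lambda>x. f x - g x) x = weak_partial i f x - weak_partial i g x"
    if i: "i \<in> Basis" for i
    by (rule has_weak_partial_unique[OF weak_partial_spec(2)[OF H i] D[OF i i i i i] weak_partial_spec(1)[OF H i]
        L2_diff(1)[OF weak_partial_spec(1)[OF f i] weak_partial_spec(1)[OF g i]]])
  have p: "nrm L2 (weak_partial i (\<lambda>x. f x - g x)) \<le> nrm L2 (weak_partial i f) + nrm L2 (weak_partial i g)"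
    if i: "i \<in> Basis" for i
  proof -
    note L = weak_partial_spec(1)[OF f i] weak_partial_spec(1)[OF g i] weak_partial_spec(1)[OF H i]
    show ?thesis
      using nrm_L2_cong_AE[OF L2_measurable[OF L(3)] L2_measurable[OF L2_diff(1)[OF L(1,2)]] ae[OF i]]
        L2_diff(2)[OF L(1,2)] by simp
  qed
  \<comment> \<open>The H1 norm is the Euclidean length of the pair formed by the L2 norm and the l2
    length of the partial norms. Its triangle inequality is therefore Minkowski's inequality over
    the directions, followed by the one in the plane.\<close>
  let ?S = "\<lambda>f. L2_set (\<lambda>i. nrm L2 (weak_partial i f)) Basis"
  have S: "nrm H1 f = sqrt ((nrm L2 f)\<^sup>2 + (?S f)\<^sup>2)" for f :: "'a \<Rightarrow> complex"
    by (simp add: nrm_H1 L2_set_def sum_nonneg)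
  have "?S (\<lambda>x. f x - g x) \<le> L2_set (\<lambda>i. nrm L2 (weak_partial i f) + nrm L2 (weak_partial i g)) Basis"
    by (rule L2_set_mono) (auto simp: p)
  also have "\<dots> \<le> ?S f + ?S g" by (rule L2_set_triangle_ineq)
  finally have "?S (\<lambda>x. f x - g x) \<le> ?S f + ?S g" .
  then have "nrm H1 (\<lambda>x. f x - g x) \<le> sqrt ((nrm L2 f + nrm L2 g)\<^sup>2 + (?S f + ?S g)\<^sup>2)"
    unfolding S using L2_diff(2)[OF H1_L2[OF f] H1_L2[OF g]]
    by (intro real_sqrt_le_mono add_mono power_mono) (auto simp: L2_set_nonneg)
  also have "\<dots> \<le> nrm H1 f + nrm H1 g"
    unfolding S by (rule real_sqrt_sum_squares_triangle_ineq)
  finally show "nrm H1 (\<lambda>x. f x - g x) \<le> nrm H1 f + nrm H1 g" .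
qed

lemma H1_scale:
  assumes f: "f \<in> elts H1"
  shows "(\<lambda>x. c * f x) \<in> elts H1" and "nrm H1 (\<lambda>x. c * f x) = cmod c * nrm H1 f"
proof -
  note D = has_weak_partial_scale[OF weak_partial_spec(2)[OF f], of _ c]
  show H: "(\<lambda>x. c * f x) \<in> elts H1"
    using L2_scale(1)[OF H1_L2[OF f], of c] D L2_scale(1)[OF weak_partial_spec(1)[OF f], of _ c]
    by (fastforce simp: elts_H1)
  have ae: "AE x in lborel. weak_partial i (\<lambda>x. c * f x) x = c * weak_partial i f x"
    if i: "i \<in> Basis" for i
    by (rule has_weak_partial_unique[OF weak_partial_spec(2)[OF H i] D[OF i] weak_partial_spec(1)[OF H i]
        L2_scale(1)[OF weak_partial_spec(1)[OF f i]]])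
  have p: "nrm L2 (weak_partial i (\<lambda>x. c * f x)) = cmod c * nrm L2 (weak_partial i f)"
    if i: "i \<in> Basis" for i
  proof -
    note L = weak_partial_spec(1)[OF f i] weak_partial_spec(1)[OF H i]
    show ?thesis
      using nrm_L2_cong_AE[OF L2_measurable[OF L(2)] L2_measurable[OF L2_scale(1)[OF L(1)]] ae[OF i]]
        L2_scale(2)[OF L(1)] by simp
  qed
  have "(nrm H1 (\<lambda>x. c * f x))\<^sup>2 = (cmod c * nrm H1 f)\<^sup>2"
    by (simp add: nrm_H1_power2 p L2_scale(2)[OF H1_L2[OF f]] power_mult_distrib distrib_left sum_distrib_left)
  then show "nrm H1 (\<lambda>x. c * f x) = cmod c * nrm H1 f"
    by (simp add: power2_eq_iff_nonneg)
qed

section \<open>The fractional Laplacian\<close>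

text \<open>Testing with a cut-off plane wave shows that, up to the cut-off, the transform turns the weak
  derivative into multiplication by the coordinate; the cut-off is then removed by Fatou's lemma.\<close>

lemma fourier_weak_partial:
  fixes f :: "'a::euclidean_space \<Rightarrow> complex"
  assumes f: "f \<in> elts H1" and i: "i \<in> Basis"
  shows "(\<lambda>\<xi>. of_real (\<xi> \<bullet> i) * fourier_L2 f \<xi>) \<in> elts L2"
    and "nrm L2 (\<lambda>\<xi>. of_real (\<xi> \<bullet> i) * fourier_L2 f \<xi>) \<le> 2 * sqrt ((2 * pi) ^ DIM('a)) * nrm H1 f"
proof -
  define C where "C = sqrt ((2 * pi) ^ DIM('a))"
  have C: "0 \<le> C" by (simp add: C_def)
  define g where "g = weak_partial i f"
  have f2: "f \<in> elts L2" by (rule H1_L2[OF f])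
  have g2: "g \<in> elts L2" and wg: "has_weak_partial i f g"
    unfolding g_def by (rule weak_partial_spec[OF f i])+
  note [measurable] = L2_measurable[OF f2] L2_measurable[OF g2]
  \<comment> \<open>\<open>\<zeta> n\<close> is the wide cut-off and \<open>\<eta> n\<close> its
    partial in direction \<open>i\<close>. Both are bounded by 1 and compactly supported, so
    multiplication by them does not increase L2 norms and makes the products integrable.\<close>
  define \<zeta> where "\<zeta> n x = complex_of_real (big_bump n (x::'a))" for n x
  define \<eta> where "\<eta> n x = complex_of_real (frechet_derivative (big_bump n) (at x) i)" for n and x :: 'a
  have alg: "cutoff_algebra (big_bump n :: 'a \<Rightarrow> real)" for n
    unfolding big_bump_def using cutoff_algebra_box_bump[where 'b=real, of 1 "- real n *\<^sub>R One" "real n *\<^sub>R One"] by simp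
  have bm[measurable]: "big_bump n \<in> borel_measurable borel" for n
    unfolding big_bump_def by measurable
  have \<zeta>1: "norm (\<zeta> n x) \<le> 1" for n x
    unfolding \<zeta>_def big_bump_def by (simp add: box_bump_nonneg box_bump_le_1)
  have supp: "norm x \<le> norm (real n *\<^sub>R (One::'a))" if "\<zeta> n x \<noteq> 0 \<or> \<eta> n x \<noteq> 0" for n x
  proof -
    have "x \<in> cbox (- real n *\<^sub>R One) (real n *\<^sub>R One)"
    proof (rule ccontr)
      assume nx: "x \<notin> cbox (- real n *\<^sub>R One) (real n *\<^sub>R One)"
      have 0: "big_bump n y = 0" if "y \<notin> cbox (- real n *\<^sub>R One) (real n *\<^sub>R One)" for y
        unfolding big_bump_def using that by (intro box_bump_eq_0) auto
      have "((\<lambda>_. 0) has_derivative (\<lambda>_. 0)) (at x)" by simp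
      then have "(big_bump n has_derivative (\<lambda>_. 0)) (at x)"
        by (rule has_derivative_transform_within_open[of _ _ _ _ "- cbox (- real n *\<^sub>R One) (real n *\<^sub>R One)"])
          (use nx 0 in \<open>auto simp: closed_cbox open_Compl\<close>)
      then have "frechet_derivative (big_bump n) (at x) = (\<lambda>_. 0)" by (rule frechet_derivative_at[symmetric])
      then show False using that 0[OF nx] by (simp add: \<zeta>_def \<eta>_def)
    qed
    then have "\<bar>x \<bullet> b\<bar> \<le> \<bar>(real n *\<^sub>R (One::'a)) \<bullet> b\<bar>" if "b \<in> Basis" for b
      using that by (auto simp: mem_box abs_le_iff)
    then show ?thesis by (rule norm_le_componentwise)
  qed
  have \<eta>1: "norm (\<eta> n x) \<le> 1" for n x
    unfolding \<eta>_def using big_bump_partial[OF i] by simp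
  have \<eta>m[measurable]: "\<eta> n \<in> borel_measurable borel" for n
  proof -
    have "continuous_on UNIV (\<lambda>x. frechet_derivative (big_bump n) (at x) i)"
      by (rule cutoff_algebra_continuous[OF cutoff_algebra_frechet_derivative(2)[OF alg]])
    from borel_measurable_continuous_onI[OF this] show ?thesis unfolding \<eta>_def by measurable
  qed
  have \<zeta>m[measurable]: "\<zeta> n \<in> borel_measurable borel" for n unfolding \<zeta>_def by measurable
  have prod: "(\<lambda>x. h x * k x) \<in> elts L2" "nrm L2 (\<lambda>x. h x * k x) \<le> nrm L2 h" "integrable lborel (\<lambda>x. h x * k x)"
    if h: "h \<in> elts L2" and k: "k \<in> borel_measurable borel" "\<And>x. norm (k x) \<le> 1" and s: "\<And>x. k x \<noteq> 0 \<Longrightarrow> norm x \<le> R"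
    for h k :: "'a \<Rightarrow> complex" and R
  proof -
    note [measurable] = L2_measurable[OF h] k(1)
    have *: "AE x in lborel. norm (h x * k x) \<le> 1 * norm (h x)"
      using k(2) by (auto simp: norm_mult mult_left_le)
    have m: "(\<lambda>x. h x * k x) \<in> borel_measurable borel" by measurable
    show L: "(\<lambda>x. h x * k x) \<in> elts L2" "nrm L2 (\<lambda>x. h x * k x) \<le> nrm L2 h"
      using L2_dominated[OF h m _ *] by auto
    have "truncate R (\<lambda>x. h x * k x) = (\<lambda>x. h x * k x)"
      using s by (force simp: truncate_def indicator_def)
    then show "integrable lborel (\<lambda>x. h x * k x)" using truncate_L2(3)[OF L(1), of R] by simp
  qed
  define R where "R n = norm (real n *\<^sub>R (One::'a))" for n
  have s\<zeta>: "\<zeta> n x \<noteq> 0 \<Longrightarrow> norm x \<le> R n" and s\<eta>: "\<eta> n x \<noteq> 0 \<Longrightarrow> norm x \<le> R n" for n x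
    using supp R_def by auto
  have f\<zeta>: "(\<lambda>x. f x * \<zeta> n x) \<in> elts L2" "integrable lborel (\<lambda>x. f x * \<zeta> n x)" for n
    using prod[OF f2 \<zeta>m \<zeta>1, of n "R n"] s\<zeta> by blast+
  have f\<eta>: "(\<lambda>x. f x * \<eta> n x) \<in> elts L2" "integrable lborel (\<lambda>x. f x * \<eta> n x)"
      "nrm L2 (\<lambda>x. f x * \<eta> n x) \<le> nrm L2 f" for n
    using prod[OF f2 \<eta>m \<eta>1, of n "R n"] s\<eta> by blast+
  have g\<zeta>: "(\<lambda>x. g x * \<zeta> n x) \<in> elts L2" "integrable lborel (\<lambda>x. g x * \<zeta> n x)"
      "nrm L2 (\<lambda>x. g x * \<zeta> n x) \<le> nrm L2 g" for n
    using prod[OF g2 \<zeta>m \<zeta>1, of n "R n"] s\<zeta> by blast+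
  define F where "F n = fourier_int (\<lambda>x. f x * \<zeta> n x)" for n
  \<comment> \<open>The weak derivative is tested with the plane wave times the cut-off. If the
    derivative hits the plane wave it yields -i times the coordinate of \<xi>; if it hits the
    cut-off it yields the term with \<open>\<eta> n\<close>.\<close>
  have ident: "of_real (\<xi> \<bullet> i) * F n \<xi> = - \<i> * (fourier_int (\<lambda>x. g x * \<zeta> n x) \<xi> + fourier_int (\<lambda>x. f x * \<eta> n x) \<xi>)" for n \<xi>
  proof -
    let ?e = "\<lambda>x. exp ((- \<i>) * of_real (x \<bullet> \<xi>))"
    have e: "?e x = cis (- (x \<bullet> \<xi>))" for x by (simp add: cis_conv_exp)
    let ?\<phi> = "\<lambda>x. ?e x * of_real (big_bump n x)"
    have "?\<phi> \<in> test_functions UNIV"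
      unfolding big_bump_def by (intro box_bump_test_function cutoff_algebra.exponential) auto
    with wg have w: "(LINT x|lborel. f x * frechet_derivative ?\<phi> (at x) i) = - (LINT x|lborel. g x * ?\<phi> x)"
      unfolding has_weak_partial_def by blast
    have fd: "frechet_derivative ?\<phi> (at x) i = cis (- (x \<bullet> \<xi>)) * \<eta> n x - \<i> * of_real (\<xi> \<bullet> i) * (cis (- (x \<bullet> \<xi>)) * \<zeta> n x)" for x
    proof -
      have "((\<lambda>x. (- \<i>) * of_real (x \<bullet> \<xi>)) has_derivative (\<lambda>v. (- \<i>) * of_real (v \<bullet> \<xi>))) (at x)"
        by (intro has_derivative_mult_right has_derivative_of_real has_derivative_inner_left has_derivative_ident)
      from has_derivative_compose[OF this DERIV_exp[unfolded has_field_derivative_def]]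
      have 1: "(?e has_derivative (\<lambda>v. ?e x * ((- \<i>) * of_real (v \<bullet> \<xi>)))) (at x)" .
      have "(big_bump n has_derivative frechet_derivative (big_bump n) (at x)) (at x)"
        using cutoff_algebra_frechet_derivative(1)[OF alg] frechet_derivative_works by blast
      from has_derivative_mult[OF 1 has_derivative_of_real[OF this]]
      have "frechet_derivative ?\<phi> (at x) = (\<lambda>v. ?e x * of_real (frechet_derivative (big_bump n) (at x) v) +
          ?e x * ((- \<i>) * of_real (v \<bullet> \<xi>)) * of_real (big_bump n x))"
        by (rule frechet_derivative_at[symmetric])
      from fun_cong[OF this, of i] show ?thesis
        unfolding e \<zeta>_def \<eta>_def inner_commute[of i \<xi>] by (simp add: algebra_simps)
    qed
    have "(LINT x|lborel. cis (- (x \<bullet> \<xi>)) * (f x * \<eta> n x) - \<i> * of_real (\<xi> \<bullet> i) * (cis (- (x \<bullet> \<xi>)) * (f x * \<zeta> n x)))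
        = (LINT x|lborel. f x * frechet_derivative ?\<phi> (at x) i)"
      by (intro Bochner_Integration.integral_cong refl) (simp only: fd, simp add: algebra_simps)
    then have "fourier_int (\<lambda>x. f x * \<eta> n x) \<xi> - \<i> * of_real (\<xi> \<bullet> i) * F n \<xi> = (LINT x|lborel. f x * frechet_derivative ?\<phi> (at x) i)"
      using fourier_int_integrable[OF f\<eta>(2)] fourier_int_integrable[OF f\<zeta>(2)]
      by (simp add: fourier_int_def F_def)
    also have "\<dots> = - fourier_int (\<lambda>x. g x * \<zeta> n x) \<xi>"
      using w unfolding fourier_int_def e \<zeta>_def by (simp add: mult_ac)
    finally show ?thesis by (simp add: algebra_simps complex_eq_iff)
  qed
  have FL: "F n \<in> elts L2" for n unfolding F_def by (rule fourier_int_L2(1)[OF f\<zeta>(2) f\<zeta>(1)])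
  let ?S = "\<lambda>n \<xi>. fourier_int (\<lambda>x. g x * \<zeta> n x) \<xi> + fourier_int (\<lambda>x. f x * \<eta> n x) \<xi>"
  have SL: "?S n \<in> elts L2" for n
    by (intro L2_add(1) fourier_int_L2(1) g\<zeta> f\<eta>)
  \<comment> \<open>The constant 2 counts the two terms. The commutator term with
    \<open>\<eta> n\<close> is only bounded by the L2 norm of \<open>f\<close>, uniformly in
    \<open>n\<close>, and this is enough for Fatou's lemma.\<close>
  have Sb: "nrm L2 (?S n) \<le> 2 * C * nrm H1 f" for n
  proof -
    have "nrm L2 (?S n) \<le> nrm L2 (fourier_int (\<lambda>x. g x * \<zeta> n x)) + nrm L2 (fourier_int (\<lambda>x. f x * \<eta> n x))"
      by (intro L2_add(2) fourier_int_L2(1) g\<zeta> f\<eta>)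
    also have "\<dots> \<le> C * nrm L2 (\<lambda>x. g x * \<zeta> n x) + C * nrm L2 (\<lambda>x. f x * \<eta> n x)"
      unfolding C_def by (intro add_mono fourier_int_L2(2) g\<zeta> f\<eta>)
    also have "\<dots> \<le> C * nrm H1 f + C * nrm H1 f"
      using C order_trans[OF g\<zeta>(3)[of n, unfolded g_def] nrm_weak_partial_le_H1[OF i]]
        order_trans[OF f\<eta>(3)[of n] nrm_L2_le_H1]
      by (intro add_mono mult_left_mono) (auto simp: g_def)
    finally show ?thesis by simp
  qed
  have \<xi>F: "(\<lambda>\<xi>. of_real (\<xi> \<bullet> i) * F n \<xi>) \<in> elts L2" "nrm L2 (\<lambda>\<xi>. of_real (\<xi> \<bullet> i) * F n \<xi>) \<le> 2 * C * nrm H1 f" for n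
    unfolding ident using L2_scale[OF SL[of n], of "- \<i>"] Sb[of n] by simp_all
  have lim: "(\<lambda>n. nrm L2 (\<lambda>\<xi>. F n \<xi> - fourier_L2 f \<xi>)) \<longlonglongrightarrow> 0"
  proof -
    have d: "(\<lambda>x. f x * \<zeta> n x - f x) \<in> elts L2" for n by (intro L2_diff f\<zeta> f2)
    have "(\<lambda>n. nrm L2 (\<lambda>x. f x * \<zeta> n x - f x)) \<longlonglongrightarrow> 0"
    proof (rule L2_dominated_tendsto[OF f2])
      show "AE x in lborel. norm (f x * \<zeta> n x - f x) \<le> norm (f x)" for n
      proof (rule AE_I2)
        fix x
        have "f x * \<zeta> n x - f x = f x * of_real (big_bump n x - 1)" by (simp add: \<zeta>_def algebra_simps)
        also have "norm \<dots> \<le> norm (f x) * 1"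
          unfolding norm_mult norm_of_real big_bump_def
          using box_bump_nonneg[of 1 "- real n *\<^sub>R One" "real n *\<^sub>R One" x] box_bump_le_1[of 1 "- real n *\<^sub>R One" "real n *\<^sub>R One" x]
          by (intro mult_left_mono) auto
        finally show "norm (f x * \<zeta> n x - f x) \<le> norm (f x)" by simp
      qed
      show "AE x in lborel. (\<lambda>n. f x * \<zeta> n x - f x) \<longlonglongrightarrow> 0"
      proof (rule AE_I2)
        fix x
        have "(\<lambda>n. f x * \<zeta> n x - f x) \<longlonglongrightarrow> f x * of_real 1 - f x"
          unfolding \<zeta>_def by (intro tendsto_intros tendsto_of_real big_bump_tendsto)
        then show "(\<lambda>n. f x * \<zeta> n x - f x) \<longlonglongrightarrow> 0" by simp
      qed
    qed measurable
    from tendsto_mult_right_zero[OF this]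
    have 0: "(\<lambda>n. C * nrm L2 (\<lambda>x. f x * \<zeta> n x - f x)) \<longlonglongrightarrow> 0" .
    \<comment> \<open>As \<open>f\<close> times the cut-off has compact support, \<open>F n\<close>
      is its L2 transform, and the difference is the transform of what the cut-off removes.\<close>
    have le: "nrm L2 (\<lambda>\<xi>. F n \<xi> - fourier_L2 f \<xi>) \<le> C * nrm L2 (\<lambda>x. f x * \<zeta> n x - f x)" for n
    proof -
      have "AE \<xi> in lborel. fourier_L2 (\<lambda>x. f x * \<zeta> n x) \<xi> = F n \<xi>"
        unfolding F_def by (rule fourier_L2_eq_fourier_int[OF f\<zeta>(1), of n "R n"]) (use s\<zeta> in auto)
      then have "AE \<xi> in lborel. F n \<xi> - fourier_L2 f \<xi> = fourier_L2 (\<lambda>x. f x * \<zeta> n x - f x) \<xi>"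
        using fourier_L2_diff[OF f\<zeta>(1) f2, of n] by eventually_elim simp
      then have "nrm L2 (\<lambda>\<xi>. F n \<xi> - fourier_L2 f \<xi>) = nrm L2 (fourier_L2 (\<lambda>x. f x * \<zeta> n x - f x))"
        by (intro nrm_L2_cong_AE L2_measurable L2_diff FL fourier_L2_L2 f2 d)
      then show ?thesis using fourier_L2_L2(2)[OF d[of n]] by (simp add: C_def)
    qed
    show ?thesis
      using 0 by (rule tendsto_sandwich[OF always_eventually always_eventually tendsto_const, rotated 2])
        (simp_all add: le)
  qed
  obtain r where r: "strict_mono r" "AE \<xi> in lborel. (\<lambda>n. F (r n) \<xi>) \<longlonglongrightarrow> fourier_L2 f \<xi>"
    using L2_tendsto_AE_subseq[OF FL fourier_L2_L2(1)[OF f2] lim] by blast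
  have ae: "AE \<xi> in lborel. (\<lambda>n. of_real (\<xi> \<bullet> i) * F (r n) \<xi>) \<longlonglongrightarrow> of_real (\<xi> \<bullet> i) * fourier_L2 f \<xi>"
    using r(2) by eventually_elim (intro tendsto_intros)
  have [measurable]: "fourier_L2 f \<in> borel_measurable borel" by (rule L2_measurable[OF fourier_L2_L2(1)[OF f2]])
  have m: "(\<lambda>\<xi>. of_real (\<xi> \<bullet> i) * fourier_L2 f \<xi>) \<in> borel_measurable borel" by measurable
  show "(\<lambda>\<xi>. of_real (\<xi> \<bullet> i) * fourier_L2 f \<xi>) \<in> elts L2"
    "nrm L2 (\<lambda>\<xi>. of_real (\<xi> \<bullet> i) * fourier_L2 f \<xi>) \<le> 2 * sqrt ((2 * pi) ^ DIM('a)) * nrm H1 f"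
    using L2_Fatou[OF \<xi>F(1) \<xi>F(2) m ae] unfolding C_def by auto
qed

lemma L2_sum:
  assumes "finite I" "\<And>i. i \<in> I \<Longrightarrow> f i \<in> elts L2"
  shows "(\<lambda>x. \<Sum>i\<in>I. f i x) \<in> elts L2 \<and> nrm L2 (\<lambda>x. \<Sum>i\<in>I. f i x) \<le> (\<Sum>i\<in>I. nrm L2 (f i))"
  using assms
proof (induction I)
  case empty
  show ?case by (simp add: L2_zero)
next
  case (insert i I)
  then show ?case
    using L2_add[of "f i" "\<lambda>x. \<Sum>i\<in>I. f i x"] by (force simp: insert.hyps)
qed

lemma L2_norm_fun:
  assumes "f \<in> elts L2"
  shows "(\<lambda>x. norm (f x)) \<in> elts L2" and "nrm L2 (\<lambda>x. norm (f x)) = nrm L2 f"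
  using assms by (auto simp: elts_L2 nrm_L2)

text \<open>Since |\<xi>|^s <= 1 + |\<xi>| <= 1 + the sum of the |\<xi>_i|, the multiplied transform
  is dominated by the transform itself and its products with the coordinates. The factor 1 + 2 DIM
  collects 1 for the former and 2 for each coordinate.\<close>

lemma powr_norm_fourier_L2:
  fixes f :: "'a::euclidean_space \<Rightarrow> complex"
  assumes f: "f \<in> elts H1" and s: "0 < s" "s < 1"
  shows "(\<lambda>\<xi>. of_real (norm \<xi> powr s) * fourier_L2 f \<xi>) \<in> elts L2"
    and "nrm L2 (\<lambda>\<xi>. of_real (norm \<xi> powr s) * fourier_L2 f \<xi>) \<le> (1 + 2 * DIM('a)) * sqrt ((2 * pi) ^ DIM('a)) * nrm H1 f"
proof -
  define C where "C = sqrt ((2 * pi) ^ DIM('a))"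
  have C: "0 \<le> C" by (simp add: C_def)
  have f2: "f \<in> elts L2" by (rule H1_L2[OF f])
  note F = fourier_L2_L2[OF f2] and P = fourier_weak_partial[OF f]
  note [measurable] = L2_measurable[OF F(1)]
  let ?p = "\<lambda>i \<xi>. norm (of_real (\<xi> \<bullet> i) * fourier_L2 f \<xi>)"
  let ?g = "\<lambda>\<xi>. norm (fourier_L2 f \<xi>) + (\<Sum>i\<in>Basis. ?p i \<xi>)"
  have S: "(\<lambda>\<xi>. \<Sum>i\<in>Basis. ?p i \<xi>) \<in> elts L2 \<and> nrm L2 (\<lambda>\<xi>. \<Sum>i\<in>Basis. ?p i \<xi>) \<le> (\<Sum>i\<in>Basis. nrm L2 (?p i))"
    by (intro L2_sum L2_norm_fun P) auto
  have g: "?g \<in> elts L2" by (rule L2_add(1)[OF L2_norm_fun(1)[OF F(1)] conjunct1[OF S]])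
  have "nrm L2 ?g \<le> nrm L2 (\<lambda>\<xi>. norm (fourier_L2 f \<xi>)) + nrm L2 (\<lambda>\<xi>. \<Sum>i\<in>Basis. ?p i \<xi>)"
    by (rule L2_add(2)[OF L2_norm_fun(1)[OF F(1)] conjunct1[OF S]])
  also have "\<dots> \<le> C * nrm H1 f + (\<Sum>i\<in>(Basis::'a set). 2 * C * nrm H1 f)"
  proof (intro add_mono)
    show "nrm L2 (\<lambda>\<xi>. norm (fourier_L2 f \<xi>)) \<le> C * nrm H1 f"
      using order_trans[OF F(2)[folded C_def] mult_left_mono[OF nrm_L2_le_H1 C]] L2_norm_fun(2)[OF F(1)] by simp
    have "(\<Sum>i\<in>Basis. nrm L2 (?p i)) \<le> (\<Sum>i\<in>(Basis::'a set). 2 * C * nrm H1 f)"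
      using P L2_norm_fun(2)[OF P(1)] by (intro sum_mono) (simp add: C_def)
    then show "nrm L2 (\<lambda>\<xi>. \<Sum>i\<in>Basis. ?p i \<xi>) \<le> (\<Sum>i\<in>(Basis::'a set). 2 * C * nrm H1 f)"
      using S by linarith
  qed
  also have "\<dots> = (1 + 2 * DIM('a)) * C * nrm H1 f" by (simp add: algebra_simps)
  finally have gb: "nrm L2 ?g \<le> (1 + 2 * DIM('a)) * C * nrm H1 f" .
  have le: "AE \<xi> in lborel. norm (of_real (norm \<xi> powr s) * fourier_L2 f \<xi>) \<le> 1 * norm (?g \<xi>)"
  proof (rule AE_I2)
    fix \<xi> :: 'a
    have "norm \<xi> powr s \<le> 1 + norm \<xi>"
    proof (cases "norm \<xi> \<le> 1")
      case True
      then have "norm \<xi> powr s \<le> 1" using s by (simp add: powr_le1)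
      then show ?thesis using norm_ge_zero[of \<xi>] by linarith
    next
      case False
      then have "norm \<xi> powr s \<le> norm \<xi> powr 1" using s by (intro powr_mono) auto
      then show ?thesis using False by simp
    qed
    also have "\<dots> \<le> 1 + (\<Sum>i\<in>Basis. \<bar>\<xi> \<bullet> i\<bar>)" using norm_le_l1[of \<xi>] by simp
    finally have "norm \<xi> powr s * norm (fourier_L2 f \<xi>) \<le> (1 + (\<Sum>i\<in>Basis. \<bar>\<xi> \<bullet> i\<bar>)) * norm (fourier_L2 f \<xi>)"
      by (rule mult_right_mono) simp
    also have "\<dots> = ?g \<xi>" by (simp add: distrib_right sum_distrib_right norm_mult)
    finally show "norm (of_real (norm \<xi> powr s) * fourier_L2 f \<xi>) \<le> 1 * norm (?g \<xi>)"
      by (simp add: norm_mult)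
  qed
  have m: "(\<lambda>\<xi>. of_real (norm \<xi> powr s) * fourier_L2 f \<xi>) \<in> borel_measurable borel" by measurable
  show "(\<lambda>\<xi>. of_real (norm \<xi> powr s) * fourier_L2 f \<xi>) \<in> elts L2"
    by (rule L2_dominated(1)[OF g m _ le]) auto
  show "nrm L2 (\<lambda>\<xi>. of_real (norm \<xi> powr s) * fourier_L2 f \<xi>) \<le> (1 + 2 * DIM('a)) * sqrt ((2 * pi) ^ DIM('a)) * nrm H1 f"
    using L2_dominated(2)[OF g m _ le] gb by (simp add: C_def)
qed

text \<open>The forward and the inverse transform each contribute sqrt ((2 pi)^DIM), and the
  multiplier contributes 1 + 2 DIM. Differences are respected only almost everywhere because both
  transforms are chosen representatives.\<close>

lemma frac_laplacian_H1:
  fixes f g :: "'a::euclidean_space \<Rightarrow> complex"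
  assumes f: "f \<in> elts H1" and s: "0 < s" "s < 1"
  shows "frac_laplacian s f \<in> elts L2"
    and "nrm L2 (frac_laplacian s f) \<le> (1 + 2 * DIM('a)) * (2 * pi) ^ DIM('a) * nrm H1 f"
    and "g \<in> elts H1 \<Longrightarrow> AE x in lborel. frac_laplacian s (\<lambda>x. f x - g x) x = frac_laplacian s f x - frac_laplacian s g x"
proof -
  note P = powr_norm_fourier_L2[OF f s]
  show "frac_laplacian s f \<in> elts L2"
    unfolding frac_laplacian_def by (rule inv_fourier_L2_eq(1)[OF P(1)])
  have "nrm L2 (frac_laplacian s f) \<le> sqrt ((2 * pi) ^ DIM('a)) * ((1 + 2 * DIM('a)) * sqrt ((2 * pi) ^ DIM('a)) * nrm H1 f)"
    unfolding frac_laplacian_def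
    by (rule order_trans[OF inv_fourier_L2_bound[OF P(1)]]) (intro mult_left_mono P(2), simp)
  also have "\<dots> = (1 + 2 * DIM('a)) * (sqrt ((2 * pi) ^ DIM('a)) * sqrt ((2 * pi) ^ DIM('a))) * nrm H1 f"
    by (simp only: mult_ac)
  also have "sqrt ((2 * pi) ^ DIM('a)) * sqrt ((2 * pi) ^ DIM('a)) = (2 * pi) ^ DIM('a)"
    by (rule real_sqrt_mult_self[THEN trans]) simp
  finally show "nrm L2 (frac_laplacian s f) \<le> (1 + 2 * DIM('a)) * (2 * pi) ^ DIM('a) * nrm H1 f" .
  assume g: "g \<in> elts H1"
  show "AE x in lborel. frac_laplacian s (\<lambda>x. f x - g x) x = frac_laplacian s f x - frac_laplacian s g x"
    unfolding frac_laplacian_def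
  proof (rule inv_fourier_L2_diff[OF P(1) powr_norm_fourier_L2(1)[OF g s] powr_norm_fourier_L2(1)[OF H1_diff(1)[OF f g] s]])
    show "AE \<xi> in lborel. of_real (norm \<xi> powr s) * fourier_L2 (\<lambda>x. f x - g x) \<xi> =
        of_real (norm \<xi> powr s) * fourier_L2 f \<xi> - of_real (norm \<xi> powr s) * fourier_L2 g \<xi>"
      using fourier_L2_diff[OF H1_L2[OF f] H1_L2[OF g]] by eventually_elim (simp add: right_diff_distrib)
  qed
qed

section \<open>Approximation in Bochner spaces\<close>

lemma nrm_H1_diff_commute:
  assumes "f \<in> elts H1" "g \<in> elts H1"
  shows "nrm H1 (\<lambda>x. f x - g x) = nrm H1 (\<lambda>x. g x - f x)"
  using H1_scale(2)[OF H1_diff(1)[OF assms], of "- 1"] by simp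

lemma H1_triangle:
  assumes f: "f \<in> elts H1" and g: "g \<in> elts H1" and h: "h \<in> elts H1"
  shows "nrm H1 (\<lambda>x. f x - h x) \<le> nrm H1 (\<lambda>x. f x - g x) + nrm H1 (\<lambda>x. g x - h x)"
  using H1_diff(3)[OF H1_diff(1)[OF f g] H1_diff(1)[OF h g]] nrm_H1_diff_commute[OF h g] by simp

lemma H1_add:
  assumes f: "f \<in> elts H1" and g: "g \<in> elts H1"
  shows "(\<lambda>x. f x + g x) \<in> elts H1" and "nrm H1 (\<lambda>x. f x + g x) \<le> nrm H1 f + nrm H1 g"
  using H1_diff(1,3)[OF f H1_scale(1)[OF g, of "- 1"]] H1_scale(2)[OF g, of "- 1"] by simp_all

lemma H1_zero: "(\<lambda>_::'a::euclidean_space. 0) \<in> elts H1" "nrm H1 (\<lambda>_::'a. 0) = 0"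
proof -
  have "has_weak_partial i (\<lambda>_::'a. 0) (\<lambda>_. 0)" for i by (simp add: has_weak_partial_def)
  then show "(\<lambda>_::'a. 0) \<in> elts H1" by (auto simp: elts_H1 L2_zero intro!: bexI[of _ "\<lambda>_. 0"])
  from H1_scale(2)[OF this, of 0] show "nrm H1 (\<lambda>_::'a. 0) = 0" by simp
qed

lemma H1_sum:
  assumes "finite I" "\<And>i. i \<in> I \<Longrightarrow> f i \<in> elts H1"
  shows "(\<lambda>x. \<Sum>i\<in>I. f i x) \<in> elts H1 \<and> nrm H1 (\<lambda>x. \<Sum>i\<in>I. f i x) \<le> (\<Sum>i\<in>I. nrm H1 (f i))"
  using assms
proof (induction I)
  case empty
  show ?case by (simp add: H1_zero)
next
  case (insert i I)
  then show ?case
    using H1_add[of "f i" "\<lambda>x. \<Sum>i\<in>I. f i x"] by (force simp: insert.hyps)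
qed

lemma nrm_H1_continuous:
  assumes s: "\<And>n::nat. s n \<in> elts H1" and f: "f \<in> elts H1" and lim: "(\<lambda>n. nrm H1 (\<lambda>x. s n x - f x)) \<longlonglongrightarrow> 0"
  shows "(\<lambda>n. nrm H1 (s n)) \<longlonglongrightarrow> nrm H1 f"
proof -
  have "(\<lambda>n. nrm H1 (s n) - nrm H1 f) \<longlonglongrightarrow> 0"
  proof (rule Lim_null_comparison[OF _ lim], rule always_eventually, rule allI)
    fix n
    show "norm (nrm H1 (s n) - nrm H1 f) \<le> nrm H1 (\<lambda>x. s n x - f x)"
      using H1_triangle[OF s f H1_zero(1), of n] H1_triangle[OF f s H1_zero(1), of n]
        nrm_H1_diff_commute[OF f s, of n] by simp
  qed
  then show ?thesis by (simp add: LIM_zero_iff)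
qed

text \<open>Lebesgue measure is complete, so measurability survives changes on a null set;
  \<open>f\<close> and \<open>g\<close> are extended by 0 to apply this on the whole space. It is
  needed because functions of time are identified only almost everywhere.\<close>

lemma borel_measurable_lebesgue_on_AE:
  fixes f g :: "'a::euclidean_space \<Rightarrow> 'b::euclidean_space"
  assumes S: "S \<in> sets lebesgue" and f: "f \<in> borel_measurable (lebesgue_on S)"
    and eq: "AE x in lebesgue_on S. f x = g x"
  shows "g \<in> borel_measurable (lebesgue_on S)"
proof -
  have "(\<lambda>x. if x \<in> S then f x else 0) \<in> borel_measurable lebesgue"
    using f S by (simp add: borel_measurable_if)
  moreover have "AE x in lebesgue. (if x \<in> S then f x else 0) = (if x \<in> S then g x else 0)"
    using eq S by (auto simp: AE_restrict_space_iff elim: eventually_mono)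
  ultimately have "(\<lambda>x. if x \<in> S then g x else 0) \<in> borel_measurable lebesgue"
    by (rule borel_measurable_AE)
  then show ?thesis using S by (simp add: borel_measurable_if)
qed

text \<open>The type of the values carries neither the topology nor the sigma-algebra of the space
  \<open>X\<close>, so continuity of \<open>G\<close> is expressed by sequences in its norm.
  Composed with simple functions, \<open>G\<close> gives measurable functions converging almost
  everywhere. Typical choices of \<open>G\<close> are a norm or a form with one argument
  fixed.\<close>

lemma strongly_measurable_compose:
  fixes G :: "'v::minus \<Rightarrow> 'b::euclidean_space" and v :: "real \<Rightarrow> 'v"
  assumes S: "S \<in> sets lebesgue" and v: "strongly_measurable (lebesgue_on S) X v"
    and G: "\<And>s f. (\<And>n. s n \<in> elts X) \<Longrightarrow> f \<in> elts X \<Longrightarrow> (\<lambda>n. nrm X (s n - f)) \<longlonglongrightarrow> 0 \<Longrightarrow> (\<lambda>n. G (s n)) \<longlonglongrightarrow> G f"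
  shows "(\<lambda>t. G (v t)) \<in> borel_measurable (lebesgue_on S)"
proof -
  obtain \<sigma> :: "nat \<Rightarrow> real \<Rightarrow> 'v" where \<sigma>: "\<And>n. simple_function (lebesgue_on S) (\<sigma> n)"
      "\<And>n. \<sigma> n ` space (lebesgue_on S) \<subseteq> elts X"
    and lim: "AE t in lebesgue_on S. v t \<in> elts X \<and> (\<lambda>n. nrm X (\<sigma> n t - v t)) \<longlonglongrightarrow> 0"
    using v unfolding strongly_measurable_def by blast
  have m[measurable]: "(\<lambda>t. G (\<sigma> n t)) \<in> borel_measurable (lebesgue_on S)" for n
    using simple_function_compose1[OF \<sigma>(1), of G n] by (rule borel_measurable_simple_function)
  have "(\<lambda>t. lim (\<lambda>n. G (\<sigma> n t))) \<in> borel_measurable (lebesgue_on S)"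
    by (rule borel_measurable_lim_metric[OF m])
  moreover have "AE t in lebesgue_on S. lim (\<lambda>n. G (\<sigma> n t)) = G (v t)"
    using lim AE_space
  proof eventually_elim
    fix t assume t: "v t \<in> elts X \<and> (\<lambda>n. nrm X (\<sigma> n t - v t)) \<longlonglongrightarrow> 0" "t \<in> space (lebesgue_on S)"
    then have "(\<lambda>n. G (\<sigma> n t)) \<longlonglongrightarrow> G (v t)"
      using \<sigma>(2) by (intro G) auto
    then show "lim (\<lambda>n. G (\<sigma> n t)) = G (v t)" by (rule limI)
  qed
  ultimately show ?thesis by (rule borel_measurable_lebesgue_on_AE[OF S])
qed

lemma strongly_measurable_H1_diff:
  fixes v v' :: "real \<Rightarrow> 'a::euclidean_space \<Rightarrow> complex"
  assumes v: "strongly_measurable M H1 v" and v': "strongly_measurable M H1 v'"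
  shows "strongly_measurable M H1 (\<lambda>t x. v t x - v' t x)"
proof -
  obtain \<sigma> :: "nat \<Rightarrow> real \<Rightarrow> 'a \<Rightarrow> complex" where \<sigma>: "\<And>n. simple_function M (\<sigma> n)" "\<And>n. \<sigma> n ` space M \<subseteq> elts H1"
      "AE t in M. v t \<in> elts H1 \<and> (\<lambda>n. nrm H1 (\<sigma> n t - v t)) \<longlonglongrightarrow> 0"
    using v unfolding strongly_measurable_def by blast
  obtain \<sigma>' :: "nat \<Rightarrow> real \<Rightarrow> 'a \<Rightarrow> complex" where \<sigma>': "\<And>n. simple_function M (\<sigma>' n)" "\<And>n. \<sigma>' n ` space M \<subseteq> elts H1"
      "AE t in M. v' t \<in> elts H1 \<and> (\<lambda>n. nrm H1 (\<sigma>' n t - v' t)) \<longlonglongrightarrow> 0"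
    using v' unfolding strongly_measurable_def by blast
  let ?\<sigma> = "\<lambda>n t x. \<sigma> n t x - \<sigma>' n t x"
  have "simple_function M (?\<sigma> n)" for n
    using simple_function_compose2[OF \<sigma>(1) \<sigma>'(1), of "\<lambda>f g x. f x - g x" n n] .
  moreover have "?\<sigma> n ` space M \<subseteq> elts H1" for n
    using \<sigma>(2)[of n] \<sigma>'(2)[of n] by (auto intro!: H1_diff(1))
  moreover have "AE t in M. (\<lambda>x. v t x - v' t x) \<in> elts H1 \<and> (\<lambda>n. nrm H1 (?\<sigma> n t - (\<lambda>x. v t x - v' t x))) \<longlonglongrightarrow> 0"
    using \<sigma>(3) \<sigma>'(3) AE_space
  proof eventually_elim
    fix t assume v: "v t \<in> elts H1 \<and> (\<lambda>n. nrm H1 (\<sigma> n t - v t)) \<longlonglongrightarrow> 0"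
      and v': "v' t \<in> elts H1 \<and> (\<lambda>n. nrm H1 (\<sigma>' n t - v' t)) \<longlonglongrightarrow> 0" and t: "t \<in> space M"
    have s: "\<sigma> n t \<in> elts H1" "\<sigma>' n t \<in> elts H1" for n using \<sigma>(2)[of n] \<sigma>'(2)[of n] t by auto
    have "norm (nrm H1 (?\<sigma> n t - (\<lambda>x. v t x - v' t x))) \<le> nrm H1 (\<sigma> n t - v t) + nrm H1 (\<sigma>' n t - v' t)" for n
      using H1_diff(3)[OF H1_diff(1)[OF s(1) conjunct1[OF v]] H1_diff(1)[OF s(2) conjunct1[OF v']], of n n]
      by (simp add: fun_diff_def algebra_simps)
    moreover have "(\<lambda>n. nrm H1 (\<sigma> n t - v t) + nrm H1 (\<sigma>' n t - v' t)) \<longlonglongrightarrow> 0"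
      using tendsto_add[OF conjunct2[OF v] conjunct2[OF v']] by simp
    ultimately have "(\<lambda>n. nrm H1 (?\<sigma> n t - (\<lambda>x. v t x - v' t x))) \<longlonglongrightarrow> 0"
      by (rule Lim_null_comparison[OF always_eventually[OF allI]])
    then show "(\<lambda>x. v t x - v' t x) \<in> elts H1 \<and> (\<lambda>n. nrm H1 (?\<sigma> n t - (\<lambda>x. v t x - v' t x))) \<longlonglongrightarrow> 0"
      using v v' by (simp add: H1_diff(1))
  qed
  ultimately show ?thesis unfolding strongly_measurable_def by (intro exI[of _ ?\<sigma>]) auto
qed

lemma strongly_measurable_H1_L2:
  fixes v :: "real \<Rightarrow> 'a::euclidean_space \<Rightarrow> complex"
  assumes v: "strongly_measurable M H1 v"
  shows "strongly_measurable M L2 v"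
proof -
  obtain \<sigma> :: "nat \<Rightarrow> real \<Rightarrow> 'a \<Rightarrow> complex" where \<sigma>: "\<And>n. simple_function M (\<sigma> n)" "\<And>n. \<sigma> n ` space M \<subseteq> elts H1"
      "AE t in M. v t \<in> elts H1 \<and> (\<lambda>n. nrm H1 (\<sigma> n t - v t)) \<longlonglongrightarrow> 0"
    using v unfolding strongly_measurable_def by blast
  have "AE t in M. v t \<in> elts L2 \<and> (\<lambda>n. nrm L2 (\<sigma> n t - v t)) \<longlonglongrightarrow> 0"
    using \<sigma>(3)
  proof eventually_elim
    fix t assume v: "v t \<in> elts H1 \<and> (\<lambda>n. nrm H1 (\<sigma> n t - v t)) \<longlonglongrightarrow> 0"
    have "norm (nrm L2 (\<sigma> n t - v t)) \<le> nrm H1 (\<sigma> n t - v t)" for n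
      by (simp add: nrm_L2_le_H1)
    then have "(\<lambda>n. nrm L2 (\<sigma> n t - v t)) \<longlonglongrightarrow> 0"
      by (rule Lim_null_comparison[OF always_eventually[OF allI] conjunct2[OF v]])
    then show "v t \<in> elts L2 \<and> (\<lambda>n. nrm L2 (\<sigma> n t - v t)) \<longlonglongrightarrow> 0" using v H1_L2 by blast
  qed
  then show ?thesis using \<sigma>(1,2) H1_L2 unfolding strongly_measurable_def by (intro exI[of _ \<sigma>]) blast
qed

lemma strongly_measurable_nrm_H1:
  fixes v :: "real \<Rightarrow> 'a::euclidean_space \<Rightarrow> complex"
  assumes "S \<in> sets lebesgue" "strongly_measurable (lebesgue_on S) H1 v"
  shows "(\<lambda>t. nrm H1 (v t)) \<in> borel_measurable (lebesgue_on S)"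
  by (rule strongly_measurable_compose[OF assms, where G="nrm H1"])
     (intro nrm_H1_continuous, auto simp: fun_diff_def)

lemma elts_L2_time: "v \<in> elts (L2_time T X) \<longleftrightarrow>
    strongly_measurable (lebesgue_on {0<..<T}) X v \<and> integrable (lebesgue_on {0<..<T}) (\<lambda>t. (nrm X (v t))\<^sup>2)"
  by (simp add: L2_time_def)

lemma strongly_measurable_elts: "strongly_measurable M X v \<Longrightarrow> AE t in M. v t \<in> elts X"
  unfolding strongly_measurable_def by (auto elim: eventually_mono)

lemma L2_time_H1_diff:
  assumes v: "v \<in> elts (L2_time T H1)" and v': "v' \<in> elts (L2_time T H1)"
  shows "(\<lambda>t x. v t x - v' t x) \<in> elts (L2_time T H1)"
proof -
  have sm: "strongly_measurable (lebesgue_on {0<..<T}) H1 (\<lambda>t x. v t x - v' t x)"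
    using v v' by (intro strongly_measurable_H1_diff) (auto simp: elts_L2_time)
  have [measurable]: "(\<lambda>t. nrm H1 (\<lambda>x. v t x - v' t x)) \<in> borel_measurable (lebesgue_on {0<..<T})"
    by (rule strongly_measurable_nrm_H1[OF _ sm]) simp
  have i: "integrable (lebesgue_on {0<..<T}) (\<lambda>t. 2 * (nrm H1 (v t))\<^sup>2 + 2 * (nrm H1 (v' t))\<^sup>2)"
    using v v' by (auto simp: elts_L2_time)
  have "AE t in lebesgue_on {0<..<T}. v t \<in> elts H1" "AE t in lebesgue_on {0<..<T}. v' t \<in> elts H1"
    using v v' by (auto simp: elts_L2_time intro: strongly_measurable_elts)
  then have "AE t in lebesgue_on {0<..<T}. norm ((nrm H1 (\<lambda>x. v t x - v' t x))\<^sup>2) \<le> norm (2 * (nrm H1 (v t))\<^sup>2 + 2 * (nrm H1 (v' t))\<^sup>2)"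
  proof eventually_elim
    fix t assume "v t \<in> elts H1" "v' t \<in> elts H1"
    then have "(nrm H1 (\<lambda>x. v t x - v' t x))\<^sup>2 \<le> (nrm H1 (v t) + nrm H1 (v' t))\<^sup>2"
      by (intro power_mono H1_diff(3)) auto
    also have "\<dots> \<le> 2 * (nrm H1 (v t))\<^sup>2 + 2 * (nrm H1 (v' t))\<^sup>2"
      using sum_squares_bound[of "nrm H1 (v t)" "nrm H1 (v' t)"] by (simp add: power2_sum)
    finally show "norm ((nrm H1 (\<lambda>x. v t x - v' t x))\<^sup>2) \<le> norm (2 * (nrm H1 (v t))\<^sup>2 + 2 * (nrm H1 (v' t))\<^sup>2)" by simp
  qed
  then have "integrable (lebesgue_on {0<..<T}) (\<lambda>t. (nrm H1 (\<lambda>x. v t x - v' t x))\<^sup>2)"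
    by (intro Bochner_Integration.integrable_bound[OF i]) auto
  with sm show ?thesis by (simp add: elts_L2_time)
qed

section \<open>Approximation by functions continuous in time\<close>

lemma finite_measure_lebesgue_on_interval: "finite_measure (lebesgue_on {a<..<b::real})"
  by (rule finite_measure_lebesgue_on) simp

text \<open>Measurability in the sense of \<open>measurable_on\<close> supplies continuous functions
  converging to the indicator off a negligible set. Clamping them to [0,1] keeps the limit and makes
  dominated convergence on the finite interval applicable.\<close>

lemma indicator_approx_continuous:
  fixes E :: "real set" and \<eta> :: real
  assumes E: "E \<in> sets lebesgue" and "0 < \<eta>"
  shows "\<exists>\<psi>::real \<Rightarrow> real. continuous_on UNIV \<psi> \<and> (\<forall>t. 0 \<le> \<psi> t \<and> \<psi> t \<le> 1) \<and>
    (LINT t|lebesgue_on {0<..<T::real}. (indicator E t - \<psi> t)\<^sup>2) < \<eta>"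
proof -
  interpret finite_measure "lebesgue_on {0<..<T}" by (rule finite_measure_lebesgue_on_interval)
  have "(indicator E :: real \<Rightarrow> real) measurable_on UNIV"
    using E by (intro lebesgue_measurable_imp_measurable_on) auto
  then obtain N g where N: "negligible N" and g: "\<And>n. continuous_on UNIV (g n)"
      "\<And>x. x \<notin> N \<Longrightarrow> (\<lambda>n. g n x) \<longlonglongrightarrow> (indicator E x :: real)"
    unfolding measurable_on_def by auto
  define \<psi> where "\<psi> n t = max 0 (min 1 (g n t))" for n :: nat and t :: real
  have c: "continuous_on UNIV (\<psi> n)" for n unfolding \<psi>_def by (intro continuous_intros g)
  have b: "0 \<le> \<psi> n t" "\<psi> n t \<le> 1" for n t by (auto simp: \<psi>_def)
  have cm: "\<psi> n \<in> borel_measurable (lebesgue_on {0<..<T})" for n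
    using continuous_on_subset[OF c, of "{0<..<T}"] by (intro continuous_imp_measurable_on_sets_lebesgue) auto
  have im: "(indicator E :: real \<Rightarrow> real) \<in> borel_measurable (lebesgue_on {0<..<T})"
    using E by (intro measurable_restrict_space1) auto
  have "(\<lambda>n. LINT t|lebesgue_on {0<..<T}. (indicator E t - \<psi> n t)\<^sup>2) \<longlonglongrightarrow> (LINT t|lebesgue_on {0<..<T}. 0)"
  proof (rule integral_dominated_convergence[where w="\<lambda>_. 1"])
    have "AE x in lebesgue. x \<notin> N"
      using N by (simp add: negligible_iff_null_sets AE_not_in)
    then have "AE x in lebesgue_on {0<..<T}. x \<notin> N"
      by (auto simp: AE_restrict_space_iff elim: eventually_mono)
    then show "AE t in lebesgue_on {0<..<T}. (\<lambda>n. (indicator E t - \<psi> n t)\<^sup>2) \<longlonglongrightarrow> 0"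
    proof eventually_elim
      fix t assume "t \<notin> N"
      then have "(\<lambda>n. (indicator E t - \<psi> n t)\<^sup>2) \<longlonglongrightarrow> (indicator E t - max 0 (min 1 (indicator E t)))\<^sup>2"
        unfolding \<psi>_def by (intro tendsto_intros g)
      then show "(\<lambda>n. (indicator E t - \<psi> n t)\<^sup>2) \<longlonglongrightarrow> 0" by (simp add: indicator_def split: if_splits)
    qed
    show "AE t in lebesgue_on {0<..<T}. norm ((indicator E t - \<psi> n t)\<^sup>2) \<le> 1" for n
    proof (rule AE_I2)
      fix t
      have "\<bar>indicator E t - \<psi> n t\<bar> \<le> 1" using b[of n t] by (auto simp: indicator_def)
      then show "norm ((indicator E t - \<psi> n t)\<^sup>2) \<le> 1" by (simp add: abs_square_le_1)
    qed
    show "(\<lambda>t. (indicator E t - \<psi> n t)\<^sup>2) \<in> borel_measurable (lebesgue_on {0<..<T})" for n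
      using cm im by measurable
  qed simp_all
  then have "(\<lambda>n. LINT t|lebesgue_on {0<..<T}. (indicator E t - \<psi> n t)\<^sup>2) \<longlonglongrightarrow> 0" by simp
  from order_tendstoD(2)[OF this assms(2)]
  obtain n where "(LINT t|lebesgue_on {0<..<T}. (indicator E t - \<psi> n t)\<^sup>2) < \<eta>"
    using eventually_happens'[OF sequentially_bot] by blast
  then show ?thesis using c b by blast
qed

lemma uniformly_continuous_sum_modulus:
  fixes \<psi> :: "'c \<Rightarrow> real \<Rightarrow> real" and K :: "'c \<Rightarrow> real"
  assumes "finite C" "\<And>c. c \<in> C \<Longrightarrow> uniformly_continuous_on S (\<psi> c)" "\<And>c. c \<in> C \<Longrightarrow> 0 \<le> K c" "0 < \<kappa>"
  shows "\<exists>\<delta>>0. \<forall>t\<in>S. \<forall>t'\<in>S. \<bar>t' - t\<bar> < \<delta> \<longrightarrow> (\<Sum>c\<in>C. \<bar>\<psi> c t' - \<psi> c t\<bar> * K c) < \<kappa>"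
  using assms
proof (induction C arbitrary: \<kappa>)
  case empty
  then show ?case by (intro exI[of _ 1]) auto
next
  case (insert c C)
  obtain \<delta>1 where 1: "\<delta>1 > 0" "\<forall>t\<in>S. \<forall>t'\<in>S. \<bar>t' - t\<bar> < \<delta>1 \<longrightarrow> (\<Sum>c\<in>C. \<bar>\<psi> c t' - \<psi> c t\<bar> * K c) < \<kappa> / 2"
    using insert.IH[of "\<kappa> / 2"] insert.prems by auto
  have K: "0 \<le> K c" using insert.prems by simp
  \<comment> \<open>The weight \<open>K c\<close> may be 0, so the tolerance is divided by
    \<open>K c + 1\<close>.\<close>
  then have "(0::real) < 2 * (K c + 1)" by simp
  then have kk: "0 < \<kappa> / (2 * (K c + 1))" using insert.prems(3) by (rule divide_pos_pos[rotated])
  obtain \<delta>2 where 2: "\<delta>2 > 0" "\<forall>t\<in>S. \<forall>t'\<in>S. dist t' t < \<delta>2 \<longrightarrow> dist (\<psi> c t') (\<psi> c t) < \<kappa> / (2 * (K c + 1))"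
    using insert.prems(1)[of c] kk unfolding uniformly_continuous_on_def by blast
  show ?case
  proof (intro exI[of _ "min \<delta>1 \<delta>2"] conjI ballI impI)
    fix t t' assume t: "t \<in> S" "t' \<in> S" "\<bar>t' - t\<bar> < min \<delta>1 \<delta>2"
    have a: "\<bar>\<psi> c t' - \<psi> c t\<bar> \<le> \<kappa> / (2 * (K c + 1))"
      using 2 t by (auto simp: dist_real_def intro: less_imp_le)
    have "\<bar>\<psi> c t' - \<psi> c t\<bar> * K c \<le> \<kappa> / (2 * (K c + 1)) * (K c + 1)"
      by (intro mult_mono a less_imp_le[OF kk] K) simp
    also have "\<dots> = \<kappa> / 2"
    proof -
      have "x / (2 * m) * m = x / 2" if "m \<noteq> 0" for x m :: real using that by simp
      then show ?thesis using K by (metis add_nonneg_pos less_irrefl zero_less_one)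
    qed
    finally have "\<bar>\<psi> c t' - \<psi> c t\<bar> * K c \<le> \<kappa> / 2" .
    moreover have "(\<Sum>c\<in>C. \<bar>\<psi> c t' - \<psi> c t\<bar> * K c) < \<kappa> / 2"
      using 1(2) t by simp
    ultimately show "(\<Sum>c\<in>insert c C. \<bar>\<psi> c t' - \<psi> c t\<bar> * K c) < \<kappa>"
      unfolding sum.insert[OF insert.hyps] by linarith
  qed (use 1 2 in auto)
qed

text \<open>Strong measurability yields pointwise convergence without any domination. Resetting a
  simple function to 0 wherever its norm exceeds twice that of \<open>v\<close> bounds the error by
  three times the norm of \<open>v\<close>, whose square is integrable.\<close>

lemma simple_approx_L2_time:
  fixes v :: "real \<Rightarrow> 'a::euclidean_space \<Rightarrow> complex"
  assumes v: "v \<in> elts (L2_time T H1)" and e: "0 < e"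
  shows "\<exists>\<tau>. simple_function (lebesgue_on {0<..<T}) \<tau> \<and> (\<forall>t\<in>{0<..<T}. \<tau> t \<in> elts H1) \<and>
    integrable (lebesgue_on {0<..<T}) (\<lambda>t. (nrm H1 (\<lambda>x. v t x - \<tau> t x))\<^sup>2) \<and>
    (LINT t|lebesgue_on {0<..<T}. (nrm H1 (\<lambda>x. v t x - \<tau> t x))\<^sup>2) < e"
proof -
  let ?M = "lebesgue_on {0<..<T}"
  have sm: "strongly_measurable ?M H1 v" and int: "integrable ?M (\<lambda>t. (nrm H1 (v t))\<^sup>2)"
    using v by (auto simp: elts_L2_time)
  note [measurable] = strongly_measurable_nrm_H1[OF _ sm, simplified]
  obtain \<sigma> :: "nat \<Rightarrow> real \<Rightarrow> 'a \<Rightarrow> complex" where \<sigma>: "\<And>n. simple_function ?M (\<sigma> n)" "\<And>n. \<sigma> n ` space ?M \<subseteq> elts H1"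
      "AE t in ?M. v t \<in> elts H1 \<and> (\<lambda>n. nrm H1 (\<sigma> n t - v t)) \<longlonglongrightarrow> 0"
    using sm unfolding strongly_measurable_def by blast
  have \<sigma>H: "t \<in> {0<..<T} \<Longrightarrow> \<sigma> n t \<in> elts H1" for n t using \<sigma>(2)[of n] by auto
  define \<tau> where "\<tau> n t = (if nrm H1 (\<sigma> n t) \<le> 2 * nrm H1 (v t) then \<sigma> n t else (\<lambda>_. 0))" for n t
  have [measurable]: "(\<lambda>t. nrm H1 (\<sigma> n t)) \<in> borel_measurable ?M" for n
    using simple_function_compose1[OF \<sigma>(1)] by (rule borel_measurable_simple_function)
  have \<tau>s: "simple_function ?M (\<tau> n)" for n
    unfolding \<tau>_def by (intro simple_function_If \<sigma>(1) simple_function_const) measurable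
  have \<tau>H: "t \<in> {0<..<T} \<Longrightarrow> \<tau> n t \<in> elts H1" for n t
    using \<sigma>H by (simp add: \<tau>_def H1_zero)
  have \<tau>b: "nrm H1 (\<tau> n t) \<le> 2 * nrm H1 (v t)" for n t by (simp add: \<tau>_def H1_zero)
  have sm\<tau>: "strongly_measurable ?M H1 (\<tau> n)" for n
    unfolding strongly_measurable_def using \<tau>s[of n] \<tau>H[of _ n]
    by (intro exI[of _ "\<lambda>_. \<tau> n"]) (auto simp: fun_diff_def H1_zero)
  have [measurable]: "(\<lambda>t. nrm H1 (\<lambda>x. v t x - \<tau> n t x)) \<in> borel_measurable ?M" for n
    by (rule strongly_measurable_nrm_H1[OF _ strongly_measurable_H1_diff[OF sm sm\<tau>]]) simp
  have space: "AE t in ?M. t \<in> {0<..<T}" using AE_space[of ?M] by simp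
  have b9: "AE t in ?M. norm ((nrm H1 (\<lambda>x. v t x - \<tau> n t x))\<^sup>2) \<le> 9 * (nrm H1 (v t))\<^sup>2" for n
    using \<sigma>(3) space
  proof eventually_elim
    fix t assume t: "v t \<in> elts H1 \<and> (\<lambda>n. nrm H1 (\<sigma> n t - v t)) \<longlonglongrightarrow> 0" "t \<in> {0<..<T}"
    then have "nrm H1 (\<lambda>x. v t x - \<tau> n t x) \<le> 3 * nrm H1 (v t)"
      using H1_diff(3)[of "v t" "\<tau> n t"] \<tau>H \<tau>b[of n t] by fastforce
    then have "(nrm H1 (\<lambda>x. v t x - \<tau> n t x))\<^sup>2 \<le> (3 * nrm H1 (v t))\<^sup>2" by (intro power_mono) auto
    then show "norm ((nrm H1 (\<lambda>x. v t x - \<tau> n t x))\<^sup>2) \<le> 9 * (nrm H1 (v t))\<^sup>2" by (simp add: power_mult_distrib)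
  qed
  have i9: "integrable ?M (\<lambda>t. 9 * (nrm H1 (v t))\<^sup>2)" using int by simp
  have integ: "integrable ?M (\<lambda>t. (nrm H1 (\<lambda>x. v t x - \<tau> n t x))\<^sup>2)" for n
    by (rule Bochner_Integration.integrable_bound[OF i9]) (use b9[of n] in auto)
  have "(\<lambda>n. LINT t|?M. (nrm H1 (\<lambda>x. v t x - \<tau> n t x))\<^sup>2) \<longlonglongrightarrow> (LINT t|?M. 0)"
  proof (rule integral_dominated_convergence[OF _ _ i9 _ b9])
    show "AE t in ?M. (\<lambda>n. (nrm H1 (\<lambda>x. v t x - \<tau> n t x))\<^sup>2) \<longlonglongrightarrow> 0"
      using \<sigma>(3) space
    proof eventually_elim
      fix t assume t: "v t \<in> elts H1 \<and> (\<lambda>n. nrm H1 (\<sigma> n t - v t)) \<longlonglongrightarrow> 0" "t \<in> {0<..<T}"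
      have "(\<lambda>n. nrm H1 (\<lambda>x. v t x - \<tau> n t x)) \<longlonglongrightarrow> 0"
      \<comment> \<open>Where \<open>v\<close> has norm 0, the retained values have norm 0 as well.
        Elsewhere the norms of the approximants eventually fall below twice the norm of
        \<open>v\<close>, so nothing is reset any more.\<close>
      proof (cases "nrm H1 (v t) = 0")
        case True
        then have "nrm H1 (\<lambda>x. v t x - \<tau> n t x) \<le> 0" for n
          using H1_diff(3)[of "v t" "\<tau> n t"] \<tau>H[OF t(2), of n] \<tau>b[of n t] t by simp
        then have "nrm H1 (\<lambda>x. v t x - \<tau> n t x) = 0" for n by (simp add: antisym)
        then show ?thesis by simp
      next
        case False
        then have pos: "nrm H1 (v t) < 2 * nrm H1 (v t)" using nrm_H1_nonneg[of "v t"] by linarith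
        have "(\<lambda>n. nrm H1 (\<sigma> n t)) \<longlonglongrightarrow> nrm H1 (v t)"
          using t \<sigma>H by (intro nrm_H1_continuous) (auto simp: fun_diff_def)
        from order_tendstoD(2)[OF this pos]
        have "\<forall>\<^sub>F n in sequentially. nrm H1 (\<sigma> n t - v t) = nrm H1 (\<lambda>x. v t x - \<tau> n t x)"
          by eventually_elim (use t \<sigma>H in \<open>simp add: \<tau>_def fun_diff_def nrm_H1_diff_commute\<close>)
        then show ?thesis using t by (auto intro: Lim_transform_eventually)
      qed
      then show "(\<lambda>n. (nrm H1 (\<lambda>x. v t x - \<tau> n t x))\<^sup>2) \<longlonglongrightarrow> 0" by (auto intro!: tendsto_eq_intros)
    qed
  qed auto
  then have "(\<lambda>n. LINT t|?M. (nrm H1 (\<lambda>x. v t x - \<tau> n t x))\<^sup>2) \<longlonglongrightarrow> 0" by simp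
  from order_tendstoD(2)[OF this e]
  obtain n where "(LINT t|?M. (nrm H1 (\<lambda>x. v t x - \<tau> n t x))\<^sup>2) < e"
    using eventually_happens'[OF sequentially_bot] by blast
  then show ?thesis using \<tau>s \<tau>H integ by blast
qed

text \<open>In the finite sum of values times indicators of level sets the indicators are replaced
  by continuous functions. The squared error is passed on through a majorant \<open>g\<close> that
  is nonnegative everywhere and has small integral, because it will be summed over single grid
  points.\<close>

lemma continuous_approx_L2_time:
  fixes v :: "real \<Rightarrow> 'a::euclidean_space \<Rightarrow> complex"
  assumes v: "v \<in> elts (L2_time T H1)" and e: "0 < e"
  obtains P g where "\<And>t. P t \<in> elts H1"
    "\<And>\<kappa>. 0 < \<kappa> \<Longrightarrow> \<exists>\<delta>>0. \<forall>t\<in>{0..T}. \<forall>t'\<in>{0..T}. \<bar>t' - t\<bar> < \<delta> \<longrightarrow> nrm H1 (\<lambda>x. P t' x - P t x) < \<kappa>"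
    "integrable (lebesgue_on {0<..<T}) g" "\<And>t. 0 \<le> g t"
    "\<And>t. t \<in> {0<..<T} \<Longrightarrow> v t \<in> elts H1 \<Longrightarrow> (nrm H1 (\<lambda>x. v t x - P t x))\<^sup>2 \<le> g t"
    "(LINT t|lebesgue_on {0<..<T}. g t) < e"
proof -
  let ?M = "lebesgue_on {0<..<T}"
  interpret finite_measure ?M by (rule finite_measure_lebesgue_on_interval)
  obtain \<tau> where \<tau>: "simple_function ?M \<tau>" "\<And>t. t \<in> {0<..<T} \<Longrightarrow> \<tau> t \<in> elts H1"
    "integrable ?M (\<lambda>t. (nrm H1 (\<lambda>x. v t x - \<tau> t x))\<^sup>2)"
    "(LINT t|?M. (nrm H1 (\<lambda>x. v t x - \<tau> t x))\<^sup>2) < e / 4"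
    using simple_approx_L2_time[OF v, of "e / 4"] e by auto
  define C where "C = \<tau> ` {0<..<T}"
  have C: "finite C" "C \<subseteq> elts H1" using \<tau>(1,2) by (auto simp: C_def simple_function_def)
  define E where "E c = {t \<in> {0<..<T}. \<tau> t = c}" for c
  have E: "E c \<in> sets lebesgue" for c
  proof -
    have "\<tau> -` {c} \<inter> space ?M \<in> sets ?M" using \<tau>(1) by (rule simple_functionD(2))
    moreover have "\<tau> -` {c} \<inter> space ?M = E c" by (auto simp: E_def)
    ultimately show ?thesis by (auto simp: sets_restrict_space intro!: sets.Int)
  qed
  \<comment> \<open>Cauchy-Schwarz over the finitely many values costs the factor
    \<open>card C\<close>; the 1 keeps \<open>B\<close> positive. With tolerance e/(4B) for each
    indicator the second part of the integral of \<open>g\<close> is at most e/2, and the first part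
    is below e/2 by the choice of \<open>\<tau>\<close>.\<close>
  define B where "B = real (card C) * (\<Sum>c\<in>C. (nrm H1 c)\<^sup>2) + 1"
  have B: "0 < B" unfolding B_def by (intro add_nonneg_pos mult_nonneg_nonneg sum_nonneg) auto
  have "\<forall>c. \<exists>\<psi>. continuous_on UNIV \<psi> \<and> (\<forall>t. 0 \<le> \<psi> t \<and> \<psi> t \<le> 1) \<and>
      (LINT t|?M. (indicator (E c) t - \<psi> t)\<^sup>2) < e / (4 * B)"
    using indicator_approx_continuous[OF E] e B by simp
  then obtain \<psi> where \<psi>: "\<And>c. continuous_on UNIV (\<psi> c)" "\<And>c t. 0 \<le> \<psi> c t" "\<And>c t. \<psi> c t \<le> 1"
      "\<And>c. (LINT t|?M. (indicator (E c) t - \<psi> c t)\<^sup>2) < e / (4 * B)"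
    by metis
  define P where "P t x = (\<Sum>c\<in>C. of_real (\<psi> c t) * c x)" for t x
  have PH: "P t \<in> elts H1" for t
    unfolding P_def[abs_def] using C by (intro conjunct1[OF H1_sum] H1_scale) auto
  have Pdiff: "nrm H1 (\<lambda>x. (\<Sum>c\<in>C. of_real (f c) * c x) - (\<Sum>c\<in>C. of_real (f' c) * c x)) \<le> (\<Sum>c\<in>C. \<bar>f c - f' c\<bar> * nrm H1 c)"
    for f f' :: "('a \<Rightarrow> complex) \<Rightarrow> real"
  proof -
    have "nrm H1 (\<lambda>x. (\<Sum>c\<in>C. of_real (f c) * c x) - (\<Sum>c\<in>C. of_real (f' c) * c x))
        = nrm H1 (\<lambda>x. \<Sum>c\<in>C. of_real (f c - f' c) * c x)"
      by (simp add: sum_subtractf left_diff_distrib)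
    also have "\<dots> \<le> (\<Sum>c\<in>C. nrm H1 (\<lambda>x. of_real (f c - f' c) * c x))"
      using C by (intro conjunct2[OF H1_sum] H1_scale) auto
    also have "\<dots> = (\<Sum>c\<in>C. \<bar>f c - f' c\<bar> * nrm H1 c)"
      using C(2) by (intro sum.cong refl) (auto simp: H1_scale(2) simp flip: of_real_diff)
    finally show ?thesis .
  qed
  define g where "g t = 2 * (nrm H1 (\<lambda>x. v t x - \<tau> t x))\<^sup>2 +
     2 * (real (card C) * (\<Sum>c\<in>C. (indicator (E c) t - \<psi> c t)\<^sup>2 * (nrm H1 c)\<^sup>2))" for t
  have i1: "integrable ?M (\<lambda>t. (indicator (E c) t - \<psi> c t)\<^sup>2)" for c
  proof (rule integrable_const_bound[where B=1])
    show "AE t in ?M. norm ((indicator (E c) t - \<psi> c t)\<^sup>2) \<le> 1"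
    proof (rule AE_I2)
      fix t
      have "\<bar>indicator (E c) t - \<psi> c t\<bar> \<le> 1" using \<psi>(2,3)[of c t] by (auto simp: indicator_def)
      then show "norm ((indicator (E c) t - \<psi> c t)\<^sup>2) \<le> 1" by (simp add: abs_square_le_1)
    qed
    have "\<psi> c \<in> borel_measurable ?M"
      using continuous_on_subset[OF \<psi>(1), of "{0<..<T}" c] by (intro continuous_imp_measurable_on_sets_lebesgue) auto
    moreover have "(indicator (E c) :: real \<Rightarrow> real) \<in> borel_measurable ?M"
      using E[of c] by (intro measurable_restrict_space1) auto
    ultimately show "(\<lambda>t. (indicator (E c) t - \<psi> c t)\<^sup>2) \<in> borel_measurable ?M" by measurable
  qed
  show ?thesis
  proof (rule that[of P g])
    show "P t \<in> elts H1" for t by (rule PH)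
    show "\<exists>\<delta>>0. \<forall>t\<in>{0..T}. \<forall>t'\<in>{0..T}. \<bar>t' - t\<bar> < \<delta> \<longrightarrow> nrm H1 (\<lambda>x. P t' x - P t x) < \<kappa>" if k0: "0 < \<kappa>" for \<kappa>
    proof -
      have "uniformly_continuous_on {0..T} (\<psi> c)" for c
        by (intro compact_uniformly_continuous continuous_on_subset[OF \<psi>(1)]) auto
      then obtain \<delta> where \<delta>: "\<delta> > 0" "\<forall>t\<in>{0..T}. \<forall>t'\<in>{0..T}. \<bar>t' - t\<bar> < \<delta> \<longrightarrow> (\<Sum>c\<in>C. \<bar>\<psi> c t' - \<psi> c t\<bar> * nrm H1 c) < \<kappa>"
        using uniformly_continuous_sum_modulus[OF C(1), of "{0..T}" \<psi> "nrm H1" \<kappa>] k0 by auto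
      have "nrm H1 (\<lambda>x. P t' x - P t x) \<le> (\<Sum>c\<in>C. \<bar>\<psi> c t' - \<psi> c t\<bar> * nrm H1 c)" for t t'
        unfolding P_def by (rule Pdiff)
      then show ?thesis using \<delta> by (meson le_less_trans)
    qed
    show "integrable ?M g"
      unfolding g_def using \<tau>(3) i1 by (intro Bochner_Integration.integrable_add integrable_mult_right Bochner_Integration.integrable_sum integrable_mult_left) auto
    show "0 \<le> g t" for t unfolding g_def by (intro add_nonneg_nonneg mult_nonneg_nonneg sum_nonneg) auto
    show "(nrm H1 (\<lambda>x. v t x - P t x))\<^sup>2 \<le> g t" if t: "t \<in> {0<..<T}" and vt: "v t \<in> elts H1" for t
    proof -
      have "\<tau> t = (\<lambda>x. \<Sum>c\<in>C. of_real (indicator (E c) t) * c x)"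
      proof
        fix x
        have "(\<Sum>c\<in>C. of_real (indicator (E c) t) * c x) = (\<Sum>c\<in>C. if c = \<tau> t then c x else 0)"
          using t by (intro sum.cong refl) (auto simp: E_def)
        also have "\<dots> = \<tau> t x" using C(1) t by (simp add: C_def)
        finally show "\<tau> t x = (\<Sum>c\<in>C. of_real (indicator (E c) t) * c x)" by simp
      qed
      then have tP: "nrm H1 (\<lambda>x. \<tau> t x - P t x) \<le> (\<Sum>c\<in>C. \<bar>indicator (E c) t - \<psi> c t\<bar> * nrm H1 c)"
        using Pdiff[of "\<lambda>c. indicator (E c) t" "\<lambda>c. \<psi> c t"] by (simp add: P_def)
      have "(nrm H1 (\<lambda>x. \<tau> t x - P t x))\<^sup>2 \<le> (\<Sum>c\<in>C. \<bar>indicator (E c) t - \<psi> c t\<bar> * nrm H1 c)\<^sup>2"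
        by (intro power_mono tP) simp
      also have "\<dots> \<le> (\<Sum>c\<in>C. (\<bar>indicator (E c) t - \<psi> c t\<bar> * nrm H1 c)\<^sup>2) * real (card C)"
        by (rule sum_squared_le_sum_of_squares)
      also have "\<dots> = real (card C) * (\<Sum>c\<in>C. (indicator (E c) t - \<psi> c t)\<^sup>2 * (nrm H1 c)\<^sup>2)"
        by (simp add: power_mult_distrib mult.commute)
      finally have 1: "(nrm H1 (\<lambda>x. \<tau> t x - P t x))\<^sup>2 \<le> real (card C) * (\<Sum>c\<in>C. (indicator (E c) t - \<psi> c t)\<^sup>2 * (nrm H1 c)\<^sup>2)" .
      have "(nrm H1 (\<lambda>x. v t x - P t x))\<^sup>2 \<le> (nrm H1 (\<lambda>x. v t x - \<tau> t x) + nrm H1 (\<lambda>x. \<tau> t x - P t x))\<^sup>2"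
        using H1_triangle[OF vt \<tau>(2)[OF t] PH] by (intro power_mono) auto
      also have "\<dots> \<le> 2 * (nrm H1 (\<lambda>x. v t x - \<tau> t x))\<^sup>2 + 2 * (nrm H1 (\<lambda>x. \<tau> t x - P t x))\<^sup>2"
        using sum_squares_bound[of "nrm H1 (\<lambda>x. v t x - \<tau> t x)" "nrm H1 (\<lambda>x. \<tau> t x - P t x)"] by (simp add: power2_sum)
      finally show ?thesis unfolding g_def using 1 by linarith
    qed
    have "(LINT t|?M. g t) = 2 * (LINT t|?M. (nrm H1 (\<lambda>x. v t x - \<tau> t x))\<^sup>2) +
        2 * (real (card C) * (\<Sum>c\<in>C. (LINT t|?M. (indicator (E c) t - \<psi> c t)\<^sup>2) * (nrm H1 c)\<^sup>2))"
      unfolding g_def using \<tau>(3) i1 by (simp add: Bochner_Integration.integral_sum)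
    also have "\<dots> \<le> 2 * (LINT t|?M. (nrm H1 (\<lambda>x. v t x - \<tau> t x))\<^sup>2) +
        2 * (real (card C) * (\<Sum>c\<in>C. e / (4 * B) * (nrm H1 c)\<^sup>2))"
      by (intro add_left_mono mult_left_mono sum_mono mult_right_mono less_imp_le[OF \<psi>(4)]) auto
    also have "2 * (real (card C) * (\<Sum>c\<in>C. e / (4 * B) * (nrm H1 c)\<^sup>2)) = e / (2 * B) * (B - 1)"
    proof -
      have "2 * (k * (e / (4 * x) * S)) = e / (2 * x) * (k * S)" for k x S :: real by simp
      moreover have "real (card C) * (\<Sum>c\<in>C. (nrm H1 c)\<^sup>2) = B - 1" by (simp add: B_def)
      ultimately show ?thesis unfolding sum_distrib_left[symmetric] by (simp only:)
    qed
    also have "\<dots> \<le> e / (2 * B) * B"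
      using e B by (intro mult_left_mono) auto
    also have "\<dots> = e / 2" using B by simp
    finally show "(LINT t|?M. g t) < e" using \<tau>(4) by simp
  qed
qed

section \<open>Weak derivatives in time\<close>

lemma L2_inner_bound:
  assumes "f \<in> elts L2" "g \<in> elts L2"
  shows "cmod (L2_inner f g) \<le> nrm L2 f * nrm L2 g"
  unfolding L2_inner_def
  using L2_mult_integrable(3)[OF assms(1) L2_cnj(1)[OF assms(2)]] L2_cnj(2)[OF assms(2)] by simp

lemma L2_inner_diff:
  assumes f: "f \<in> elts L2" and g: "g \<in> elts L2" and h: "h \<in> elts L2"
  shows "L2_inner (\<lambda>x. f x - g x) h = L2_inner f h - L2_inner g h"
  unfolding L2_inner_def left_diff_distrib
  by (intro Bochner_Integration.integral_diff L2_mult_integrable(1) f g L2_cnj h)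

lemma L2_inner_cong_AE:
  assumes f: "f \<in> elts L2" and g: "g \<in> elts L2" and f': "f' \<in> elts L2" and g': "g' \<in> elts L2"
    and eq: "AE x in lborel. f x = f' x" "AE x in lborel. g x = g' x"
  shows "L2_inner f g = L2_inner f' g'"
  unfolding L2_inner_def
proof (rule integral_cong_AE)
  note [measurable] = L2_measurable[OF f] L2_measurable[OF g] L2_measurable[OF f'] L2_measurable[OF g']
  show "(\<lambda>x. f x * cnj (g x)) \<in> borel_measurable lborel" "(\<lambda>x. f' x * cnj (g' x)) \<in> borel_measurable lborel" by measurable
  show "AE x in lborel. f x * cnj (g x) = f' x * cnj (g' x)" using eq by eventually_elim simp
qed

lemma Re_L2_inner_self: "Re (L2_inner f f) = (nrm L2 f)\<^sup>2"
  by (simp add: L2_inner_def nrm_L2_power2 complex_norm_square[symmetric] del: of_real_power)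

text \<open>The difference of the two sides is the squared norm of \<open>f - g\<close>. The test
  element on the right is the newer state \<open>f\<close>, which makes the inequality go in the
  direction of an upper bound.\<close>

lemma nrm_L2_power2_diff_le:
  assumes f: "f \<in> elts L2" and g: "g \<in> elts L2"
  shows "(nrm L2 f)\<^sup>2 - (nrm L2 g)\<^sup>2 \<le> 2 * (Re (L2_inner f f) - Re (L2_inner g f))"
proof -
  have i: "integrable lborel (\<lambda>x. (norm (f x))\<^sup>2)" "integrable lborel (\<lambda>x. (norm (g x))\<^sup>2)"
    using f g by (auto simp: elts_L2)
  have j: "integrable lborel (\<lambda>x. g x * cnj (f x))" by (intro L2_mult_integrable(1) L2_cnj f g)
  define h where "h x = Re (g x * cnj (f x))" for x
  have h: "integrable lborel h" "(LINT x|lborel. h x) = Re (L2_inner g f)"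
    using integrable_Re[OF j] integral_Re[OF j] unfolding h_def[abs_def] L2_inner_def by simp_all
  have "0 \<le> (LINT x|lborel. (norm (f x))\<^sup>2 + (norm (g x))\<^sup>2 - 2 * h x)"
  proof (rule integral_nonneg_AE, rule AE_I2)
    fix x
    have "(norm (f x))\<^sup>2 + (norm (g x))\<^sup>2 - 2 * Re (g x * cnj (f x)) = (norm (f x - g x))\<^sup>2"
      unfolding cmod_power2 by (simp add: power2_eq_square algebra_simps)
    then show "0 \<le> (norm (f x))\<^sup>2 + (norm (g x))\<^sup>2 - 2 * h x" by (simp add: h_def)
  qed
  also have "\<dots> = (nrm L2 f)\<^sup>2 + (nrm L2 g)\<^sup>2 - 2 * Re (L2_inner g f)"
    using i h by (simp add: nrm_L2_power2)
  finally show ?thesis by (simp add: Re_L2_inner_self)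
qed

section \<open>Point evaluation in time by bump functions\<close>

lemma cutoff_2_integral:
  "integrable lborel (cutoff 2)" "(LINT x|lborel. cutoff 2 x) = 1"
proof -
  have d: "(cutoff 0 has_real_derivative cutoff 2 x) (at x)" for x
    using cutoff_has_real_derivative[of 0 x] by (simp add: numeral_2_eq_2)
  have c0: "cutoff 2 x * indicator {0..} x = cutoff 2 x" for x
    by (auto simp: cutoff_def indicator_def)
  \<comment> \<open>The antiderivative \<open>cutoff 0\<close> rises from 0 at the origin to 1 at
    infinity, so \<open>cutoff 2\<close> is a probability density.\<close>
  have nn: "(\<integral>\<^sup>+x. ennreal (cutoff 2 x) * indicator {0..} x \<partial>lborel) = ennreal (1 - cutoff 0 0)"
    by (rule nn_integral_FTC_atLeast) (auto intro: d cutoff_nonneg cutoff_0_tendsto)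
  moreover have "ennreal (cutoff 2 x) * indicator {0..} x = ennreal (cutoff 2 x)" for x
    by (auto simp: cutoff_def indicator_def)
  ultimately have nn1: "(\<integral>\<^sup>+x. ennreal (cutoff 2 x) \<partial>lborel) = 1"
    by (simp add: cutoff_def)
  then show i: "integrable lborel (cutoff 2)"
    by (intro integrableI_bounded) (auto simp: cutoff_nonneg)
  have "ennreal (LINT x|lborel. cutoff 2 x) = 1"
    using nn1 nn_integral_eq_integral[OF i] by (simp add: cutoff_nonneg)
  then show "(LINT x|lborel. cutoff 2 x) = 1"
    by (metis enn2real_1 enn2real_ennreal cutoff_nonneg integral_nonneg_AE AE_I2)
qed

text \<open>After the substitution \<sigma> = (n+1)(\<tau> - r) the kernel is the fixed density
  \<open>cutoff 2\<close> and \<open>y\<close> is evaluated at r + \<sigma>/(n+1). The second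
  factor, which belongs to the far end \<open>t\<close>, tends to 1 because r < t.\<close>

lemma cutoff_2_approximate_identity:
  fixes y :: "real \<Rightarrow> complex"
  assumes y: "continuous_on UNIV y" and b: "\<And>\<tau>. cmod (y \<tau>) \<le> B" and rt: "r < t"
  shows "(\<lambda>n. LINT \<tau>|lborel. of_real (real (Suc n) * cutoff 2 (real (Suc n) * (\<tau> - r)) * cutoff 0 (real (Suc n) * (t - \<tau>))) * y \<tau>) \<longlonglongrightarrow> y r"
proof -
  have [measurable]: "y \<in> borel_measurable borel" by (rule borel_measurable_continuous_onI[OF y])
  have B: "0 \<le> B" using b[of 0] norm_ge_zero order_trans by blast
  let ?g = "\<lambda>n \<sigma>. of_real (cutoff 2 \<sigma> * cutoff 0 (real (Suc n) * (t - r) - \<sigma>)) * y (r + \<sigma> / real (Suc n))"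
  have eq: "(LINT \<tau>|lborel. of_real (real (Suc n) * cutoff 2 (real (Suc n) * (\<tau> - r)) * cutoff 0 (real (Suc n) * (t - \<tau>))) * y \<tau>)
      = (LINT \<sigma>|lborel. ?g n \<sigma>)" for n
  proof -
    let ?N = "real (Suc n)"
    have N: "?N > 0" by simp
    have "(LINT \<tau>|lborel. of_real (?N * cutoff 2 (?N * (\<tau> - r)) * cutoff 0 (?N * (t - \<tau>))) * y \<tau>)
       = \<bar>1 / ?N\<bar> *\<^sub>R (LINT \<sigma>|lborel. of_real (?N * cutoff 2 (?N * ((r + (1 / ?N) * \<sigma>) - r)) * cutoff 0 (?N * (t - (r + (1 / ?N) * \<sigma>)))) * y (r + (1 / ?N) * \<sigma>))"
      by (rule lborel_integral_real_affine) simp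
    also have "\<dots> = (LINT \<sigma>|lborel. (1 / ?N) *\<^sub>R (of_real (?N * cutoff 2 (?N * ((r + (1 / ?N) * \<sigma>) - r)) * cutoff 0 (?N * (t - (r + (1 / ?N) * \<sigma>)))) * y (r + (1 / ?N) * \<sigma>)))"
      by simp
    also have "\<dots> = (LINT \<sigma>|lborel. ?g n \<sigma>)"
    proof (intro Bochner_Integration.integral_cong refl)
      fix \<sigma>
      have "?N * ((r + (1 / ?N) * \<sigma>) - r) = \<sigma>" "?N * (t - (r + (1 / ?N) * \<sigma>)) = ?N * (t - r) - \<sigma>"
        using N by (simp_all add: right_diff_distrib distrib_left del: of_nat_Suc)
      then show "(1 / ?N) *\<^sub>R (of_real (?N * cutoff 2 (?N * ((r + (1 / ?N) * \<sigma>) - r)) * cutoff 0 (?N * (t - (r + (1 / ?N) * \<sigma>)))) * y (r + (1 / ?N) * \<sigma>)) = ?g n \<sigma>"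
        using N by (simp add: scaleR_conv_of_real del: of_nat_Suc)
    qed
    finally show ?thesis .
  qed
  have "(\<lambda>n. LINT \<sigma>|lborel. ?g n \<sigma>) \<longlonglongrightarrow> (LINT \<sigma>|lborel. of_real (cutoff 2 \<sigma>) * y r)"
  proof (rule integral_dominated_convergence[where w="\<lambda>\<sigma>. cutoff 2 \<sigma> * B"])
    show "integrable lborel (\<lambda>\<sigma>. cutoff 2 \<sigma> * B)" by (intro integrable_mult_left cutoff_2_integral)
    show "AE \<sigma> in lborel. (\<lambda>n. ?g n \<sigma>) \<longlonglongrightarrow> of_real (cutoff 2 \<sigma>) * y r"
    proof (rule AE_I2)
      fix \<sigma> :: real
      have "filterlim (\<lambda>n. real (Suc n) * (t - r) - \<sigma>) at_top sequentially" using rt by real_asymp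
      then have 1: "(\<lambda>n. cutoff 0 (real (Suc n) * (t - r) - \<sigma>)) \<longlonglongrightarrow> 1"
        by (rule filterlim_compose[OF cutoff_0_tendsto])
      have "(\<lambda>n. r + \<sigma> / real (Suc n)) \<longlonglongrightarrow> r + 0"
        by (intro tendsto_add tendsto_const LIMSEQ_Suc[OF lim_const_over_n])
      moreover have "isCont y (r + 0)" using y by (simp add: continuous_on_eq_continuous_at)
      ultimately have 2: "(\<lambda>n. y (r + \<sigma> / real (Suc n))) \<longlonglongrightarrow> y (r + 0)"
        using isCont_tendsto_compose by blast
      have "(\<lambda>n. ?g n \<sigma>) \<longlonglongrightarrow> of_real (cutoff 2 \<sigma> * 1) * y (r + 0)"
        by (intro tendsto_mult tendsto_of_real tendsto_const 1 2)
      then show "(\<lambda>n. ?g n \<sigma>) \<longlonglongrightarrow> of_real (cutoff 2 \<sigma>) * y r" by simp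
    qed
    show "AE \<sigma> in lborel. norm (?g n \<sigma>) \<le> cutoff 2 \<sigma> * B" for n
    proof (rule AE_I2)
      fix \<sigma>
      have "norm (?g n \<sigma>) = cutoff 2 \<sigma> * cutoff 0 (real (Suc n) * (t - r) - \<sigma>) * cmod (y (r + \<sigma> / real (Suc n)))"
        by (simp add: norm_mult abs_mult cutoff_nonneg del: of_nat_Suc)
      also have "\<dots> \<le> cutoff 2 \<sigma> * 1 * B"
        by (intro mult_mono mult_nonneg_nonneg cutoff_nonneg cutoff_0_le_1 b B) auto
      finally show "norm (?g n \<sigma>) \<le> cutoff 2 \<sigma> * B" by simp
    qed
  qed measurable
  moreover have "(LINT \<sigma>|lborel. complex_of_real (cutoff 2 \<sigma>) * y r) = y r"
    using cutoff_2_integral by simp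
  ultimately show ?thesis by (simp only: eq)
qed

lemma deriv_box_bump_real:
  "deriv (box_bump n r t) \<tau> = n * cutoff 2 (n * (\<tau> - r)) * cutoff 0 (n * (t - \<tau>))
      - n * cutoff 2 (n * (t - \<tau>)) * cutoff 0 (n * (\<tau> - r))"
proof (rule DERIV_imp_deriv)
  have c: "(cutoff 0 has_real_derivative cutoff 2 x) (at x)" for x
    using cutoff_has_real_derivative[of 0 x] by (simp add: numeral_2_eq_2)
  have 1: "((\<lambda>\<tau>. cutoff 0 (n * (\<tau> - r))) has_real_derivative cutoff 2 (n * (\<tau> - r)) * n) (at \<tau>)"
    by (rule DERIV_chain2[OF c]) (auto intro!: derivative_eq_intros)
  have 2: "((\<lambda>\<tau>. cutoff 0 (n * (t - \<tau>))) has_real_derivative cutoff 2 (n * (t - \<tau>)) * - n) (at \<tau>)"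
    by (rule DERIV_chain2[OF c]) (auto intro!: derivative_eq_intros)
  have "box_bump n r t = (\<lambda>\<tau>. cutoff 0 (n * (\<tau> - r)) * cutoff 0 (n * (t - \<tau>)))"
    by (simp add: box_bump_def fun_eq_iff)
  moreover have "((\<lambda>\<tau>. cutoff 0 (n * (\<tau> - r)) * cutoff 0 (n * (t - \<tau>))) has_real_derivative
      n * cutoff 2 (n * (\<tau> - r)) * cutoff 0 (n * (t - \<tau>)) - n * cutoff 2 (n * (t - \<tau>)) * cutoff 0 (n * (\<tau> - r))) (at \<tau>)"
    by (rule DERIV_cong[OF DERIV_mult[OF 1 2]]) (simp add: algebra_simps)
  ultimately show "(box_bump n r t has_real_derivative n * cutoff 2 (n * (\<tau> - r)) * cutoff 0 (n * (t - \<tau>))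
      - n * cutoff 2 (n * (t - \<tau>)) * cutoff 0 (n * (\<tau> - r))) (at \<tau>)"
    by simp
qed

text \<open>The derivative of the bump over (r,t) is positive mass 1 concentrating at
  \<open>r\<close> and negative mass 1 concentrating at \<open>t\<close>.\<close>

lemma integral_deriv_bump_tendsto:
  fixes y :: "real \<Rightarrow> complex"
  assumes y: "continuous_on UNIV y" and b: "\<And>\<tau>. cmod (y \<tau>) \<le> B" and rt: "r < t"
  shows "(\<lambda>n. LINT \<tau>|lborel. of_real (deriv (box_bump (real (Suc n)) r t) \<tau>) * y \<tau>) \<longlonglongrightarrow> y r - y t"
proof -
  have [measurable]: "y \<in> borel_measurable borel" by (rule borel_measurable_continuous_onI[OF y])
  have B0: "0 \<le> B" using b[of 0] norm_ge_zero order_trans by blast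
  let ?N = "\<lambda>n. real (Suc n)"
  let ?A = "\<lambda>n \<tau>. complex_of_real (?N n * cutoff 2 (?N n * (\<tau> - r)) * cutoff 0 (?N n * (t - \<tau>))) * y \<tau>"
  let ?B = "\<lambda>n \<tau>. complex_of_real (?N n * cutoff 2 (?N n * (t - \<tau>)) * cutoff 0 (?N n * (\<tau> - r))) * y \<tau>"
  have int: "integrable lborel (\<lambda>\<tau>. complex_of_real (?N n * cutoff 2 (?N n * (c + d * \<tau>)) * cutoff 0 (?N n * (e + f * \<tau>))) * y \<tau>)"
    if d: "d \<noteq> 0" for n c d e f
  proof (rule Bochner_Integration.integrable_bound)
    have "integrable lborel (\<lambda>\<tau>. cutoff 2 (?N n * c + ?N n * d * \<tau>))"
      by (rule lborel_integrable_real_affine[OF cutoff_2_integral(1)]) (use d in simp)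
    then show "integrable lborel (\<lambda>\<tau>. ?N n * B * cutoff 2 (?N n * (c + d * \<tau>)))"
      by (simp add: distrib_left mult.assoc)
    show "AE \<tau> in lborel. norm (complex_of_real (?N n * cutoff 2 (?N n * (c + d * \<tau>)) * cutoff 0 (?N n * (e + f * \<tau>))) * y \<tau>)
       \<le> norm (?N n * B * cutoff 2 (?N n * (c + d * \<tau>)))"
    proof (rule AE_I2)
      fix \<tau>
      have "norm (complex_of_real (?N n * cutoff 2 (?N n * (c + d * \<tau>)) * cutoff 0 (?N n * (e + f * \<tau>))) * y \<tau>)
        = ?N n * cutoff 2 (?N n * (c + d * \<tau>)) * cutoff 0 (?N n * (e + f * \<tau>)) * cmod (y \<tau>)"
        by (simp add: norm_mult abs_mult cutoff_nonneg del: of_nat_Suc)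
      also have "\<dots> \<le> ?N n * cutoff 2 (?N n * (c + d * \<tau>)) * 1 * B"
        by (intro mult_mono mult_nonneg_nonneg cutoff_nonneg cutoff_0_le_1 b) auto
      also have "\<dots> = norm (?N n * B * cutoff 2 (?N n * (c + d * \<tau>)))"
        using B0 by (simp add: abs_mult cutoff_nonneg mult_ac del: of_nat_Suc)
      finally show "norm (complex_of_real (?N n * cutoff 2 (?N n * (c + d * \<tau>)) * cutoff 0 (?N n * (e + f * \<tau>))) * y \<tau>)
       \<le> norm (?N n * B * cutoff 2 (?N n * (c + d * \<tau>)))" .
    qed
  qed measurable
  have iA: "integrable lborel (?A n)" for n using int[of 1 n "- r" t "- 1"] by simp
  have iB: "integrable lborel (?B n)" for n using int[of "- 1" n t "- r" 1] by simp
  have A: "(\<lambda>n. LINT \<tau>|lborel. ?A n \<tau>) \<longlonglongrightarrow> y r" by (rule cutoff_2_approximate_identity[OF y b rt])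
  \<comment> \<open>The mass at \<open>t\<close> reduces to the one at the left end by the
    reflection \<tau> to -\<tau>, which turns (r,t) into (-t,-r).\<close>
  have "(\<lambda>n. LINT \<tau>|lborel. of_real (?N n * cutoff 2 (?N n * (\<tau> - (- t))) * cutoff 0 (?N n * (- r - \<tau>))) * y (- \<tau>)) \<longlonglongrightarrow> y (- (- t))"
  proof (rule cutoff_2_approximate_identity)
    show "continuous_on UNIV (\<lambda>\<tau>. y (- \<tau>))"
      by (rule continuous_on_compose2[OF y]) (auto intro: continuous_intros)
  qed (use b rt in auto)
  moreover have "(LINT \<tau>|lborel. of_real (?N n * cutoff 2 (?N n * (\<tau> - (- t))) * cutoff 0 (?N n * (- r - \<tau>))) * y (- \<tau>)) = (LINT \<tau>|lborel. ?B n \<tau>)" for n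
  proof -
    have "(LINT \<tau>|lborel. ?B n \<tau>) = \<bar>- 1\<bar> *\<^sub>R (LINT \<tau>|lborel. ?B n (0 + - 1 * \<tau>))"
      by (rule lborel_integral_real_affine) simp
    also have "\<dots> = (LINT \<tau>|lborel. of_real (?N n * cutoff 2 (?N n * (\<tau> - (- t))) * cutoff 0 (?N n * (- r - \<tau>))) * y (- \<tau>))"
      by (simp add: add.commute minus_diff_commute del: of_nat_Suc)
    finally show ?thesis by simp
  qed
  ultimately have B: "(\<lambda>n. LINT \<tau>|lborel. ?B n \<tau>) \<longlonglongrightarrow> y t" by simp
  have "(LINT \<tau>|lborel. of_real (deriv (box_bump (?N n) r t) \<tau>) * y \<tau>) = (LINT \<tau>|lborel. ?A n \<tau>) - (LINT \<tau>|lborel. ?B n \<tau>)" for n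
    unfolding deriv_box_bump_real of_real_diff left_diff_distrib by (rule Bochner_Integration.integral_diff[OF iA iB])
  then show ?thesis using tendsto_diff[OF A B] by simp
qed

text \<open>Passes from Lebesgue integrals over the open time interval to gauge integrals over
  closed intervals, where splitting into adjacent subintervals is convenient.\<close>

lemma lebesgue_on_interval_integral:
  fixes f :: "real \<Rightarrow> 'b::euclidean_space"
  assumes f: "integrable (lebesgue_on {0<..<T}) f"
  shows "f integrable_on {0..T}" and "(LINT t|lebesgue_on {0<..<T}. f t) = integral {0..T} f"
    and "0 \<le> r \<Longrightarrow> t \<le> T \<Longrightarrow> f integrable_on {r..t}"
proof -
  have "f integrable_on {0<..<T}" by (rule integrable_on_lebesgue_on[OF f]) simp
  then show i: "f integrable_on {0..T}" by (simp add: integrable_on_open_interval_real)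
  have "(LINT t|lebesgue_on {0<..<T}. f t) = integral {0<..<T} f"
    by (rule lebesgue_integral_eq_integral[OF f]) simp
  then show "(LINT t|lebesgue_on {0<..<T}. f t) = integral {0..T} f" by (simp add: integral_open_interval_real)
  show "0 \<le> r \<Longrightarrow> t \<le> T \<Longrightarrow> f integrable_on {r..t}"
    using integrable_on_subinterval[OF i, of r t] by auto
qed

lemma integral_le_AE:
  fixes f g :: "real \<Rightarrow> real"
  assumes f: "f integrable_on {a..b}" and g: "g integrable_on {a..b}" and N: "negligible N"
    and le: "\<And>x. x \<in> {a..b} - N \<Longrightarrow> f x \<le> g x"
  shows "integral {a..b} f \<le> integral {a..b} g"
proof -
  let ?f = "\<lambda>x. if x \<in> N then g x else f x"
  have f': "?f integrable_on {a..b}" by (rule integrable_spike[OF f N]) auto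
  have "integral {a..b} f = integral {a..b} ?f" by (rule integral_spike[OF N]) auto
  also have "\<dots> \<le> integral {a..b} g" by (rule integral_le[OF f' g]) (use le in auto)
  finally show ?thesis .
qed

lemma L2_inner_continuous_on:
  fixes V :: "real \<Rightarrow> 'a::euclidean_space \<Rightarrow> complex"
  assumes V: "\<And>t. t \<in> S \<Longrightarrow> V t \<in> elts L2"
      "\<And>t. t \<in> S \<Longrightarrow> ((\<lambda>r. nrm L2 (\<lambda>x. V r x - V t x)) \<longlongrightarrow> 0) (at t within S)"
    and \<phi>: "\<phi> \<in> elts L2"
  shows "continuous_on S (\<lambda>t. L2_inner (V t) \<phi>)"
  unfolding continuous_on_def
proof
  fix t assume t: "t \<in> S"
  have "((\<lambda>r. L2_inner (V r) \<phi> - L2_inner (V t) \<phi>) \<longlongrightarrow> 0) (at t within S)"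
  proof (rule Lim_null_comparison)
    show "\<forall>\<^sub>F r in at t within S. norm (L2_inner (V r) \<phi> - L2_inner (V t) \<phi>) \<le> nrm L2 (\<lambda>x. V r x - V t x) * nrm L2 \<phi>"
      unfolding eventually_at_filter
      using L2_inner_bound[OF L2_diff(1)[OF V(1) V(1)[OF t]] \<phi>] L2_inner_diff[OF V(1) V(1)[OF t] \<phi>]
      by (auto intro!: always_eventually)
    show "((\<lambda>r. nrm L2 (\<lambda>x. V r x - V t x) * nrm L2 \<phi>) \<longlongrightarrow> 0) (at t within S)"
      using tendsto_mult_left_zero[OF V(2)[OF t]] .
  qed
  then show "((\<lambda>t. L2_inner (V t) \<phi>) \<longlongrightarrow> L2_inner (V t) \<phi>) (at t within S)"
    by (simp add: LIM_zero_iff)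
qed

lemma nrm_L2_continuous_on:
  fixes V :: "real \<Rightarrow> 'a::euclidean_space \<Rightarrow> complex"
  assumes V: "\<And>t. t \<in> S \<Longrightarrow> V t \<in> elts L2"
      "\<And>t. t \<in> S \<Longrightarrow> ((\<lambda>r. nrm L2 (\<lambda>x. V r x - V t x)) \<longlongrightarrow> 0) (at t within S)"
  shows "continuous_on S (\<lambda>t. nrm L2 (V t))"
  unfolding continuous_on_def
proof
  fix t assume t: "t \<in> S"
  have "((\<lambda>r. nrm L2 (V r) - nrm L2 (V t)) \<longlongrightarrow> 0) (at t within S)"
  proof (rule Lim_null_comparison[OF _ V(2)[OF t]])
    have "norm (nrm L2 (V r) - nrm L2 (V t)) \<le> nrm L2 (\<lambda>x. V r x - V t x)" if r: "r \<in> S" for r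
      using L2_triangle[OF V(1)[OF r] V(1)[OF t] L2_zero(1)] L2_triangle[OF V(1)[OF t] V(1)[OF r] L2_zero(1)]
        nrm_L2_diff_commute[of "V r" "V t"] by simp
    then show "\<forall>\<^sub>F r in at t within S. norm (nrm L2 (V r) - nrm L2 (V t)) \<le> nrm L2 (\<lambda>x. V r x - V t x)"
      unfolding eventually_at_filter by (auto intro!: always_eventually)
  qed
  then show "((\<lambda>t. nrm L2 (V t)) \<longlongrightarrow> nrm L2 (V t)) (at t within S)"
    by (simp add: LIM_zero_iff)
qed

text \<open>The time test functions are bumps over (r,t). On one side they tend to the indicator of
  (r,t), on the other their derivatives evaluate the pairing at the end points. Such point values
  make sense for the continuous representative \<open>V\<close>.\<close>

lemma weak_time_derivative_increment:
  fixes V v :: "real \<Rightarrow> 'a::euclidean_space \<Rightarrow> complex"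
  assumes V: "\<And>t. t \<in> {0..T} \<Longrightarrow> V t \<in> elts L2"
      "\<And>t. t \<in> {0..T} \<Longrightarrow> ((\<lambda>r. nrm L2 (\<lambda>x. V r x - V t x)) \<longlongrightarrow> 0) (at t within {0..T})"
    and v: "AE t in lebesgue_on {0<..<T}. v t \<in> elts L2 \<and> (AE x in lborel. V t x = v t x)"
    and wd: "has_weak_time_derivative T v w"
    and \<phi>: "\<phi> \<in> elts H1"
    and z: "integrable (lebesgue_on {0<..<T}) (\<lambda>t. w t \<phi>)"
    and rt: "0 < r" "r < t" "t < T"
  shows "L2_inner (V t) \<phi> - L2_inner (V r) \<phi> = integral {r..t} (\<lambda>\<sigma>. w \<sigma> \<phi>)"
proof -
  let ?M = "lebesgue_on {0<..<T}"
  have \<phi>2: "\<phi> \<in> elts L2" by (rule H1_L2[OF \<phi>])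
  define y0 where "y0 \<tau> = L2_inner (V \<tau>) \<phi>" for \<tau>
  have y0: "continuous_on {0..T} y0"
    unfolding y0_def by (rule L2_inner_continuous_on[OF V \<phi>2])
  \<comment> \<open>Clamping the argument to [0,T] extends the pairing to a bounded continuous
    function on the whole line, as the approximate identity requires.\<close>
  define y where "y \<tau> = y0 (max 0 (min T \<tau>))" for \<tau>
  have T: "0 < T" using rt by simp
  have y: "continuous_on UNIV y"
    unfolding y_def by (rule continuous_on_compose2[OF y0]) (use T in \<open>auto intro!: continuous_intros\<close>)
  have "compact (y0 ` {0..T})" by (rule compact_continuous_image[OF y0]) simp
  then obtain B where B: "\<And>\<tau>. \<tau> \<in> {0..T} \<Longrightarrow> cmod (y0 \<tau>) \<le> B"
    using compact_imp_bounded bounded_iff by (metis imageI)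
  have b: "cmod (y \<tau>) \<le> B" for \<tau> unfolding y_def using T by (intro B) auto
  have ym[measurable]: "y \<in> borel_measurable borel" by (rule borel_measurable_continuous_onI[OF y])
  define \<eta> where "\<eta> n = box_bump (real (Suc n)) r t" for n
  have \<eta>m[measurable]: "\<eta> n \<in> borel_measurable borel" for n unfolding \<eta>_def by measurable
  have \<eta>dm[measurable]: "deriv (\<eta> n) \<in> borel_measurable borel" for n
    unfolding \<eta>_def deriv_box_bump_real[abs_def] by measurable
  have \<eta>t: "\<eta> n \<in> test_functions {0<..<T}" for n
  proof -
    have "cbox r t \<subseteq> {0<..<T}" using rt by (auto simp: cbox_interval)
    from box_bump_test_function[OF cutoff_algebra.const[of "1::real"] _ this, of "real (Suc n)"]
    show ?thesis by (simp add: \<eta>_def del: of_nat_Suc)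
  qed
  have wd': "(LINT \<tau>|?M. of_real (\<eta> n \<tau>) * w \<tau> \<phi>) = - (LINT \<tau>|?M. of_real (deriv (\<eta> n) \<tau>) * L2_inner (v \<tau>) \<phi>)" for n
    using wd \<eta>t \<phi> unfolding has_weak_time_derivative_def by blast
  have sp: "AE \<tau> in ?M. \<tau> \<in> {0<..<T}" using AE_space[of ?M] by simp
  have ae: "AE \<tau> in ?M. of_real (deriv (\<eta> n) \<tau>) * y \<tau> = of_real (deriv (\<eta> n) \<tau>) * L2_inner (v \<tau>) \<phi>" for n
    using v sp
  proof eventually_elim
    fix \<tau> assume *: "v \<tau> \<in> elts L2 \<and> (AE x in lborel. V \<tau> x = v \<tau> x)" "\<tau> \<in> {0<..<T}"
    then have "y \<tau> = L2_inner (V \<tau>) \<phi>" by (simp add: y_def y0_def)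
    also have "\<dots> = L2_inner (v \<tau>) \<phi>"
      using * V(1)[of \<tau>] \<phi>2 by (intro L2_inner_cong_AE) auto
    finally show "of_real (deriv (\<eta> n) \<tau>) * y \<tau> = of_real (deriv (\<eta> n) \<tau>) * L2_inner (v \<tau>) \<phi>" by simp
  qed
  have m1: "(\<lambda>\<tau>. complex_of_real (deriv (\<eta> n) \<tau>) * y \<tau>) \<in> borel_measurable ?M" for n
  proof -
    have "(\<lambda>\<tau>. complex_of_real (deriv (\<eta> n) \<tau>) * y \<tau>) \<in> borel_measurable lborel" by measurable
    then show ?thesis by (intro measurable_restrict_space1 measurable_completion)
  qed
  have m2: "(\<lambda>\<tau>. complex_of_real (deriv (\<eta> n) \<tau>) * L2_inner (v \<tau>) \<phi>) \<in> borel_measurable ?M" for n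
    by (rule borel_measurable_lebesgue_on_AE[OF _ m1 ae]) simp
  have supp: "indicator {0<..<T} \<tau> *\<^sub>R (complex_of_real (deriv (\<eta> n) \<tau>) * y \<tau>) = complex_of_real (deriv (\<eta> n) \<tau>) * y \<tau>" for n \<tau>
  proof (cases "\<tau> \<in> {0<..<T}")
    case False
    then have "real (Suc n) * (\<tau> - r) \<le> 0 \<or> real (Suc n) * (t - \<tau>) \<le> 0"
      using rt by (auto simp: mult_le_0_iff)
    then have "deriv (\<eta> n) \<tau> = 0" unfolding \<eta>_def deriv_box_bump_real by (auto simp: cutoff_def)
    then show ?thesis by simp
  qed simp
  have RHS: "(LINT \<tau>|?M. of_real (deriv (\<eta> n) \<tau>) * L2_inner (v \<tau>) \<phi>) = (LINT \<tau>|lborel. of_real (deriv (\<eta> n) \<tau>) * y \<tau>)" for n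
  proof -
    have "(LINT \<tau>|?M. of_real (deriv (\<eta> n) \<tau>) * L2_inner (v \<tau>) \<phi>) = (LINT \<tau>|?M. of_real (deriv (\<eta> n) \<tau>) * y \<tau>)"
      by (rule integral_cong_AE[OF m2 m1]) (use ae[of n] in \<open>auto elim: eventually_mono\<close>)
    also have "\<dots> = (LINT \<tau>|lebesgue. indicator {0<..<T} \<tau> *\<^sub>R (of_real (deriv (\<eta> n) \<tau>) * y \<tau>))"
      by (rule integral_restrict_space) simp
    also have "\<dots> = (LINT \<tau>|lebesgue. of_real (deriv (\<eta> n) \<tau>) * y \<tau>)"
      by (simp only: supp)
    also have "\<dots> = (LINT \<tau>|lborel. of_real (deriv (\<eta> n) \<tau>) * y \<tau>)"
      by (rule integral_completion) measurable
    finally show ?thesis .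
  qed
  have lim1: "(\<lambda>n. LINT \<tau>|?M. of_real (\<eta> n \<tau>) * w \<tau> \<phi>) \<longlonglongrightarrow> - (y r - y t)"
    unfolding wd' RHS unfolding \<eta>_def by (intro tendsto_minus integral_deriv_bump_tendsto[OF y b rt(2)])
  have zm: "(\<lambda>\<tau>. w \<tau> \<phi>) \<in> borel_measurable ?M" by (rule borel_measurable_integrable[OF z])
  have lim2: "(\<lambda>n. LINT \<tau>|?M. of_real (\<eta> n \<tau>) * w \<tau> \<phi>) \<longlonglongrightarrow> (LINT \<tau>|?M. of_real (indicator (box r t) \<tau>) * w \<tau> \<phi>)"
  proof (rule integral_dominated_convergence[where w="\<lambda>\<tau>. norm (w \<tau> \<phi>)"])
    show "integrable ?M (\<lambda>\<tau>. norm (w \<tau> \<phi>))" using z by simp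
    show "AE \<tau> in ?M. (\<lambda>n. of_real (\<eta> n \<tau>) * w \<tau> \<phi>) \<longlonglongrightarrow> of_real (indicator (box r t) \<tau>) * w \<tau> \<phi>"
      unfolding \<eta>_def by (intro AE_I2 tendsto_mult tendsto_of_real tendsto_const box_bump_tendsto_indicator)
    show "AE \<tau> in ?M. norm (of_real (\<eta> n \<tau>) * w \<tau> \<phi>) \<le> norm (w \<tau> \<phi>)" for n
      unfolding \<eta>_def using box_bump_nonneg[of _ r t] box_bump_le_1[of _ r t]
      by (intro AE_I2) (simp add: norm_mult mult_left_le_one_le)
    have bm: "f \<in> borel_measurable ?M" if "f \<in> borel_measurable borel" for f :: "real \<Rightarrow> complex"
      using that by (intro measurable_restrict_space1 measurable_completion) simp
    have "(\<lambda>\<tau>. complex_of_real (\<eta> n \<tau>)) \<in> borel_measurable ?M" for n by (rule bm) measurable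
    then show "(\<lambda>\<tau>. of_real (\<eta> n \<tau>) * w \<tau> \<phi>) \<in> borel_measurable ?M" for n
      using zm by measurable
    have "(\<lambda>\<tau>. complex_of_real (indicator (box r t) \<tau>)) \<in> borel_measurable ?M" by (rule bm) measurable
    then show "(\<lambda>\<tau>. of_real (indicator (box r t) \<tau>) * w \<tau> \<phi>) \<in> borel_measurable ?M"
      using zm by measurable
  qed
  have "(LINT \<tau>|?M. of_real (indicator (box r t) \<tau>) * w \<tau> \<phi>) = (LINT \<tau>|lebesgue. indicator {0<..<T} \<tau> *\<^sub>R (of_real (indicator (box r t) \<tau>) * w \<tau> \<phi>))"
    by (rule integral_restrict_space) simp
  also have "\<dots> = (LINT \<tau>:{r<..<t}|lebesgue. w \<tau> \<phi>)"
    unfolding set_lebesgue_integral_def using rt by (intro Bochner_Integration.integral_cong refl) (auto simp: indicator_def)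
  also have "\<dots> = integral {r<..<t} (\<lambda>\<tau>. w \<tau> \<phi>)"
  proof (rule set_lebesgue_integral_eq_integral(2))
    have "set_integrable lebesgue {0<..<T} (\<lambda>\<tau>. w \<tau> \<phi>)"
      using z by (simp add: integrable_restrict_space set_integrable_def)
    then show "set_integrable lebesgue {r<..<t} (\<lambda>\<tau>. w \<tau> \<phi>)"
      by (rule set_integrable_subset) (use rt in auto)
  qed
  also have "\<dots> = integral {r..t} (\<lambda>\<tau>. w \<tau> \<phi>)" by (simp add: integral_open_interval_real)
  finally have "integral {r..t} (\<lambda>\<tau>. w \<tau> \<phi>) = - (y r - y t)"
    using LIMSEQ_unique[OF lim1 lim2] by simp
  then show ?thesis using rt by (simp add: y_def y0_def)
qed

text \<open>Cut [0,nh] into \<open>n\<close> cells and shift each back to [0,h]: the integral over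
  all offsets of the sum of \<open>g\<close> on the translated grid is exactly the integral of
  \<open>g\<close>.\<close>

lemma integral_offset_sum:
  fixes g :: "real \<Rightarrow> real"
  assumes "0 \<le> h" "g integrable_on {0..real n * h}"
  shows "((\<lambda>\<theta>. \<Sum>j<n. g (\<theta> + real j * h)) has_integral integral {0..real n * h} g) {0..h}"
  using assms(2)
proof (induction n)
  case 0
  then show ?case by simp
next
  case (Suc n)
  have le: "0 \<le> real n * h" "real n * h \<le> real (Suc n) * h" using assms(1) by (auto simp: distrib_right)
  have i1: "g integrable_on {0..real n * h}" and i2: "g integrable_on {real n * h..real (Suc n) * h}"
    using integrable_on_subinterval[OF Suc.prems] le by (auto simp del: of_nat_Suc)
  have "(g has_integral integral {real n * h..real (Suc n) * h} g) (cbox (0 + real n * h) (h + real n * h))"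
    using integrable_integral[OF i2] by (simp add: algebra_simps)
  then have "((g \<circ> (+) (real n * h)) has_integral integral {real n * h..real (Suc n) * h} g) (cbox 0 h)"
    by (subst has_integral_shift_cbox_iff)
  then have "((\<lambda>\<theta>. g (\<theta> + real n * h)) has_integral integral {real n * h..real (Suc n) * h} g) {0..h}"
    by (simp add: o_def add.commute)
  from has_integral_add[OF Suc.IH[OF i1] this]
  have "((\<lambda>\<theta>. \<Sum>j<Suc n. g (\<theta> + real j * h)) has_integral
      integral {0..real n * h} g + integral {real n * h..real (Suc n) * h} g) {0..h}" by simp
  also have "integral {0..real n * h} g + integral {real n * h..real (Suc n) * h} g = integral {0..real (Suc n) * h} g"
    by (rule Henstock_Kurzweil_Integration.integral_combine[OF le Suc.prems])
  finally show ?case .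
qed

text \<open>If almost every offset gave a Riemann sum above the integral plus \<open>e\<close>,
  integration over the offsets would contradict \<open>integral_offset_sum\<close>. The good offset
  can moreover be taken so that no grid point falls into the null set.\<close>

lemma exists_offset:
  fixes g :: "real \<Rightarrow> real"
  assumes n: "0 < n" and t: "0 < t" and g: "g integrable_on {0..t}" and N: "negligible N" and e: "0 < e"
  obtains \<theta> where "0 < \<theta>" "\<theta> < t / real n" "\<And>j. j < n \<Longrightarrow> \<theta> + real j * (t / real n) \<notin> N"
    "t / real n * (\<Sum>j<n. g (\<theta> + real j * (t / real n))) \<le> integral {0..t} g + e"
proof -
  define h where "h = t / real n"
  have h: "0 < h" and nh: "real n * h = t" using n t by (auto simp: h_def)
  define G where "G \<theta> = (\<Sum>j<n. g (\<theta> + real j * h))" for \<theta>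
  have G: "(G has_integral integral {0..t} g) {0..h}"
    unfolding G_def using integral_offset_sum[of h g n] g h by (simp add: nh)
  \<comment> \<open>Finitely many translates of \<open>N\<close> form the offsets that put some grid
    point into \<open>N\<close>; adding 0 and \<open>h\<close> forces the offset into the open
    cell.\<close>
  define N' where "N' = (\<Union>j<n. (\<lambda>x. x - real j * h) ` N) \<union> {0, h}"
  have N': "negligible N'"
  proof -
    have "negligible ((\<lambda>x. x - c) ` N)" for c using negligible_translation[OF N, of "- c"] by simp
    then show ?thesis unfolding N'_def by (intro negligible_Un negligible_Union) auto
  qed
  have "\<exists>\<theta>\<in>{0..h} - N'. h * G \<theta> \<le> integral {0..t} g + e"
  proof (rule ccontr)
    assume "\<not> ?thesis"
    then have gt: "integral {0..t} g + e < h * G \<theta>" if "\<theta> \<in> {0..h} - N'" for \<theta> using that by force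
    have "integral {0..h} (\<lambda>_. integral {0..t} g + e) \<le> integral {0..h} (\<lambda>\<theta>. h * G \<theta>)"
      using G gt by (intro integral_le_AE[OF _ _ N']) (auto simp: integrable_on_def intro!: has_integral_mult_right less_imp_le)
    then have "h * (integral {0..t} g + e) \<le> h * integral {0..t} g"
      using h integral_unique[OF G] by simp
    then show False using h e by simp
  qed
  then obtain \<theta> where \<theta>: "\<theta> \<in> {0..h}" "\<theta> \<notin> N'" "h * G \<theta> \<le> integral {0..t} g + e" by auto
  have "\<theta> + real j * h \<notin> N" if "j < n" for j
  proof
    assume "\<theta> + real j * h \<in> N"
    then have "\<theta> \<in> (\<lambda>x. x - real j * h) ` N" by (auto intro!: image_eqI[of _ _ "\<theta> + real j * h"])
    then show False using \<theta>(2) that by (auto simp: N'_def)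
  qed
  moreover have "0 < \<theta>" "\<theta> < h" using \<theta>(1,2) by (auto simp: N'_def less_le)
  ultimately show ?thesis using that[of \<theta>] \<theta>(3) by (simp add: h_def G_def)
qed

section \<open>The energy inequality\<close>

text \<open>The step estimate \<open>|V t'|\<^sup>2 - |V t|\<^sup>2 \<le> 2 Re (V t' - V t, V t')\<close> needs the equation only
  with the fixed test function \<open>V t'\<close>. Averaging over the offset of an equidistant grid, \<open>v\<close> at the
  grid points is as close to the nearby values of \<open>v\<close> as \<open>v\<close> is to functions continuous in time.\<close>

lemma energy_inequality_step:
  fixes V v :: "real \<Rightarrow> 'a::euclidean_space \<Rightarrow> complex" and D :: "real \<Rightarrow> ('a \<Rightarrow> complex) \<Rightarrow> complex"
  assumes VL: "V r \<in> elts L2" "V t \<in> elts L2"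
    and vt: "v t \<in> elts H1" "AE x in lborel. V t x = v t x"
    and inc: "L2_inner (V t) (v t) - L2_inner (V r) (v t) = integral {r..t} (\<lambda>\<sigma>. D \<sigma> (v t))"
    and Di: "(\<lambda>\<sigma>. D \<sigma> (v t)) integrable_on {r..t}"
    and rt: "r \<le> t"
    and f: "f integrable_on {r..t}" and N: "negligible N"
    and bound: "\<And>\<sigma>. \<sigma> \<in> {r..t} - N \<Longrightarrow> Re (D \<sigma> (v t)) \<le> f \<sigma> + c"
  shows "(nrm L2 (V t))\<^sup>2 - (nrm L2 (V r))\<^sup>2 \<le> 2 * integral {r..t} f + 2 * (t - r) * c"
proof -
  have v2: "v t \<in> elts L2" by (rule H1_L2[OF vt(1)])
  \<comment> \<open>\<open>V t\<close> carries the norm and \<open>v t\<close> is the representative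
    in H1 that may serve as test function; they agree almost everywhere in space.\<close>
  have "L2_inner (V t) (V t) = L2_inner (V t) (v t)" "L2_inner (V r) (V t) = L2_inner (V r) (v t)"
    using vt(2) by (auto intro!: L2_inner_cong_AE VL v2)
  then have "(nrm L2 (V t))\<^sup>2 - (nrm L2 (V r))\<^sup>2 \<le> 2 * Re (L2_inner (V t) (v t) - L2_inner (V r) (v t))"
    using nrm_L2_power2_diff_le[OF VL(2,1)] by simp
  also have "Re (L2_inner (V t) (v t) - L2_inner (V r) (v t)) = integral {r..t} (\<lambda>\<sigma>. Re (D \<sigma> (v t)))"
    unfolding inc using integral_linear[OF Di bounded_linear_Re] by (simp add: o_def)
  also have "\<dots> \<le> integral {r..t} (\<lambda>\<sigma>. f \<sigma> + c)"
    using integrable_linear[OF Di bounded_linear_Re] f N bound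
    by (intro integral_le_AE[of _ _ _ _ N] integrable_add integrable_const_ivl) (auto simp: o_def)
  also have "\<dots> = integral {r..t} f + (t - r) * c"
    using f rt by (subst integral_add) (auto simp: integrable_const_ivl)
  finally show ?thesis by (simp add: algebra_simps)
qed

text \<open>From l x <= lam/2 l^2 + x^2/(2 lam) and (a+b+c)^2 <= 3 (a^2+b^2+c^2). The three summands
  will be the distance of \<open>v\<close> to its approximation at the grid point, the variation of
  the approximation within a cell, and the distance at the running time.\<close>

lemma young_three:
  fixes l x a b c lam :: real
  assumes "0 < lam" "0 \<le> x" "x \<le> a + b + c"
  shows "l * x \<le> lam / 2 * l\<^sup>2 + 3 / (2 * lam) * (a\<^sup>2 + b\<^sup>2 + c\<^sup>2)"
proof -
  have "x\<^sup>2 \<le> (a + b + c)\<^sup>2" using assms by (intro power_mono) auto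
  also have "\<dots> \<le> 3 * (a\<^sup>2 + b\<^sup>2 + c\<^sup>2)"
    using sum_squares_bound[of a b] sum_squares_bound[of a c] sum_squares_bound[of b c]
    by (simp add: power2_eq_square algebra_simps)
  finally have x: "x\<^sup>2 / (2 * lam) \<le> 3 * (a\<^sup>2 + b\<^sup>2 + c\<^sup>2) / (2 * lam)"
    using assms(1) by (intro divide_right_mono) auto
  have "0 \<le> (lam * l - x)\<^sup>2 / (2 * lam)" using assms(1) by simp
  also have "\<dots> = lam / 2 * l\<^sup>2 + x\<^sup>2 / (2 * lam) - l * x"
    using assms(1) by (simp add: field_simps power2_eq_square)
  finally show ?thesis using x by simp
qed

text \<open>\<open>q\<close> bounds the functional at \<open>v\<close> itself, and \<open>L\<close>
  is the price per unit of H1 distance for testing with another element. The Young parameter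
  \<open>lam\<close> converts this price into a multiple of the integral of \<open>L^2\<close>. Of
  the constant 12, one half comes from the errors at the grid points and one half from the errors
  inside the cells.\<close>

lemma energy_inequality_approx:
  fixes V v :: "real \<Rightarrow> 'a::euclidean_space \<Rightarrow> complex" and D :: "real \<Rightarrow> ('a \<Rightarrow> complex) \<Rightarrow> complex"
  assumes V: "\<And>t. t \<in> {0..T} \<Longrightarrow> V t \<in> elts L2"
      "\<And>t. t \<in> {0..T} \<Longrightarrow> ((\<lambda>r. nrm L2 (\<lambda>x. V r x - V t x)) \<longlongrightarrow> 0) (at t within {0..T})"
    and v: "v \<in> elts (L2_time T H1)"
    and ae: "AE t in lebesgue_on {0<..<T}. v t \<in> elts H1 \<and> (AE x in lborel. V t x = v t x) \<and>
       (\<forall>\<phi>\<in>elts H1. Re (D t \<phi>) \<le> q t + L t * nrm H1 (\<lambda>x. \<phi> x - v t x))"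
    and inc: "\<And>r t \<phi>. 0 < r \<Longrightarrow> r < t \<Longrightarrow> t < T \<Longrightarrow> \<phi> \<in> elts H1 \<Longrightarrow>
       L2_inner (V t) \<phi> - L2_inner (V r) \<phi> = integral {r..t} (\<lambda>\<sigma>. D \<sigma> \<phi>)"
    and Di: "\<And>\<phi>. \<phi> \<in> elts H1 \<Longrightarrow> integrable (lebesgue_on {0<..<T}) (\<lambda>\<sigma>. D \<sigma> \<phi>)"
    and q: "integrable (lebesgue_on {0<..<T}) q"
    and L: "integrable (lebesgue_on {0<..<T}) (\<lambda>\<sigma>. (L \<sigma>)\<^sup>2)"
    and t: "0 < t" "t \<le> T" and lam: "0 < lam"
  shows "(nrm L2 (V t))\<^sup>2 - (nrm L2 (V 0))\<^sup>2 \<le> 2 * integral {0..t} q + lam * (integral {0..T} (\<lambda>\<sigma>. (L \<sigma>)\<^sup>2) + 12)"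
proof -
  let ?M = "lebesgue_on {0<..<T}"
  have T: "0 < T" using t by simp
  \<comment> \<open>\<open>\<kappa>\<close> is the permitted variation of the approximation within a
    cell. Dividing by T + 1 ensures \<open>\<kappa>^2 * t <= lam^2\<close>, as t <= T <=
    (T+1)^2.\<close>
  define \<kappa> where "\<kappa> = lam / (T + 1)"
  have \<kappa>: "0 < \<kappa>" "\<kappa>\<^sup>2 * t \<le> lam\<^sup>2"
  proof -
    show "0 < \<kappa>" using lam T by (simp add: \<kappa>_def)
    have "T + 1 \<le> (T + 1)\<^sup>2" by (rule self_le_power) (use T in auto)
    then have "\<kappa>\<^sup>2 * t \<le> \<kappa>\<^sup>2 * (T + 1)\<^sup>2"
      using t by (intro mult_left_mono) auto
    also have "\<dots> = (\<kappa> * (T + 1))\<^sup>2" by (simp add: power_mult_distrib)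
    also have "\<kappa> * (T + 1) = lam" using T by (simp add: \<kappa>_def)
    finally show "\<kappa>\<^sup>2 * t \<le> lam\<^sup>2" .
  qed
  \<comment> \<open>Young's inequality divides squared errors by \<open>lam\<close>, so accuracy
    \<open>lam^2\<close> in the squared norm leaves errors of order \<open>lam\<close>.\<close>
  have lam2: "0 < lam\<^sup>2" using lam by simp
  show ?thesis
  proof (rule continuous_approx_L2_time[OF v lam2])
    fix P g
    assume PH: "\<And>t. P t \<in> elts H1"
      and Pc: "\<And>\<kappa>. 0 < \<kappa> \<Longrightarrow> \<exists>\<delta>>0. \<forall>t\<in>{0..T}. \<forall>t'\<in>{0..T}. \<bar>t' - t\<bar> < \<delta> \<longrightarrow> nrm H1 (\<lambda>x. P t' x - P t x) < \<kappa>"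
      and g: "integrable ?M g" "\<And>t. 0 \<le> g t"
        "\<And>t. t \<in> {0<..<T} \<Longrightarrow> v t \<in> elts H1 \<Longrightarrow> (nrm H1 (\<lambda>x. v t x - P t x))\<^sup>2 \<le> g t"
        "(LINT t|?M. g t) < lam\<^sup>2"
    obtain \<delta> where \<delta>: "0 < \<delta>" "\<And>t t'. t \<in> {0..T} \<Longrightarrow> t' \<in> {0..T} \<Longrightarrow> \<bar>t' - t\<bar> < \<delta> \<Longrightarrow> nrm H1 (\<lambda>x. P t' x - P t x) < \<kappa>"
      using Pc[OF \<kappa>(1)] by blast
    define good where "good t \<longleftrightarrow> v t \<in> elts H1 \<and> (AE x in lborel. V t x = v t x) \<and>
         (\<forall>\<phi>\<in>elts H1. Re (D t \<phi>) \<le> q t + L t * nrm H1 (\<lambda>x. \<phi> x - v t x))" for t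
    have "AE t in lebesgue. t \<in> {0<..<T} \<longrightarrow> good t"
      using ae unfolding good_def by (subst (asm) AE_restrict_space_iff) auto
    then obtain N where N: "N \<in> null_sets lebesgue" "{t. \<not> (t \<in> {0<..<T} \<longrightarrow> good t)} \<subseteq> N"
      unfolding eventually_ae_filter by auto
    have negN: "negligible N" using N(1) by (simp add: negligible_iff_null_sets)
    have good: "good t" if "t \<in> {0<..<T}" "t \<notin> N" for t using N(2) that by auto
    \<comment> \<open>The part of the step bound that varies within a cell. The remaining term, a
      multiple of \<open>g\<close> at the right end of the cell, is constant there and is handled by
      the Riemann sum.\<close>
    define f where "f \<sigma> = q \<sigma> + (lam / 2 * (L \<sigma>)\<^sup>2 + 3 / (2 * lam) * (\<kappa>\<^sup>2 + g \<sigma>))" for \<sigma>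
    interpret finite_measure ?M by (rule finite_measure_lebesgue_on_interval)
    have fint: "integrable ?M f" unfolding f_def using q L g(1) by auto
    note HK = lebesgue_on_interval_integral
    define F where "F x = integral {0..x} f" for x
    have Fc: "continuous_on {0..T} F" unfolding F_def by (rule indefinite_integral_continuous_1[OF HK(1)[OF fint]])
    define E where "E x = (nrm L2 (V x))\<^sup>2" for x
    have Ec: "continuous_on {0..T} E" unfolding E_def by (intro continuous_intros nrm_L2_continuous_on V)
    have gt: "g integrable_on {0..t}" by (rule HK(3)[OF g(1)]) (use t in auto)
    have gI: "integral {0..t} g < lam\<^sup>2"
    proof -
      have "integral {0..t} g \<le> integral {0..T} g"
        by (rule integral_subset_le[OF _ gt HK(1)[OF g(1)]]) (use t g(2) in auto)
      then show ?thesis using g(4) HK(2)[OF g(1)] by simp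
    qed
    \<comment> \<open>A grid of \<open>n\<close> points has n - 1 cells, so the inequality runs from
      the offset only to the last grid point, which misses \<open>t\<close> by at most one cell.
      Both gaps close as \<open>n\<close> grows, by continuity of \<open>E\<close> and
      \<open>F\<close>. The error 6 lam is 3/lam times 2 lam^2, where one lam^2 bounds the integral
      of \<open>g\<close> and the other is the slack of the offset.\<close>
    have step: "\<exists>\<theta>. 0 < \<theta> \<and> \<theta> < t / real n \<and>
        E (\<theta> + real (n - 1) * (t / real n)) - E \<theta> \<le> 2 * (F (\<theta> + real (n - 1) * (t / real n)) - F \<theta>) + 6 * lam"
      if n: "0 < n" "t / real n < \<delta>" for n
    proof -
      define h where "h = t / real n"
      have h: "0 < h" "h < \<delta>" "real n * h = t" using n t by (auto simp: h_def)
      obtain \<theta> where \<theta>: "0 < \<theta>" "\<theta> < h" "\<And>j. j < n \<Longrightarrow> \<theta> + real j * h \<notin> N"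
        "h * (\<Sum>j<n. g (\<theta> + real j * h)) \<le> integral {0..t} g + lam\<^sup>2"
        using exists_offset[OF n(1) t(1) gt negN lam2] unfolding h_def by blast
      define \<tau> where "\<tau> j = \<theta> + real j * h" for j
      have \<tau>: "\<tau> j \<in> {0<..<T}" if "j < n" for j
      proof -
        have "real j + 1 \<le> real n" using that by linarith
        then have "(real j + 1) * h \<le> t" using h by (metis less_imp_le mult_right_mono)
        then have "\<theta> + real j * h < t" using \<theta>(2) by (simp add: distrib_right)
        moreover have "0 < \<theta> + real j * h" using \<theta>(1) h(1) by (simp add: add_pos_nonneg)
        ultimately show ?thesis using t by (simp add: \<tau>_def)
      qed
      have \<tau>S: "\<tau> (Suc j) - \<tau> j = h" for j by (simp add: \<tau>_def distrib_right)
      have one: "E (\<tau> (Suc j)) - E (\<tau> j) \<le> 2 * (F (\<tau> (Suc j)) - F (\<tau> j)) + 3 / lam * (h * g (\<tau> (Suc j)))"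
        if j: "Suc j < n" for j
      proof -
        have r: "\<tau> j \<in> {0<..<T}" "\<tau> (Suc j) \<in> {0<..<T}" "\<tau> j < \<tau> (Suc j)"
          using \<tau>[of j] \<tau>[of "Suc j"] j \<tau>S[of j] h by auto
        have gd: "good (\<tau> (Suc j))" using good[OF r(2)] \<theta>(3)[OF j] by (simp add: \<tau>_def)
        have vH: "v (\<tau> (Suc j)) \<in> elts H1" using gd by (simp add: good_def)
        have fi: "f integrable_on {\<tau> j..\<tau> (Suc j)}" using r by (intro HK(3)[OF fint]) auto
        have "E (\<tau> (Suc j)) - E (\<tau> j) \<le> 2 * integral {\<tau> j..\<tau> (Suc j)} f + 2 * (\<tau> (Suc j) - \<tau> j) * (3 / (2 * lam) * g (\<tau> (Suc j)))"
          unfolding E_def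
        proof (rule energy_inequality_step[where v=v and D=D and N=N])
          show "V (\<tau> j) \<in> elts L2" "V (\<tau> (Suc j)) \<in> elts L2" using V(1) r by auto
          show "AE x in lborel. V (\<tau> (Suc j)) x = v (\<tau> (Suc j)) x" using gd by (simp add: good_def)
          show "L2_inner (V (\<tau> (Suc j))) (v (\<tau> (Suc j))) - L2_inner (V (\<tau> j)) (v (\<tau> (Suc j))) =
              integral {\<tau> j..\<tau> (Suc j)} (\<lambda>\<sigma>. D \<sigma> (v (\<tau> (Suc j))))"
            using r by (intro inc vH) auto
          show "(\<lambda>\<sigma>. D \<sigma> (v (\<tau> (Suc j)))) integrable_on {\<tau> j..\<tau> (Suc j)}"
            using r by (intro HK(3)[OF Di[OF vH]]) auto
          fix \<sigma> assume \<sigma>: "\<sigma> \<in> {\<tau> j..\<tau> (Suc j)} - N"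
          then have \<sigma>T: "\<sigma> \<in> {0<..<T}" using r by auto
          have gs: "good \<sigma>" using good[OF \<sigma>T] \<sigma> by simp
          have vs: "v \<sigma> \<in> elts H1" using gs by (simp add: good_def)
          let ?x = "nrm H1 (\<lambda>x. v (\<tau> (Suc j)) x - v \<sigma> x)"
          have sq: "nrm H1 (\<lambda>x. v s x - P s x) \<le> sqrt (g s)" if "s \<in> {0<..<T}" "v s \<in> elts H1" for s
            using g(3)[OF that] by (rule real_le_rsqrt)
          have "?x \<le> nrm H1 (\<lambda>x. v (\<tau> (Suc j)) x - P (\<tau> (Suc j)) x) + nrm H1 (\<lambda>x. P (\<tau> (Suc j)) x - v \<sigma> x)"
            by (rule H1_triangle[OF vH PH vs])
          also have "nrm H1 (\<lambda>x. P (\<tau> (Suc j)) x - v \<sigma> x) \<le> nrm H1 (\<lambda>x. P (\<tau> (Suc j)) x - P \<sigma> x) + nrm H1 (\<lambda>x. P \<sigma> x - v \<sigma> x)"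
            by (rule H1_triangle[OF PH PH vs])
          also have "nrm H1 (\<lambda>x. P \<sigma> x - v \<sigma> x) = nrm H1 (\<lambda>x. v \<sigma> x - P \<sigma> x)"
            by (rule nrm_H1_diff_commute[OF PH vs])
          finally have "?x \<le> nrm H1 (\<lambda>x. v (\<tau> (Suc j)) x - P (\<tau> (Suc j)) x) + (nrm H1 (\<lambda>x. P (\<tau> (Suc j)) x - P \<sigma> x) + nrm H1 (\<lambda>x. v \<sigma> x - P \<sigma> x))"
            by simp
          moreover have "nrm H1 (\<lambda>x. P (\<tau> (Suc j)) x - P \<sigma> x) < \<kappa>"
            using \<sigma> r \<tau>S[of j] h by (intro \<delta>(2)) auto
          ultimately have x: "?x \<le> sqrt (g (\<tau> (Suc j))) + \<kappa> + sqrt (g \<sigma>)"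
            using sq[OF r(2) vH] sq[OF \<sigma>T vs] by linarith
          have "L \<sigma> * ?x \<le> lam / 2 * (L \<sigma>)\<^sup>2 + 3 / (2 * lam) * ((sqrt (g (\<tau> (Suc j))))\<^sup>2 + \<kappa>\<^sup>2 + (sqrt (g \<sigma>))\<^sup>2)"
            by (rule young_three[OF lam _ x]) simp
          also have "\<dots> = lam / 2 * (L \<sigma>)\<^sup>2 + 3 / (2 * lam) * (\<kappa>\<^sup>2 + g \<sigma>) + 3 / (2 * lam) * g (\<tau> (Suc j))"
            using g(2) by (simp add: distrib_left)
          finally have "L \<sigma> * ?x \<le> lam / 2 * (L \<sigma>)\<^sup>2 + 3 / (2 * lam) * (\<kappa>\<^sup>2 + g \<sigma>) + 3 / (2 * lam) * g (\<tau> (Suc j))" .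
          moreover have "Re (D \<sigma> (v (\<tau> (Suc j)))) \<le> q \<sigma> + L \<sigma> * ?x"
            using gs vH by (simp add: good_def)
          ultimately show "Re (D \<sigma> (v (\<tau> (Suc j)))) \<le> f \<sigma> + 3 / (2 * lam) * g (\<tau> (Suc j))"
            unfolding f_def by linarith
        qed (use r vH fi negN in auto)
        also have "integral {\<tau> j..\<tau> (Suc j)} f = F (\<tau> (Suc j)) - F (\<tau> j)"
          using Henstock_Kurzweil_Integration.integral_combine[of 0 "\<tau> j" "\<tau> (Suc j)" f] r HK(3)[OF fint, of 0 "\<tau> (Suc j)"]
          by (simp add: F_def)
        also have "2 * (\<tau> (Suc j) - \<tau> j) * (3 / (2 * lam) * g (\<tau> (Suc j))) = 3 / lam * (h * g (\<tau> (Suc j)))"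
          by (simp add: \<tau>S)
        finally show ?thesis .
      qed
      \<comment> \<open>The sum starts at 1 because each step is tested at its right end
        point.\<close>
      have sum: "E (\<tau> k) - E (\<tau> 0) \<le> 2 * (F (\<tau> k) - F (\<tau> 0)) + 3 / lam * (h * (\<Sum>j\<in>{1..k}. g (\<tau> j)))" if "k < n" for k
        using that
      proof (induction k)
        case 0
        then show ?case by simp
      next
        case (Suc k)
        have "3 / lam * (h * (\<Sum>j\<in>{1..Suc k}. g (\<tau> j))) = 3 / lam * (h * (\<Sum>j\<in>{1..k}. g (\<tau> j))) + 3 / lam * (h * g (\<tau> (Suc k)))"
          by (simp add: distrib_left)
        then show ?case using Suc.IH one[OF Suc.prems] Suc.prems by simp
      qed
      have "h * (\<Sum>j\<in>{1..n - 1}. g (\<tau> j)) \<le> h * (\<Sum>j<n. g (\<tau> j))"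
        using h(1) n(1) g(2) by (intro mult_left_mono sum_mono2) auto
      also have "\<dots> \<le> 2 * lam\<^sup>2" using \<theta>(4) gI by (simp add: \<tau>_def)
      finally have "3 / lam * (h * (\<Sum>j\<in>{1..n - 1}. g (\<tau> j))) \<le> 3 / lam * (2 * lam\<^sup>2)"
        using lam by (intro mult_left_mono) auto
      also have "\<dots> = 6 * lam" using lam by (simp add: power2_eq_square)
      finally have "E (\<tau> (n - 1)) - E (\<tau> 0) \<le> 2 * (F (\<tau> (n - 1)) - F (\<tau> 0)) + 6 * lam"
        using sum[of "n - 1"] n(1) by simp
      then show ?thesis using \<theta>(1,2) by (intro exI[of _ \<theta>]) (simp add: \<tau>_def h_def)
    qed
    \<comment> \<open>For the finitely many \<open>n\<close> whose mesh is still too wide, or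
      \<open>n = 0\<close>, the choice may be meaningless; only eventual statements are made about
      it.\<close>
    define \<Theta> where "\<Theta> n = (SOME \<theta>. 0 < \<theta> \<and> \<theta> < t / real n \<and>
        E (\<theta> + real (n - 1) * (t / real n)) - E \<theta> \<le> 2 * (F (\<theta> + real (n - 1) * (t / real n)) - F \<theta>) + 6 * lam)" for n
    define Z where "Z n = \<Theta> n + real (n - 1) * (t / real n)" for n
    have tn0: "(\<lambda>n. t / real n) \<longlonglongrightarrow> 0" by (rule lim_const_over_n)
    have ev: "\<forall>\<^sub>F n in sequentially. 0 < \<Theta> n \<and> \<Theta> n < t / real n \<and> E (Z n) - E (\<Theta> n) \<le> 2 * (F (Z n) - F (\<Theta> n)) + 6 * lam"
      using eventually_gt_at_top[of 0] order_tendstoD(2)[OF tn0 \<delta>(1)]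
    proof eventually_elim
      fix n assume n: "0 < n" "t / real n < \<delta>"
      from someI_ex[OF step[OF this]] show "0 < \<Theta> n \<and> \<Theta> n < t / real n \<and> E (Z n) - E (\<Theta> n) \<le> 2 * (F (Z n) - F (\<Theta> n)) + 6 * lam"
        unfolding Z_def \<Theta>_def .
    qed
    have \<Theta>0: "\<Theta> \<longlonglongrightarrow> 0"
      by (rule tendsto_sandwich[OF _ _ tendsto_const tn0]) (use ev in \<open>auto elim!: eventually_mono\<close>)
    have Zb: "\<forall>\<^sub>F n in sequentially. t - t / real n \<le> Z n \<and> Z n \<le> t"
      using ev eventually_gt_at_top[of 0]
    proof eventually_elim
      fix n :: nat assume a: "0 < \<Theta> n \<and> \<Theta> n < t / real n \<and> E (Z n) - E (\<Theta> n) \<le> 2 * (F (Z n) - F (\<Theta> n)) + 6 * lam" and n: "0 < n"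
      have "real (n - 1) * (t / real n) = t - t / real n"
        using n by (simp add: of_nat_diff field_simps)
      then show "t - t / real n \<le> Z n \<and> Z n \<le> t" using a by (simp add: Z_def)
    qed
    have Z: "Z \<longlonglongrightarrow> t"
    proof (rule tendsto_sandwich[OF _ _ _ tendsto_const])
      show "(\<lambda>n. t - t / real n) \<longlonglongrightarrow> t" using tendsto_diff[OF tendsto_const tn0, of t] by simp
    qed (use Zb in \<open>auto elim!: eventually_mono\<close>)
    have inT: "\<forall>\<^sub>F n in sequentially. \<Theta> n \<in> {0..T}" "\<forall>\<^sub>F n in sequentially. Z n \<in> {0..T}"
    proof -
      have *: "\<forall>\<^sub>F n in sequentially. t / real n \<le> t"
        using eventually_ge_at_top[of 1] by eventually_elim (use t in \<open>simp add: divide_le_eq mult_le_cancel_left1\<close>)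
      show "\<forall>\<^sub>F n in sequentially. \<Theta> n \<in> {0..T}" using ev * by eventually_elim (use t in auto)
      show "\<forall>\<^sub>F n in sequentially. Z n \<in> {0..T}" using Zb * by eventually_elim (use t in auto)
    qed
    have lims: "(\<lambda>n. G (Z n)) \<longlonglongrightarrow> G t" "(\<lambda>n. G (\<Theta> n)) \<longlonglongrightarrow> G 0" if "continuous_on {0..T} G" for G :: "real \<Rightarrow> real"
      using continuous_on_tendsto_compose[OF that Z _ inT(2)] continuous_on_tendsto_compose[OF that \<Theta>0 _ inT(1)] t by auto
    have "E t - E 0 \<le> 2 * (F t - F 0) + 6 * lam"
    proof (rule tendsto_le[OF sequentially_bot])
      show "(\<lambda>n. E (Z n) - E (\<Theta> n)) \<longlonglongrightarrow> E t - E 0" by (intro tendsto_diff lims Ec)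
      show "(\<lambda>n. 2 * (F (Z n) - F (\<Theta> n)) + 6 * lam) \<longlonglongrightarrow> 2 * (F t - F 0) + 6 * lam"
        by (intro tendsto_intros lims Fc)
      show "\<forall>\<^sub>F n in sequentially. E (Z n) - E (\<Theta> n) \<le> 2 * (F (Z n) - F (\<Theta> n)) + 6 * lam"
        using ev by (auto elim: eventually_mono)
    qed
    moreover have "F 0 = 0" by (simp add: F_def)
    moreover have "F t \<le> integral {0..t} q + lam / 2 * integral {0..T} (\<lambda>\<sigma>. (L \<sigma>)\<^sup>2) + 3 * lam"
    proof -
      have qi: "q integrable_on {0..t}" and Li: "(\<lambda>\<sigma>. (L \<sigma>)\<^sup>2) integrable_on {0..t}"
        using t by (auto intro!: HK(3)[OF q] HK(3)[OF L])
      have "F t = integral {0..t} q + (lam / 2 * integral {0..t} (\<lambda>\<sigma>. (L \<sigma>)\<^sup>2) + 3 / (2 * lam) * (\<kappa>\<^sup>2 * t + integral {0..t} g))"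
      proof -
        have "(f has_integral integral {0..t} q + (lam / 2 * integral {0..t} (\<lambda>\<sigma>. (L \<sigma>)\<^sup>2) + 3 / (2 * lam) * (\<kappa>\<^sup>2 * t + integral {0..t} g))) {0..t}"
          unfolding f_def
          using has_integral_const_real[of "\<kappa>\<^sup>2" 0 t] t
          by (intro has_integral_add has_integral_mult_right integrable_integral qi Li gt) (simp add: mult.commute)
        then show ?thesis unfolding F_def by (rule integral_unique)
      qed
      moreover have "integral {0..t} (\<lambda>\<sigma>. (L \<sigma>)\<^sup>2) \<le> integral {0..T} (\<lambda>\<sigma>. (L \<sigma>)\<^sup>2)"
        by (rule integral_subset_le[OF _ Li HK(1)[OF L]]) (use t in auto)
      then have "lam / 2 * integral {0..t} (\<lambda>\<sigma>. (L \<sigma>)\<^sup>2) \<le> lam / 2 * integral {0..T} (\<lambda>\<sigma>. (L \<sigma>)\<^sup>2)"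
        using lam by (intro mult_left_mono) auto
      moreover have "3 / (2 * lam) * (\<kappa>\<^sup>2 * t + integral {0..t} g) \<le> 3 / (2 * lam) * (2 * lam\<^sup>2)"
        using lam \<kappa>(2) gI by (intro mult_left_mono) auto
      moreover have "3 / (2 * lam) * (2 * lam\<^sup>2) = 3 * lam" using lam by (simp add: power2_eq_square)
      ultimately show ?thesis by linarith
    qed
    ultimately show ?thesis unfolding E_def by (simp add: algebra_simps)
  qed
qed

text \<open>Letting \<open>lam\<close> tend to 0 removes \<open>L\<close> completely: the price of
  changing the test function only has to be square integrable in time, however large it is.\<close>

lemma energy_inequality:
  fixes V v :: "real \<Rightarrow> 'a::euclidean_space \<Rightarrow> complex" and D :: "real \<Rightarrow> ('a \<Rightarrow> complex) \<Rightarrow> complex"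
  assumes V: "\<And>t. t \<in> {0..T} \<Longrightarrow> V t \<in> elts L2"
      "\<And>t. t \<in> {0..T} \<Longrightarrow> ((\<lambda>r. nrm L2 (\<lambda>x. V r x - V t x)) \<longlongrightarrow> 0) (at t within {0..T})"
    and v: "v \<in> elts (L2_time T H1)"
    and ae: "AE t in lebesgue_on {0<..<T}. v t \<in> elts H1 \<and> (AE x in lborel. V t x = v t x) \<and>
       (\<forall>\<phi>\<in>elts H1. Re (D t \<phi>) \<le> q t + L t * nrm H1 (\<lambda>x. \<phi> x - v t x))"
    and inc: "\<And>r t \<phi>. 0 < r \<Longrightarrow> r < t \<Longrightarrow> t < T \<Longrightarrow> \<phi> \<in> elts H1 \<Longrightarrow>
       L2_inner (V t) \<phi> - L2_inner (V r) \<phi> = integral {r..t} (\<lambda>\<sigma>. D \<sigma> \<phi>)"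
    and Di: "\<And>\<phi>. \<phi> \<in> elts H1 \<Longrightarrow> integrable (lebesgue_on {0<..<T}) (\<lambda>\<sigma>. D \<sigma> \<phi>)"
    and q: "integrable (lebesgue_on {0<..<T}) q"
    and L: "integrable (lebesgue_on {0<..<T}) (\<lambda>\<sigma>. (L \<sigma>)\<^sup>2)"
    and t: "0 < t" "t \<le> T"
  shows "(nrm L2 (V t))\<^sup>2 \<le> (nrm L2 (V 0))\<^sup>2 + 2 * integral {0..t} q"
proof -
  let ?I = "integral {0..T} (\<lambda>\<sigma>. (L \<sigma>)\<^sup>2) + 12"
  have "((\<lambda>lam. 2 * integral {0..t} q + lam * ?I) \<longlongrightarrow> 2 * integral {0..t} q + 0 * ?I) (at_right 0)"
    by (intro tendsto_intros)
  moreover have "\<forall>\<^sub>F lam in at_right 0. (nrm L2 (V t))\<^sup>2 - (nrm L2 (V 0))\<^sup>2 \<le> 2 * integral {0..t} q + lam * ?I"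
    unfolding eventually_at_filter
    using energy_inequality_approx[OF V v ae inc Di q L t] by (auto intro!: always_eventually)
  ultimately have "(nrm L2 (V t))\<^sup>2 - (nrm L2 (V 0))\<^sup>2 \<le> 2 * integral {0..t} q + 0 * ?I"
    by (intro tendsto_lowerbound[where F="at_right (0::real)"]) auto
  then show ?thesis by simp
qed

section \<open>The elliptic form\<close>

definition weighted_inner :: "('a::euclidean_space \<Rightarrow> real) \<Rightarrow> ('a \<Rightarrow> complex) \<Rightarrow> ('a \<Rightarrow> complex) \<Rightarrow> complex" where
  "weighted_inner \<alpha> f g = (LINT x|lborel. of_real (\<alpha> x) * f x * cnj (g x))"

definition bounded_coeff :: "real \<Rightarrow> ('a::euclidean_space \<Rightarrow> real) \<Rightarrow> bool" where
  "bounded_coeff M \<alpha> \<longleftrightarrow> 0 \<le> M \<and> \<alpha> \<in> borel_measurable borel \<and> (AE x in lborel. \<bar>\<alpha> x\<bar> \<le> M)"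

lemma weighted_L2:
  assumes \<alpha>: "bounded_coeff M \<alpha>" and f: "f \<in> elts L2"
  shows "(\<lambda>x. complex_of_real (\<alpha> x) * f x) \<in> elts L2" and "nrm L2 (\<lambda>x. complex_of_real (\<alpha> x) * f x) \<le> M * nrm L2 f"
proof -
  have [measurable]: "\<alpha> \<in> borel_measurable borel" "f \<in> borel_measurable borel"
    using \<alpha> L2_measurable[OF f] by (auto simp: bounded_coeff_def)
  have M: "0 \<le> M" and "AE x in lborel. \<bar>\<alpha> x\<bar> \<le> M" using \<alpha> by (auto simp: bounded_coeff_def)
  then have ae: "AE x in lborel. norm (complex_of_real (\<alpha> x) * f x) \<le> M * norm (f x)"
    by (auto elim!: eventually_mono simp: norm_mult intro: mult_right_mono)
  have m: "(\<lambda>x. complex_of_real (\<alpha> x) * f x) \<in> borel_measurable borel" by measurable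
  show "(\<lambda>x. complex_of_real (\<alpha> x) * f x) \<in> elts L2" "nrm L2 (\<lambda>x. complex_of_real (\<alpha> x) * f x) \<le> M * nrm L2 f"
    using L2_dominated[OF f m M ae] by auto
qed

lemma weighted_inner_integrable:
  assumes \<alpha>: "bounded_coeff M \<alpha>" and f: "f \<in> elts L2" and g: "g \<in> elts L2"
  shows "integrable lborel (\<lambda>x. complex_of_real (\<alpha> x) * f x * cnj (g x))"
  by (rule L2_mult_integrable(1)[OF weighted_L2(1)[OF \<alpha> f] L2_cnj(1)[OF g]])

lemma weighted_inner_bound:
  assumes \<alpha>: "bounded_coeff M \<alpha>" and f: "f \<in> elts L2" and g: "g \<in> elts L2"
  shows "cmod (weighted_inner \<alpha> f g) \<le> M * nrm L2 f * nrm L2 g"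
proof -
  have "cmod (weighted_inner \<alpha> f g) \<le> nrm L2 (\<lambda>x. complex_of_real (\<alpha> x) * f x) * nrm L2 (\<lambda>x. cnj (g x))"
    unfolding weighted_inner_def by (rule L2_mult_integrable(3)[OF weighted_L2(1)[OF \<alpha> f] L2_cnj(1)[OF g]])
  also have "\<dots> \<le> M * nrm L2 f * nrm L2 g"
    unfolding L2_cnj(2)[OF g] by (intro mult_right_mono weighted_L2(2)[OF \<alpha> f]) simp
  finally show ?thesis .
qed

lemma weighted_inner_diff_left:
  assumes \<alpha>: "bounded_coeff M \<alpha>" and f: "f \<in> elts L2" and g: "g \<in> elts L2" and h: "h \<in> elts L2" and k: "k \<in> elts L2"
    and eq: "AE x in lborel. k x = f x - g x"
  shows "weighted_inner \<alpha> k h = weighted_inner \<alpha> f h - weighted_inner \<alpha> g h"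
proof -
  have "weighted_inner \<alpha> k h = (LINT x|lborel. of_real (\<alpha> x) * f x * cnj (h x) - of_real (\<alpha> x) * g x * cnj (h x))"
    unfolding weighted_inner_def
  proof (rule integral_cong_AE)
    show "AE x in lborel. of_real (\<alpha> x) * k x * cnj (h x) = of_real (\<alpha> x) * f x * cnj (h x) - of_real (\<alpha> x) * g x * cnj (h x)"
      using eq by eventually_elim (simp only: right_diff_distrib left_diff_distrib complex_cnj_diff)
  qed (use weighted_inner_integrable[OF \<alpha> k h] weighted_inner_integrable[OF \<alpha> f h] weighted_inner_integrable[OF \<alpha> g h] in auto)
  also have "\<dots> = weighted_inner \<alpha> f h - weighted_inner \<alpha> g h"
    unfolding weighted_inner_def
    by (rule Bochner_Integration.integral_diff[OF weighted_inner_integrable[OF \<alpha> f h] weighted_inner_integrable[OF \<alpha> g h]])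
  finally show ?thesis .
qed

lemma weighted_inner_diff_right:
  assumes \<alpha>: "bounded_coeff M \<alpha>" and f: "f \<in> elts L2" and g: "g \<in> elts L2" and h: "h \<in> elts L2" and k: "k \<in> elts L2"
    and eq: "AE x in lborel. k x = f x - g x"
  shows "weighted_inner \<alpha> h k = weighted_inner \<alpha> h f - weighted_inner \<alpha> h g"
proof -
  have "weighted_inner \<alpha> h k = (LINT x|lborel. of_real (\<alpha> x) * h x * cnj (f x) - of_real (\<alpha> x) * h x * cnj (g x))"
    unfolding weighted_inner_def
  proof (rule integral_cong_AE)
    show "AE x in lborel. of_real (\<alpha> x) * h x * cnj (k x) = of_real (\<alpha> x) * h x * cnj (f x) - of_real (\<alpha> x) * h x * cnj (g x)"
      using eq by eventually_elim (simp only: right_diff_distrib left_diff_distrib complex_cnj_diff)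
  qed (use weighted_inner_integrable[OF \<alpha> h k] weighted_inner_integrable[OF \<alpha> h f] weighted_inner_integrable[OF \<alpha> h g] in auto)
  also have "\<dots> = weighted_inner \<alpha> h f - weighted_inner \<alpha> h g"
    unfolding weighted_inner_def
    by (rule Bochner_Integration.integral_diff[OF weighted_inner_integrable[OF \<alpha> h f] weighted_inner_integrable[OF \<alpha> h g]])
  finally show ?thesis .
qed

lemma weighted_inner_diff_coeff:
  assumes \<alpha>: "bounded_coeff M \<alpha>" and \<beta>: "bounded_coeff M' \<beta>" and f: "f \<in> elts L2" and g: "g \<in> elts L2"
  shows "weighted_inner (\<lambda>x. \<alpha> x - \<beta> x) f g = weighted_inner \<alpha> f g - weighted_inner \<beta> f g"
  unfolding weighted_inner_def of_real_diff left_diff_distrib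
  by (rule Bochner_Integration.integral_diff[OF weighted_inner_integrable[OF \<alpha> f g] weighted_inner_integrable[OF \<beta> f g]])

lemma weighted_inner_coercive:
  assumes \<alpha>: "bounded_coeff M \<alpha>" and f: "f \<in> elts L2" and ge: "AE x in lborel. a0 \<le> \<alpha> x"
  shows "a0 * (nrm L2 f)\<^sup>2 \<le> Re (weighted_inner \<alpha> f f)"
proof -
  have i: "integrable lborel (\<lambda>x. Re (complex_of_real (\<alpha> x) * f x * cnj (f x)))"
    by (intro integrable_Re weighted_inner_integrable[OF \<alpha> f f])
  have "a0 * (nrm L2 f)\<^sup>2 = (LINT x|lborel. a0 * (norm (f x))\<^sup>2)" by (simp add: nrm_L2_power2)
  also have "\<dots> \<le> (LINT x|lborel. Re (complex_of_real (\<alpha> x) * f x * cnj (f x)))"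
  proof (rule integral_mono_AE[OF _ i])
    show "integrable lborel (\<lambda>x. a0 * (norm (f x))\<^sup>2)" using f by (simp add: elts_L2)
    show "AE x in lborel. a0 * (norm (f x))\<^sup>2 \<le> Re (complex_of_real (\<alpha> x) * f x * cnj (f x))"
      using ge
    proof eventually_elim
      fix x assume "a0 \<le> \<alpha> x"
      then have "a0 * (norm (f x))\<^sup>2 \<le> \<alpha> x * (norm (f x))\<^sup>2" by (rule mult_right_mono) simp
      also have "\<dots> = Re (complex_of_real (\<alpha> x) * (f x * cnj (f x)))"
        by (simp add: complex_norm_square[symmetric] del: of_real_power)
      finally show "a0 * (norm (f x))\<^sup>2 \<le> Re (complex_of_real (\<alpha> x) * f x * cnj (f x))" by (simp only: mult.assoc)
    qed
  qed
  also have "\<dots> = Re (weighted_inner \<alpha> f f)"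
    unfolding weighted_inner_def by (rule integral_Re[OF weighted_inner_integrable[OF \<alpha> f f]])
  finally show ?thesis .
qed

definition energy_form :: "real \<Rightarrow> ('a::euclidean_space \<Rightarrow> real) \<Rightarrow> ('a \<Rightarrow> real) \<Rightarrow> ('a \<Rightarrow> real) \<Rightarrow> ('a \<Rightarrow> complex) \<Rightarrow> ('a \<Rightarrow> complex) \<Rightarrow> complex" where
  "energy_form s \<alpha> \<beta> \<gamma> f \<phi> = (\<Sum>i\<in>Basis. weighted_inner \<alpha> (weak_partial i f) (weak_partial i \<phi>))
     + weighted_inner \<beta> (frac_laplacian s f) (frac_laplacian s \<phi>) + weighted_inner \<gamma> f \<phi>"

text \<open>One set of assumptions for two uses: the coefficients themselves, with some possibly
  huge bound \<open>M\<close>, and differences of coefficients, with a small bound. Since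
  differences have no sign, lower bounds are left to the coercivity lemma.\<close>

locale form_coeffs =
  fixes s M :: real and \<alpha> \<beta> \<gamma> :: "'a::euclidean_space \<Rightarrow> real"
  assumes s: "0 < s" "s < 1"
    and bounded: "bounded_coeff M \<alpha>" "bounded_coeff M \<beta>" "bounded_coeff M \<gamma>"
begin

lemma energy_form_diff_left:
  assumes f: "f \<in> elts H1" and g: "g \<in> elts H1" and h: "h \<in> elts H1"
  shows "energy_form s \<alpha> \<beta> \<gamma> (\<lambda>x. f x - g x) h = energy_form s \<alpha> \<beta> \<gamma> f h - energy_form s \<alpha> \<beta> \<gamma> g h"
proof -
  note d = H1_diff(1)[OF f g]
  have 1: "weighted_inner \<alpha> (weak_partial i (\<lambda>x. f x - g x)) (weak_partial i h) =
      weighted_inner \<alpha> (weak_partial i f) (weak_partial i h) - weighted_inner \<alpha> (weak_partial i g) (weak_partial i h)"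
    if i: "i \<in> Basis" for i
    by (rule weighted_inner_diff_left[OF bounded(1) weak_partial_spec(1)[OF f i] weak_partial_spec(1)[OF g i]
          weak_partial_spec(1)[OF h i] weak_partial_spec(1)[OF d i] H1_diff(2)[OF f g i]])
  have 2: "weighted_inner \<beta> (frac_laplacian s (\<lambda>x. f x - g x)) (frac_laplacian s h) =
      weighted_inner \<beta> (frac_laplacian s f) (frac_laplacian s h) - weighted_inner \<beta> (frac_laplacian s g) (frac_laplacian s h)"
    by (rule weighted_inner_diff_left[OF bounded(2) frac_laplacian_H1(1)[OF f s] frac_laplacian_H1(1)[OF g s]
          frac_laplacian_H1(1)[OF h s] frac_laplacian_H1(1)[OF d s] frac_laplacian_H1(3)[OF f s g]])
  have 3: "weighted_inner \<gamma> (\<lambda>x. f x - g x) h = weighted_inner \<gamma> f h - weighted_inner \<gamma> g h"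
    by (rule weighted_inner_diff_left[OF bounded(3) H1_L2[OF f] H1_L2[OF g] H1_L2[OF h] H1_L2[OF d]]) simp
  show ?thesis
    unfolding energy_form_def 2 3 using 1 by (simp add: sum_subtractf)
qed

lemma energy_form_diff_right:
  assumes f: "f \<in> elts H1" and g: "g \<in> elts H1" and h: "h \<in> elts H1"
  shows "energy_form s \<alpha> \<beta> \<gamma> h (\<lambda>x. f x - g x) = energy_form s \<alpha> \<beta> \<gamma> h f - energy_form s \<alpha> \<beta> \<gamma> h g"
proof -
  note d = H1_diff(1)[OF f g]
  have 1: "weighted_inner \<alpha> (weak_partial i h) (weak_partial i (\<lambda>x. f x - g x)) =
      weighted_inner \<alpha> (weak_partial i h) (weak_partial i f) - weighted_inner \<alpha> (weak_partial i h) (weak_partial i g)"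
    if i: "i \<in> Basis" for i
    by (rule weighted_inner_diff_right[OF bounded(1) weak_partial_spec(1)[OF f i] weak_partial_spec(1)[OF g i]
          weak_partial_spec(1)[OF h i] weak_partial_spec(1)[OF d i] H1_diff(2)[OF f g i]])
  have 2: "weighted_inner \<beta> (frac_laplacian s h) (frac_laplacian s (\<lambda>x. f x - g x)) =
      weighted_inner \<beta> (frac_laplacian s h) (frac_laplacian s f) - weighted_inner \<beta> (frac_laplacian s h) (frac_laplacian s g)"
    by (rule weighted_inner_diff_right[OF bounded(2) frac_laplacian_H1(1)[OF f s] frac_laplacian_H1(1)[OF g s]
          frac_laplacian_H1(1)[OF h s] frac_laplacian_H1(1)[OF d s] frac_laplacian_H1(3)[OF f s g]])
  have 3: "weighted_inner \<gamma> h (\<lambda>x. f x - g x) = weighted_inner \<gamma> h f - weighted_inner \<gamma> h g"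
    by (rule weighted_inner_diff_right[OF bounded(3) H1_L2[OF f] H1_L2[OF g] H1_L2[OF h] H1_L2[OF d]]) simp
  show ?thesis
    unfolding energy_form_def 2 3 using 1 by (simp add: sum_subtractf)
qed

text \<open>DIM for the gradient terms, the square of the constant of
  \<open>frac_laplacian_H1\<close> for the fractional term, where both arguments are estimated, and
  1 for the term of order zero.\<close>

lemma energy_form_bound:
  assumes f: "f \<in> elts H1" and g: "g \<in> elts H1"
  shows "cmod (energy_form s \<alpha> \<beta> \<gamma> f g) \<le> M * (DIM('a) + ((1 + 2 * DIM('a)) * (2 * pi) ^ DIM('a))\<^sup>2 + 1) * nrm H1 f * nrm H1 g"
proof -
  define K where "K = real (1 + 2 * DIM('a)) * (2 * pi) ^ DIM('a)"
  have K: "0 \<le> K" by (simp add: K_def)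
  have M: "0 \<le> M" using bounded(1) by (simp add: bounded_coeff_def)
  have 1: "cmod (weighted_inner \<alpha> (weak_partial i f) (weak_partial i g)) \<le> M * nrm H1 f * nrm H1 g" if i: "i \<in> Basis" for i
    using M by (intro order_trans[OF weighted_inner_bound[OF bounded(1) weak_partial_spec(1)[OF f i] weak_partial_spec(1)[OF g i]]]
        mult_mono mult_left_mono mult_nonneg_nonneg nrm_weak_partial_le_H1 i) auto
  have 2: "cmod (weighted_inner \<beta> (frac_laplacian s f) (frac_laplacian s g)) \<le> M * (K * nrm H1 f) * (K * nrm H1 g)"
    using M K by (intro order_trans[OF weighted_inner_bound[OF bounded(2) frac_laplacian_H1(1)[OF f s] frac_laplacian_H1(1)[OF g s]]]
        mult_mono mult_left_mono mult_nonneg_nonneg frac_laplacian_H1(2)[OF f s, folded K_def] frac_laplacian_H1(2)[OF g s, folded K_def]) auto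
  have 3: "cmod (weighted_inner \<gamma> f g) \<le> M * nrm H1 f * nrm H1 g"
    using M by (intro order_trans[OF weighted_inner_bound[OF bounded(3) H1_L2[OF f] H1_L2[OF g]]]
        mult_mono mult_left_mono mult_nonneg_nonneg nrm_L2_le_H1) auto
  have "cmod (\<Sum>i\<in>Basis. weighted_inner \<alpha> (weak_partial i f) (weak_partial i g)) \<le> (\<Sum>i\<in>(Basis::'a set). M * nrm H1 f * nrm H1 g)"
    by (rule order_trans[OF norm_sum]) (intro sum_mono 1)
  then have "cmod (energy_form s \<alpha> \<beta> \<gamma> f g) \<le> DIM('a) * (M * nrm H1 f * nrm H1 g) + M * (K * nrm H1 f) * (K * nrm H1 g) + M * nrm H1 f * nrm H1 g"
    unfolding energy_form_def using 2 3 by (intro order_trans[OF norm_triangle_ineq] add_mono) auto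
  also have "\<dots> = M * (DIM('a) + K\<^sup>2 + 1) * nrm H1 f * nrm H1 g"
    by (simp add: algebra_simps power2_eq_square)
  finally show ?thesis unfolding K_def .
qed

text \<open>The gradient and the zero-order terms together already give the full H1 norm with weight
  \<open>m\<close>; the fractional term is nonnegative and enters the comparison with weight
  0.\<close>

lemma energy_form_coercive:
  assumes f: "f \<in> elts H1" and ge: "AE x in lborel. m \<le> \<alpha> x" "AE x in lborel. 0 \<le> \<beta> x" "AE x in lborel. m \<le> \<gamma> x"
  shows "m * (nrm H1 f)\<^sup>2 \<le> Re (energy_form s \<alpha> \<beta> \<gamma> f f)"
proof -
  have "m * (nrm H1 f)\<^sup>2 = (\<Sum>i\<in>Basis. m * (nrm L2 (weak_partial i f))\<^sup>2) + 0 * (nrm L2 (frac_laplacian s f))\<^sup>2 + m * (nrm L2 f)\<^sup>2"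
    by (simp add: nrm_H1_power2 distrib_left sum_distrib_left)
  also have "\<dots> \<le> (\<Sum>i\<in>Basis. Re (weighted_inner \<alpha> (weak_partial i f) (weak_partial i f)))
     + Re (weighted_inner \<beta> (frac_laplacian s f) (frac_laplacian s f)) + Re (weighted_inner \<gamma> f f)"
    by (intro add_mono sum_mono weighted_inner_coercive[OF bounded(1)] weighted_inner_coercive[OF bounded(2)]
        weighted_inner_coercive[OF bounded(3)] weak_partial_spec[OF f] frac_laplacian_H1(1)[OF f s] H1_L2[OF f] ge)
  also have "\<dots> = Re (energy_form s \<alpha> \<beta> \<gamma> f f)" by (simp add: energy_form_def)
  finally show ?thesis .
qed

end

lemma energy_form_diff_coeff:
  assumes A: "form_coeffs s M \<alpha> \<beta> \<gamma>" and B: "form_coeffs s M' \<alpha>' \<beta>' \<gamma>'" and f: "f \<in> elts H1" and g: "g \<in> elts H1"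
  shows "energy_form s (\<lambda>x. \<alpha> x - \<alpha>' x) (\<lambda>x. \<beta> x - \<beta>' x) (\<lambda>x. \<gamma> x - \<gamma>' x) f g =
     energy_form s \<alpha> \<beta> \<gamma> f g - energy_form s \<alpha>' \<beta>' \<gamma>' f g"
proof -
  interpret A: form_coeffs s M \<alpha> \<beta> \<gamma> by fact
  interpret B: form_coeffs s M' \<alpha>' \<beta>' \<gamma>' by fact
  have 1: "weighted_inner (\<lambda>x. \<alpha> x - \<alpha>' x) (weak_partial i f) (weak_partial i g) =
      weighted_inner \<alpha> (weak_partial i f) (weak_partial i g) - weighted_inner \<alpha>' (weak_partial i f) (weak_partial i g)"
    if i: "i \<in> Basis" for i
    by (rule weighted_inner_diff_coeff[OF A.bounded(1) B.bounded(1) weak_partial_spec(1)[OF f i] weak_partial_spec(1)[OF g i]])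
  note 2 = weighted_inner_diff_coeff[OF A.bounded(2) B.bounded(2) frac_laplacian_H1(1)[OF f A.s] frac_laplacian_H1(1)[OF g A.s]]
  note 3 = weighted_inner_diff_coeff[OF A.bounded(3) B.bounded(3) H1_L2[OF f] H1_L2[OF g]]
  show ?thesis unfolding energy_form_def 2 3 using 1 by (simp add: sum_subtractf)
qed

text \<open>Measurability is read off from the equation: with the second argument fixed the form is
  continuous on H1, so its composition with the strongly measurable \<open>v\<close> is measurable.
  Integrability follows since x <= 1 + x^2 and the interval is bounded.\<close>

lemma energy_form_time_integrable:
  assumes A: "form_coeffs s M \<alpha> \<beta> \<gamma>" and v: "v \<in> elts (L2_time T H1)" and \<phi>: "\<phi> \<in> elts H1"
    and w: "AE t in lebesgue_on {0<..<T}. w t \<phi> = - energy_form s \<alpha> \<beta> \<gamma> (v t) \<phi>"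
  shows "integrable (lebesgue_on {0<..<T}) (\<lambda>t. w t \<phi>)"
proof -
  interpret form_coeffs s M \<alpha> \<beta> \<gamma> by fact
  let ?M = "lebesgue_on {0<..<T}"
  interpret F: finite_measure ?M by (rule finite_measure_lebesgue_on_interval)
  have sm: "strongly_measurable ?M H1 v" and int: "integrable ?M (\<lambda>t. (nrm H1 (v t))\<^sup>2)"
    using v by (auto simp: elts_L2_time)
  define C where "C = M * (DIM('a) + ((1 + 2 * DIM('a)) * (2 * pi) ^ DIM('a))\<^sup>2 + 1) * nrm H1 \<phi>"
  have M: "0 \<le> M" using bounded(1) by (simp add: bounded_coeff_def)
  have C: "0 \<le> C" unfolding C_def using M by (intro mult_nonneg_nonneg add_nonneg_nonneg) auto
  have bd: "cmod (energy_form s \<alpha> \<beta> \<gamma> f \<phi>) \<le> C * nrm H1 f" if "f \<in> elts H1" for f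
    using energy_form_bound[OF that \<phi>] by (simp add: C_def mult_ac)
  have m: "(\<lambda>t. - energy_form s \<alpha> \<beta> \<gamma> (v t) \<phi>) \<in> borel_measurable ?M"
  proof (rule strongly_measurable_compose[OF _ sm, where G="\<lambda>f. - energy_form s \<alpha> \<beta> \<gamma> f \<phi>"])
    fix \<sigma> and f :: "'a \<Rightarrow> complex"
    assume \<sigma>: "\<And>n::nat. \<sigma> n \<in> elts H1" and f: "f \<in> elts H1" and lim: "(\<lambda>n. nrm H1 (\<sigma> n - f)) \<longlonglongrightarrow> 0"
    have "(\<lambda>n. energy_form s \<alpha> \<beta> \<gamma> (\<sigma> n) \<phi> - energy_form s \<alpha> \<beta> \<gamma> f \<phi>) \<longlonglongrightarrow> 0"
    proof (rule Lim_null_comparison)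
      show "(\<lambda>n. C * nrm H1 (\<sigma> n - f)) \<longlonglongrightarrow> 0" using tendsto_mult_right_zero[OF lim] .
      show "\<forall>\<^sub>F n in sequentially. norm (energy_form s \<alpha> \<beta> \<gamma> (\<sigma> n) \<phi> - energy_form s \<alpha> \<beta> \<gamma> f \<phi>) \<le> C * nrm H1 (\<sigma> n - f)"
        using bd[OF H1_diff(1)[OF \<sigma> f]] energy_form_diff_left[OF \<sigma> f \<phi>]
        by (auto simp: fun_diff_def intro!: always_eventually)
    qed
    then have "(\<lambda>n. energy_form s \<alpha> \<beta> \<gamma> (\<sigma> n) \<phi>) \<longlonglongrightarrow> energy_form s \<alpha> \<beta> \<gamma> f \<phi>" by (simp add: LIM_zero_iff)
    then show "(\<lambda>n. - energy_form s \<alpha> \<beta> \<gamma> (\<sigma> n) \<phi>) \<longlonglongrightarrow> - energy_form s \<alpha> \<beta> \<gamma> f \<phi>" by (rule tendsto_minus)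
  qed simp
  have wm: "(\<lambda>t. w t \<phi>) \<in> borel_measurable ?M"
    by (rule borel_measurable_lebesgue_on_AE[OF _ m]) (use w in \<open>auto elim: eventually_mono\<close>)
  have "integrable ?M (\<lambda>t. C * (1 + (nrm H1 (v t))\<^sup>2))" using int by auto
  then show ?thesis
  proof (rule Bochner_Integration.integrable_bound[OF _ wm])
    show "AE t in ?M. norm (w t \<phi>) \<le> norm (C * (1 + (nrm H1 (v t))\<^sup>2))"
      using w strongly_measurable_elts[OF sm]
    proof eventually_elim
      fix t assume "w t \<phi> = - energy_form s \<alpha> \<beta> \<gamma> (v t) \<phi>" "v t \<in> elts H1"
      then have "norm (w t \<phi>) \<le> C * nrm H1 (v t)" using bd by simp
      also have "\<dots> \<le> C * (1 + (nrm H1 (v t))\<^sup>2)"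
      proof (rule mult_left_mono[OF _ C])
        have "2 * nrm H1 (v t) \<le> 1 + (nrm H1 (v t))\<^sup>2" using sum_squares_bound[of 1 "nrm H1 (v t)"] by simp
        then show "nrm H1 (v t) \<le> 1 + (nrm H1 (v t))\<^sup>2" using nrm_H1_nonneg[of "v t"] by linarith
      qed
      also have "\<dots> \<le> norm (C * (1 + (nrm H1 (v t))\<^sup>2))" by simp
      finally show "norm (w t \<phi>) \<le> norm (C * (1 + (nrm H1 (v t))\<^sup>2))" .
    qed
  qed
qed

lemma weak_solution_form:
  "weak_solution T s \<alpha> \<beta> \<gamma> v0 v \<longleftrightarrow> v \<in> elts (L2_time T H1) \<and> has_initial_value T v v0 \<and>
     (\<exists>w. w \<in> elts (L2_time T (antidual H1)) \<and> has_weak_time_derivative T v w \<and>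
        (AE t in lebesgue_on {0<..<T}. \<forall>\<phi>\<in>elts H1. w t \<phi> = - energy_form s \<alpha> \<beta> \<gamma> (v t) \<phi>))"
proof -
  have "x + a + b + c = 0 \<longleftrightarrow> x = - (a + b + c)" for x a b c :: complex
    using eq_neg_iff_add_eq_0[of x "a + b + c"] by (simp add: add.assoc)
  then show ?thesis
    unfolding weak_solution_def energy_form_def weighted_inner_def by simp
qed

section \<open>Stability of weak solutions\<close>

lemma has_initial_valueE:
  assumes "has_initial_value T v v0"
  obtains V where "\<And>t. t \<in> {0..T} \<Longrightarrow> V t \<in> elts L2"
    "\<And>t. t \<in> {0..T} \<Longrightarrow> ((\<lambda>r. nrm L2 (\<lambda>x. V r x - V t x)) \<longlongrightarrow> 0) (at t within {0..T})"
    "AE t in lebesgue_on {0<..<T}. AE x in lborel. V t x = v t x"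
    "AE x in lborel. V 0 x = v0 x"
proof -
  from assms obtain V where "(\<forall>t\<in>{0..T}. V t \<in> elts L2 \<and> ((\<lambda>r. nrm L2 (V r - V t)) \<longlongrightarrow> 0) (at t within {0..T})) \<and>
          (AE t in lebesgue_on {0<..<T}. AE x in lborel. V t x = v t x) \<and> (AE x in lborel. V 0 x = v0 x)"
    unfolding has_initial_value_def by (elim exE)
  then show ?thesis by (intro that[of V]) (auto simp: fun_diff_def)
qed

lemma form_coeffs_diff:
  assumes A: "form_coeffs s M a b c" and B: "form_coeffs s M' a' b' c'" and \<delta>: "0 \<le> \<delta>"
    and le: "AE x in lborel. \<bar>a x - a' x\<bar> \<le> \<delta>" "AE x in lborel. \<bar>b x - b' x\<bar> \<le> \<delta>" "AE x in lborel. \<bar>c x - c' x\<bar> \<le> \<delta>"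
  shows "form_coeffs s \<delta> (\<lambda>x. a x - a' x) (\<lambda>x. b x - b' x) (\<lambda>x. c x - c' x)"
  using assms unfolding form_coeffs_def bounded_coeff_def by auto

text \<open>Completing the square absorbs the mixed term into one half of the coercive term. It is
  applied with \<open>x\<close> the H1 norm of the difference and \<open>y\<close> that of the
  second solution.\<close>

lemma weighted_young:
  fixes m d x y :: real
  assumes "0 < m"
  shows "- m * x\<^sup>2 + d * y * x \<le> - (m / 2) * x\<^sup>2 + d\<^sup>2 / (2 * m) * y\<^sup>2"
proof -
  have "0 \<le> (m * x - d * y)\<^sup>2 / (2 * m)" using assms by simp
  also have "\<dots> = m / 2 * x\<^sup>2 + d\<^sup>2 / (2 * m) * y\<^sup>2 - d * y * x"
    using assms by (simp add: field_simps power2_eq_square)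
  finally show ?thesis by (simp add: algebra_simps)
qed

text \<open>\<open>Q\<close> is the constant of \<open>energy_form_bound\<close>. \<open>R\<close>
  involves the difference of the data, the bound \<open>\<delta>\<close> for the coefficient
  differences, the lower bound \<open>m\<close> and the second solution, but not \<open>M\<close>.
  Both conclusions come from one inequality by dropping either of two nonnegative terms, the second
  at the final time.\<close>

lemma energy_estimate:
  fixes u u' :: "real \<Rightarrow> 'a::euclidean_space \<Rightarrow> complex"
  assumes T: "0 < T" and m: "0 < m"
    and A: "form_coeffs s M a b c" and A': "form_coeffs s M a' b' c'" and \<delta>: "form_coeffs s \<delta> (\<lambda>x. a x - a' x) (\<lambda>x. b x - b' x) (\<lambda>x. c x - c' x)"
    and ge: "AE x in lborel. m \<le> a x" "AE x in lborel. 0 \<le> b x" "AE x in lborel. m \<le> c x"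
    and u: "weak_solution T s a b c u0 u" and u': "weak_solution T s a' b' c' u0' u'"
    and u0: "u0 \<in> elts L2" "u0' \<in> elts L2"
  defines "Q \<equiv> DIM('a) + ((1 + 2 * DIM('a)) * (2 * pi) ^ DIM('a))\<^sup>2 + 1"
  defines "R \<equiv> (nrm L2 (\<lambda>x. u0 x - u0' x))\<^sup>2 + (\<delta> * Q)\<^sup>2 / m * (LINT t|lebesgue_on {0<..<T}. (nrm H1 (u' t))\<^sup>2)"
  shows "AE t in lebesgue_on {0<..<T}. (nrm L2 (\<lambda>x. u t x - u' t x))\<^sup>2 \<le> R"
    and "m * (LINT t|lebesgue_on {0<..<T}. (nrm H1 (\<lambda>x. u t x - u' t x))\<^sup>2) \<le> R"
proof -
  let ?M = "lebesgue_on {0<..<T}"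
  interpret A: form_coeffs s M a b c by fact
  interpret A': form_coeffs s M a' b' c' by fact
  interpret D: form_coeffs s \<delta> "\<lambda>x. a x - a' x" "\<lambda>x. b x - b' x" "\<lambda>x. c x - c' x" by fact
  obtain w where uH: "u \<in> elts (L2_time T H1)" and ui: "has_initial_value T u u0"
    and w: "has_weak_time_derivative T u w" "AE t in ?M. \<forall>\<phi>\<in>elts H1. w t \<phi> = - energy_form s a b c (u t) \<phi>"
    using u unfolding weak_solution_form by blast
  obtain w' where uH': "u' \<in> elts (L2_time T H1)" and ui': "has_initial_value T u' u0'"
    and w': "has_weak_time_derivative T u' w'" "AE t in ?M. \<forall>\<phi>\<in>elts H1. w' t \<phi> = - energy_form s a' b' c' (u' t) \<phi>"
    using u' unfolding weak_solution_form by blast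
  obtain U where U: "\<And>t. t \<in> {0..T} \<Longrightarrow> U t \<in> elts L2"
    "\<And>t. t \<in> {0..T} \<Longrightarrow> ((\<lambda>r. nrm L2 (\<lambda>x. U r x - U t x)) \<longlongrightarrow> 0) (at t within {0..T})"
    "AE t in ?M. AE x in lborel. U t x = u t x" "AE x in lborel. U 0 x = u0 x"
    using has_initial_valueE[OF ui] by blast
  obtain U' where U': "\<And>t. t \<in> {0..T} \<Longrightarrow> U' t \<in> elts L2"
    "\<And>t. t \<in> {0..T} \<Longrightarrow> ((\<lambda>r. nrm L2 (\<lambda>x. U' r x - U' t x)) \<longlongrightarrow> 0) (at t within {0..T})"
    "AE t in ?M. AE x in lborel. U' t x = u' t x" "AE x in lborel. U' 0 x = u0' x"
    using has_initial_valueE[OF ui'] by blast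
  define V where "V t x = U t x - U' t x" for t x
  define v where "v t x = u t x - u' t x" for t x
  define D where "D t \<phi> = w t \<phi> - w' t \<phi>" for t \<phi>
  have vH: "v \<in> elts (L2_time T H1)" unfolding v_def[abs_def] by (rule L2_time_H1_diff[OF uH uH'])
  have VL: "V t \<in> elts L2" if "t \<in> {0..T}" for t unfolding V_def[abs_def] by (intro L2_diff U U' that)
  have Vc: "((\<lambda>r. nrm L2 (\<lambda>x. V r x - V t x)) \<longlongrightarrow> 0) (at t within {0..T})" if t: "t \<in> {0..T}" for t
  proof (rule Lim_null_comparison)
    show "((\<lambda>r. nrm L2 (\<lambda>x. U r x - U t x) + nrm L2 (\<lambda>x. U' r x - U' t x)) \<longlongrightarrow> 0) (at t within {0..T})"
      using tendsto_add[OF U(2)[OF t] U'(2)[OF t]] by simp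
    have "norm (nrm L2 (\<lambda>x. V r x - V t x)) \<le> nrm L2 (\<lambda>x. U r x - U t x) + nrm L2 (\<lambda>x. U' r x - U' t x)" if r: "r \<in> {0..T}" for r
    proof -
      have "(\<lambda>x. V r x - V t x) = (\<lambda>x. (U r x - U t x) - (U' r x - U' t x))" by (simp add: V_def algebra_simps)
      then show ?thesis
        using L2_diff(2)[OF L2_diff(1)[OF U(1)[OF r] U(1)[OF t]] L2_diff(1)[OF U'(1)[OF r] U'(1)[OF t]]] by simp
    qed
    then show "\<forall>\<^sub>F r in at t within {0..T}. norm (nrm L2 (\<lambda>x. V r x - V t x)) \<le> nrm L2 (\<lambda>x. U r x - U t x) + nrm L2 (\<lambda>x. U' r x - U' t x)"
      unfolding eventually_at_filter by (intro always_eventually) blast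
  qed
  have aeu: "AE t in ?M. u t \<in> elts H1" "AE t in ?M. u' t \<in> elts H1"
    using uH uH' by (auto simp: elts_L2_time intro: strongly_measurable_elts)
  have wi: "integrable ?M (\<lambda>t. w t \<phi>)" if \<phi>: "\<phi> \<in> elts H1" for \<phi>
    by (rule energy_form_time_integrable[OF A uH \<phi>]) (use w(2) \<phi> in \<open>auto elim: eventually_mono\<close>)
  have wi': "integrable ?M (\<lambda>t. w' t \<phi>)" if \<phi>: "\<phi> \<in> elts H1" for \<phi>
    by (rule energy_form_time_integrable[OF A' uH' \<phi>]) (use w'(2) \<phi> in \<open>auto elim: eventually_mono\<close>)
  have Di: "integrable ?M (\<lambda>\<sigma>. D \<sigma> \<phi>)" if \<phi>: "\<phi> \<in> elts H1" for \<phi>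
    unfolding D_def by (intro Bochner_Integration.integrable_diff wi wi' \<phi>)
  have inc: "L2_inner (V t) \<phi> - L2_inner (V r) \<phi> = integral {r..t} (\<lambda>\<sigma>. D \<sigma> \<phi>)"
    if rt: "0 < r" "r < t" "t < T" and \<phi>: "\<phi> \<in> elts H1" for r t \<phi>
  proof -
    have inT: "r \<in> {0..T}" "t \<in> {0..T}" using rt by auto
    have \<phi>2: "\<phi> \<in> elts L2" by (rule H1_L2[OF \<phi>])
    have ae: "AE t in ?M. u t \<in> elts L2 \<and> (AE x in lborel. U t x = u t x)"
      using aeu(1) U(3) by eventually_elim (simp add: H1_L2)
    have ae': "AE t in ?M. u' t \<in> elts L2 \<and> (AE x in lborel. U' t x = u' t x)"
      using aeu(2) U'(3) by eventually_elim (simp add: H1_L2)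
    have 1: "L2_inner (U t) \<phi> - L2_inner (U r) \<phi> = integral {r..t} (\<lambda>\<sigma>. w \<sigma> \<phi>)"
      by (rule weak_time_derivative_increment[OF U(1,2) ae w(1) \<phi> wi[OF \<phi>] rt])
    have 2: "L2_inner (U' t) \<phi> - L2_inner (U' r) \<phi> = integral {r..t} (\<lambda>\<sigma>. w' \<sigma> \<phi>)"
      by (rule weak_time_derivative_increment[OF U'(1,2) ae' w'(1) \<phi> wi'[OF \<phi>] rt])
    have 3: "L2_inner (V t) \<phi> = L2_inner (U t) \<phi> - L2_inner (U' t) \<phi>" "L2_inner (V r) \<phi> = L2_inner (U r) \<phi> - L2_inner (U' r) \<phi>"
      unfolding V_def[abs_def] by (intro L2_inner_diff U U' inT \<phi>2)+
    have 4: "integral {r..t} (\<lambda>\<sigma>. D \<sigma> \<phi>) = integral {r..t} (\<lambda>\<sigma>. w \<sigma> \<phi>) - integral {r..t} (\<lambda>\<sigma>. w' \<sigma> \<phi>)"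
      unfolding D_def using rt
      by (intro Henstock_Kurzweil_Integration.integral_diff lebesgue_on_interval_integral(3)[OF wi[OF \<phi>]] lebesgue_on_interval_integral(3)[OF wi'[OF \<phi>]]) auto
    show ?thesis unfolding 3 4 1[symmetric] 2[symmetric] by simp
  qed
  have Q: "0 \<le> Q" by (simp add: Q_def)
  have M: "0 \<le> M" using A.bounded(1) by (simp add: bounded_coeff_def)
  have \<delta>0: "0 \<le> \<delta>" using D.bounded(1) by (simp add: bounded_coeff_def)
  \<comment> \<open>A test element is written as \<open>v\<close> plus a remainder. The terms tested
    with \<open>v\<close> give \<open>q\<close> after absorption by coercivity, those tested with
    the remainder give \<open>L\<close>. The bound \<open>M\<close> occurs in \<open>L\<close> alone
    and hence leaves no trace in the result. Doubling \<open>q\<close> in the energy inequality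
    turns the weights m/2 and 1/(2m) into m and 1/m.\<close>
  define q where "q t = - (m / 2) * (nrm H1 (v t))\<^sup>2 + (\<delta> * Q)\<^sup>2 / (2 * m) * (nrm H1 (u' t))\<^sup>2" for t
  define L where "L t = M * Q * nrm H1 (v t) + \<delta> * Q * nrm H1 (u' t)" for t
  have vi: "integrable ?M (\<lambda>t. (nrm H1 (v t))\<^sup>2)" and ui2: "integrable ?M (\<lambda>t. (nrm H1 (u' t))\<^sup>2)"
    using vH uH' by (auto simp: elts_L2_time)
  have qi: "integrable ?M q" unfolding q_def using vi ui2 by auto
  have Li: "integrable ?M (\<lambda>t. (L t)\<^sup>2)"
  proof (rule Bochner_Integration.integrable_bound)
    show "integrable ?M (\<lambda>t. 2 * (M * Q)\<^sup>2 * (nrm H1 (v t))\<^sup>2 + 2 * (\<delta> * Q)\<^sup>2 * (nrm H1 (u' t))\<^sup>2)"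
      using vi ui2 by auto
    have "(\<lambda>t. nrm H1 (v t)) \<in> borel_measurable ?M" "(\<lambda>t. nrm H1 (u' t)) \<in> borel_measurable ?M"
      using vH uH' by (auto simp: elts_L2_time intro!: strongly_measurable_nrm_H1)
    then show "(\<lambda>t. (L t)\<^sup>2) \<in> borel_measurable ?M" unfolding L_def by measurable
    show "AE t in ?M. norm ((L t)\<^sup>2) \<le> norm (2 * (M * Q)\<^sup>2 * (nrm H1 (v t))\<^sup>2 + 2 * (\<delta> * Q)\<^sup>2 * (nrm H1 (u' t))\<^sup>2)"
    proof (rule AE_I2)
      fix t
      have "(L t)\<^sup>2 \<le> 2 * (M * Q * nrm H1 (v t))\<^sup>2 + 2 * (\<delta> * Q * nrm H1 (u' t))\<^sup>2"
        unfolding L_def power2_sum using sum_squares_bound[of "M * Q * nrm H1 (v t)" "\<delta> * Q * nrm H1 (u' t)"] by linarith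
      then show "norm ((L t)\<^sup>2) \<le> norm (2 * (M * Q)\<^sup>2 * (nrm H1 (v t))\<^sup>2 + 2 * (\<delta> * Q)\<^sup>2 * (nrm H1 (u' t))\<^sup>2)"
        by (simp add: power_mult_distrib)
    qed
  qed
  have bound: "AE t in ?M. v t \<in> elts H1 \<and> (AE x in lborel. V t x = v t x) \<and>
       (\<forall>\<phi>\<in>elts H1. Re (D t \<phi>) \<le> q t + L t * nrm H1 (\<lambda>x. \<phi> x - v t x))"
    using aeu w(2) w'(2) U(3) U'(3)
  proof eventually_elim
    fix t assume ut: "u t \<in> elts H1" and ut': "u' t \<in> elts H1"
      and wt: "\<forall>\<phi>\<in>elts H1. w t \<phi> = - energy_form s a b c (u t) \<phi>"
      and wt': "\<forall>\<phi>\<in>elts H1. w' t \<phi> = - energy_form s a' b' c' (u' t) \<phi>"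
      and Ut: "AE x in lborel. U t x = u t x" and Ut': "AE x in lborel. U' t x = u' t x"
    have vt: "v t \<in> elts H1" unfolding v_def[abs_def] by (rule H1_diff(1)[OF ut ut'])
    have Vt: "AE x in lborel. V t x = v t x" using Ut Ut' by eventually_elim (simp add: V_def v_def)
    have "Re (D t \<phi>) \<le> q t + L t * nrm H1 (\<lambda>x. \<phi> x - v t x)" if \<phi>: "\<phi> \<in> elts H1" for \<phi>
    proof -
      let ?E = "energy_form s a b c" and ?E' = "energy_form s a' b' c'"
      let ?F = "energy_form s (\<lambda>x. a x - a' x) (\<lambda>x. b x - b' x) (\<lambda>x. c x - c' x)"
      let ?p = "\<lambda>x. \<phi> x - v t x" and ?x = "nrm H1 (v t)" and ?y = "nrm H1 (u' t)"
      have p: "?p \<in> elts H1" by (rule H1_diff(1)[OF \<phi> vt])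
      have 1: "?E (v t) \<phi> = ?E (u t) \<phi> - ?E (u' t) \<phi>"
        unfolding v_def[abs_def] by (rule A.energy_form_diff_left[OF ut ut' \<phi>])
      have 2: "?F (u' t) \<phi> = ?E (u' t) \<phi> - ?E' (u' t) \<phi>"
        by (rule energy_form_diff_coeff[OF A A' ut' \<phi>])
      have 3: "?E (v t) ?p = ?E (v t) \<phi> - ?E (v t) (v t)" by (rule A.energy_form_diff_right[OF \<phi> vt vt])
      have 4: "?F (u' t) ?p = ?F (u' t) \<phi> - ?F (u' t) (v t)" by (rule D.energy_form_diff_right[OF \<phi> vt ut'])
      have "D t \<phi> = - ?E (v t) (v t) - ?E (v t) ?p - ?F (u' t) (v t) - ?F (u' t) ?p"
        using wt wt' \<phi> by (simp add: D_def 1 2 3 4)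
      then have "Re (D t \<phi>) = - Re (?E (v t) (v t)) - Re (?E (v t) ?p) - Re (?F (u' t) (v t)) - Re (?F (u' t) ?p)"
        by simp
      moreover have "m * ?x\<^sup>2 \<le> Re (?E (v t) (v t))" by (rule A.energy_form_coercive[OF vt ge])
      moreover have "- Re (?E (v t) ?p) \<le> M * Q * ?x * nrm H1 ?p"
        using A.energy_form_bound[OF vt p, folded Q_def] abs_Re_le_cmod[of "?E (v t) ?p"] by linarith
      moreover have "- Re (?F (u' t) (v t)) \<le> \<delta> * Q * ?y * ?x"
        using D.energy_form_bound[OF ut' vt, folded Q_def] abs_Re_le_cmod[of "?F (u' t) (v t)"] by linarith
      moreover have "- Re (?F (u' t) ?p) \<le> \<delta> * Q * ?y * nrm H1 ?p"
        using D.energy_form_bound[OF ut' p, folded Q_def] abs_Re_le_cmod[of "?F (u' t) ?p"] by linarith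
      moreover have "- m * ?x\<^sup>2 + \<delta> * Q * ?y * ?x \<le> q t"
        unfolding q_def by (rule weighted_young[OF m])
      moreover have "L t * nrm H1 ?p = M * Q * ?x * nrm H1 ?p + \<delta> * Q * ?y * nrm H1 ?p"
        by (simp add: L_def distrib_right)
      ultimately show ?thesis by linarith
    qed
    then show "v t \<in> elts H1 \<and> (AE x in lborel. V t x = v t x) \<and>
       (\<forall>\<phi>\<in>elts H1. Re (D t \<phi>) \<le> q t + L t * nrm H1 (\<lambda>x. \<phi> x - v t x))" using vt Vt by blast
  qed
  have V0: "nrm L2 (V 0) = nrm L2 (\<lambda>x. u0 x - u0' x)"
  proof (rule nrm_L2_cong_AE)
    show "V 0 \<in> borel_measurable borel" using VL[of 0] T by (intro L2_measurable) auto
    show "(\<lambda>x. u0 x - u0' x) \<in> borel_measurable borel" by (intro L2_measurable L2_diff u0)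
    show "AE x in lborel. V 0 x = u0 x - u0' x" using U(4) U'(4) by eventually_elim (simp add: V_def)
  qed
  note HK = lebesgue_on_interval_integral
  have main: "(nrm L2 (V t))\<^sup>2 + m * integral {0..t} (\<lambda>t. (nrm H1 (v t))\<^sup>2) \<le> R" if t: "0 < t" "t \<le> T" for t
  proof -
    have a: "(\<lambda>t. (nrm H1 (v t))\<^sup>2) integrable_on {0..t}" "(\<lambda>t. (nrm H1 (u' t))\<^sup>2) integrable_on {0..t}"
      using t by (auto intro!: HK(3)[OF vi] HK(3)[OF ui2])
    have "(q has_integral - (m / 2) * integral {0..t} (\<lambda>t. (nrm H1 (v t))\<^sup>2) + (\<delta> * Q)\<^sup>2 / (2 * m) * integral {0..t} (\<lambda>t. (nrm H1 (u' t))\<^sup>2)) {0..t}"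
      unfolding q_def by (intro has_integral_add has_integral_mult_right integrable_integral a)
    then have q: "2 * integral {0..t} q = - m * integral {0..t} (\<lambda>t. (nrm H1 (v t))\<^sup>2) + (\<delta> * Q)\<^sup>2 / m * integral {0..t} (\<lambda>t. (nrm H1 (u' t))\<^sup>2)"
      by (simp add: integral_unique)
    have "integral {0..t} (\<lambda>t. (nrm H1 (u' t))\<^sup>2) \<le> integral {0..T} (\<lambda>t. (nrm H1 (u' t))\<^sup>2)"
      by (rule integral_subset_le[OF _ a(2) HK(1)[OF ui2]]) (use t in auto)
    then have "(\<delta> * Q)\<^sup>2 / m * integral {0..t} (\<lambda>t. (nrm H1 (u' t))\<^sup>2) \<le> (\<delta> * Q)\<^sup>2 / m * (LINT t|?M. (nrm H1 (u' t))\<^sup>2)"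
      unfolding HK(2)[OF ui2] using m by (intro mult_left_mono) auto
    with energy_inequality[OF VL Vc vH bound inc Di qi Li t] q show ?thesis
      unfolding R_def V0 by linarith
  qed
  have nn: "0 \<le> integral {0..t} (\<lambda>t. (nrm H1 (v t))\<^sup>2)" if "t \<le> T" for t
    by (rule Henstock_Kurzweil_Integration.integral_nonneg[OF HK(3)[OF vi _ that]]) auto
  show "m * (LINT t|?M. (nrm H1 (\<lambda>x. u t x - u' t x))\<^sup>2) \<le> R"
    using main[OF T order_refl] zero_le_power2[of "nrm L2 (V T)"]
    unfolding HK(2)[OF vi, unfolded v_def] v_def by linarith
  show "AE t in ?M. (nrm L2 (\<lambda>x. u t x - u' t x))\<^sup>2 \<le> R"
    using bound AE_space[of ?M]
  proof eventually_elim
    fix t assume b: "v t \<in> elts H1 \<and> (AE x in lborel. V t x = v t x) \<and>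
       (\<forall>\<phi>\<in>elts H1. Re (D t \<phi>) \<le> q t + L t * nrm H1 (\<lambda>x. \<phi> x - v t x))" and "t \<in> space ?M"
    then have t: "0 < t" "t \<le> T" by auto
    have "nrm L2 (v t) = nrm L2 (V t)"
      using b L2_measurable[OF VL[of t]] L2_measurable[OF H1_L2[of "v t"]] t
      by (intro nrm_L2_cong_AE) (auto elim: eventually_mono)
    then have "(nrm L2 (v t))\<^sup>2 \<le> R" using main[OF t] mult_nonneg_nonneg[OF less_imp_le[OF m] nn[OF t(2)]] by simp
    then show "(nrm L2 (\<lambda>x. u t x - u' t x))\<^sup>2 \<le> R" by (simp add: v_def[abs_def])
  qed
qed

text \<open>\<open>real_of_ereal\<close> sends infinite values to 0, so the essential supremum has
  to be shown different from infinity before the norm can be used as a bound.\<close>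

lemma Linf_AE_bound:
  assumes "f \<in> elts Linf"
  shows "AE x in lborel. norm (f x) \<le> nrm Linf f"
proof -
  have f[measurable]: "f \<in> borel_measurable borel" using assms by (simp add: Linf_def)
  obtain C where C: "AE x in lborel. norm (f x) \<le> C" using assms by (auto simp: Linf_def)
  let ?e = "esssup lborel (\<lambda>x. ereal (norm (f x)))"
  have "?e \<le> ereal C" by (rule esssup_I) (use C in auto)
  then have "?e \<noteq> \<infinity>" by auto
  have "AE x in lborel. ereal (norm (f x)) \<le> ?e" by (rule esssup_AE)
  then show ?thesis
    unfolding Linf_def nspace.simps
    by eventually_elim (use \<open>?e \<noteq> \<infinity>\<close> in \<open>cases ?e; auto\<close>)
qed

lemma Linf_time_AE_bound:
  assumes "v \<in> elts (Linf_time T X)"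
    and "(\<lambda>t. nrm X (v t)) \<in> borel_measurable (lebesgue_on {0<..<T})"
  shows "AE t in lebesgue_on {0<..<T}. nrm X (v t) \<le> nrm (Linf_time T X) v"
proof -
  let ?M = "lebesgue_on {0<..<T}"
  obtain C where C: "AE t in ?M. nrm X (v t) \<le> C" using assms by (auto simp: Linf_time_def)
  let ?e = "esssup ?M (\<lambda>t. ereal (nrm X (v t)))"
  have "?e \<le> ereal C" by (rule esssup_I) (use C assms(2) in auto)
  then have "?e \<noteq> \<infinity>" by auto
  have "AE t in ?M. ereal (nrm X (v t)) \<le> ?e" by (rule esssup_AE)
  then show ?thesis
    unfolding Linf_time_def nspace.simps
    by eventually_elim (use \<open>?e \<noteq> \<infinity>\<close> in \<open>cases ?e; auto\<close>)
qed

text \<open>Nonnegativity of \<open>C\<close> covers an essential supremum of minus infinity, which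
  \<open>real_of_ereal\<close> reads as 0.\<close>

lemma nrm_Linf_time_le:
  assumes m: "(\<lambda>t. nrm X (v t)) \<in> borel_measurable (lebesgue_on {0<..<T})"
    and le: "AE t in lebesgue_on {0<..<T}. nrm X (v t) \<le> C" and C: "0 \<le> C"
  shows "nrm (Linf_time T X) v \<le> C"
proof -
  let ?e = "esssup (lebesgue_on {0<..<T}) (\<lambda>t. ereal (nrm X (v t)))"
  have "?e \<le> ereal C" by (rule esssup_I) (use m le in auto)
  then have "real_of_ereal ?e \<le> C" using C by (cases ?e) auto
  then show ?thesis by (simp add: Linf_time_def)
qed

lemma strongly_measurable_nrm_L2:
  fixes v :: "real \<Rightarrow> 'a::euclidean_space \<Rightarrow> complex"
  assumes S: "S \<in> sets lebesgue" and v: "strongly_measurable (lebesgue_on S) L2 v"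
  shows "(\<lambda>t. nrm L2 (v t)) \<in> borel_measurable (lebesgue_on S)"
proof (rule strongly_measurable_compose[OF S v, where G="nrm L2"])
  fix \<sigma> and f :: "'a \<Rightarrow> complex"
  assume \<sigma>: "\<And>n::nat. \<sigma> n \<in> elts L2" and f: "f \<in> elts L2" and lim: "(\<lambda>n. nrm L2 (\<sigma> n - f)) \<longlonglongrightarrow> 0"
  have "norm (nrm L2 (\<sigma> n) - nrm L2 f) \<le> nrm L2 (\<sigma> n - f)" for n
    using L2_triangle[OF \<sigma> f L2_zero(1), of n] L2_triangle[OF f \<sigma> L2_zero(1), of n]
      nrm_L2_diff_commute[of f "\<sigma> n"] by (simp add: fun_diff_def)
  then have "(\<lambda>n. nrm L2 (\<sigma> n) - nrm L2 f) \<longlonglongrightarrow> 0"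
    by (rule Lim_null_comparison[OF always_eventually[OF allI] lim])
  then show "(\<lambda>n. nrm L2 (\<sigma> n)) \<longlonglongrightarrow> nrm L2 f" by (simp add: LIM_zero_iff)
qed

lemma Linf_bounded:
  assumes "f \<in> elts Linf"
  shows "f \<in> borel_measurable borel" "\<exists>M\<ge>0. AE x in lborel. \<bar>f x\<bar> \<le> (M::real)"
proof -
  show "f \<in> borel_measurable borel" using assms by (simp add: Linf_def)
  obtain C where "AE x in lborel. \<bar>f x\<bar> \<le> C" using assms by (auto simp: Linf_def)
  then have "AE x in lborel. \<bar>f x\<bar> \<le> max 0 C" by (auto elim: eventually_mono)
  then show "\<exists>M\<ge>0. AE x in lborel. \<bar>f x\<bar> \<le> M" by (intro exI[of _ "max 0 C"]) auto
qed

text \<open>\<open>M\<close> may depend on the coefficients in any way, since the bound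
  \<open>R\<close> of \<open>energy_estimate\<close> does not contain it; the sum of six separate
  bounds will do.\<close>

lemma common_bound_form_coeffs:
  fixes a b c a' b' c' :: "'a::euclidean_space \<Rightarrow> real"
  assumes s: "0 < s" "s < 1" and L: "a \<in> elts Linf" "b \<in> elts Linf" "c \<in> elts Linf"
    "a' \<in> elts Linf" "b' \<in> elts Linf" "c' \<in> elts Linf"
  obtains M where "form_coeffs s M a b c" "form_coeffs s M a' b' c'"
proof -
  obtain Ma Mb Mc Ma' Mb' Mc' where M: "0 \<le> Ma" "0 \<le> Mb" "0 \<le> Mc" "0 \<le> Ma'" "0 \<le> Mb'" "0 \<le> Mc'"
     "AE x in lborel. \<bar>a x\<bar> \<le> Ma" "AE x in lborel. \<bar>b x\<bar> \<le> Mb" "AE x in lborel. \<bar>c x\<bar> \<le> Mc"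
     "AE x in lborel. \<bar>a' x\<bar> \<le> Ma'" "AE x in lborel. \<bar>b' x\<bar> \<le> Mb'" "AE x in lborel. \<bar>c' x\<bar> \<le> Mc'"
    using L[THEN Linf_bounded(2)] by metis
  let ?M = "Ma + Mb + Mc + Ma' + Mb' + Mc'"
  have b: "bounded_coeff ?M f" if "f \<in> elts Linf" "AE x in lborel. \<bar>f x\<bar> \<le> C" "C \<le> ?M" for f C
    using that M(1-6) Linf_bounded(1)[OF that(1)]
    by (auto simp: bounded_coeff_def elim!: eventually_mono)
  have "form_coeffs s ?M a b c" "form_coeffs s ?M a' b' c'"
    unfolding form_coeffs_def using s M
    by (auto intro!: b[OF L(1)] b[OF L(2)] b[OF L(3)] b[OF L(4)] b[OF L(5)] b[OF L(6)])
  then show ?thesis by (rule that)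
qed

theorem theorem4p2:
  fixes T s a0 b0 c0 :: real
    and \<omega> :: "real \<Rightarrow> real"
    and u0 :: "('a::euclidean_space \<Rightarrow> complex) \<Rightarrow> complex"
    and a b c :: "('a \<Rightarrow> real) \<Rightarrow> real"
    and a\<epsilon> b\<epsilon> c\<epsilon> a\<epsilon>' b\<epsilon>' c\<epsilon>' :: "real \<Rightarrow> 'a \<Rightarrow> real"
    and u0\<epsilon> u0\<epsilon>' :: "real \<Rightarrow> 'a \<Rightarrow> complex"
    and u u' :: "real \<Rightarrow> real \<Rightarrow> 'a \<Rightarrow> complex"
  assumes "T > 0" and "0 < s" and "s < 1"
    and "compactly_supported_distribution u0"
    and "distribution a" and "distribution b" and "distribution c"
    and "a0 > 0" and "b0 > 0" and "c0 > 0"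
    and "distr_ge a a0" and "distr_ge b b0" and "distr_ge c c0"
    and "asymptotic_scale \<omega>"
    and "moderate_regularisation \<omega> Linf a a\<epsilon>" and "moderate_regularisation \<omega> Linf a a\<epsilon>'"
    and "moderate_regularisation \<omega> Linf b b\<epsilon>" and "moderate_regularisation \<omega> Linf b b\<epsilon>'"
    and "moderate_regularisation \<omega> Linf c c\<epsilon>" and "moderate_regularisation \<omega> Linf c c\<epsilon>'"
    and "negligible_net \<omega> Linf (\<lambda>\<epsilon>. a\<epsilon> \<epsilon> - a\<epsilon>' \<epsilon>)"
    and "negligible_net \<omega> Linf (\<lambda>\<epsilon>. b\<epsilon> \<epsilon> - b\<epsilon>' \<epsilon>)"
    and "negligible_net \<omega> Linf (\<lambda>\<epsilon>. c\<epsilon> \<epsilon> - c\<epsilon>' \<epsilon>)"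
    and "moderate_regularisation \<omega> H1 u0 u0\<epsilon>" and "moderate_regularisation \<omega> H1 u0 u0\<epsilon>'"
    and "negligible_net \<omega> H1 (\<lambda>\<epsilon>. u0\<epsilon> \<epsilon> - u0\<epsilon>' \<epsilon>)"
    and "\<And>\<epsilon>. \<epsilon> \<in> {0<..1} \<Longrightarrow> AE x in lborel. a\<epsilon> \<epsilon> x \<ge> a0 \<and> b\<epsilon> \<epsilon> x \<ge> b0 \<and> c\<epsilon> \<epsilon> x \<ge> c0"
    and "\<And>\<epsilon>. \<epsilon> \<in> {0<..1} \<Longrightarrow> AE x in lborel. a\<epsilon>' \<epsilon> x \<ge> a0 \<and> b\<epsilon>' \<epsilon> x \<ge> b0 \<and> c\<epsilon>' \<epsilon> x \<ge> c0"
    and "\<And>\<epsilon>. \<epsilon> \<in> {0<..1} \<Longrightarrow> weak_solution T s (a\<epsilon> \<epsilon>) (b\<epsilon> \<epsilon>) (c\<epsilon> \<epsilon>) (u0\<epsilon> \<epsilon>) (u \<epsilon>)"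
    and "\<And>\<epsilon>. \<epsilon> \<in> {0<..1} \<Longrightarrow> weak_solution T s (a\<epsilon>' \<epsilon>) (b\<epsilon>' \<epsilon>) (c\<epsilon>' \<epsilon>) (u0\<epsilon>' \<epsilon>) (u' \<epsilon>)"
    and "moderate \<omega> (Linf_time T H1) u" and "moderate \<omega> (Linf_time T H1) u'"
  shows "negligible_net \<omega> (inter_space (Linf_time T L2) (L2_time T H1)) (\<lambda>\<epsilon>. u \<epsilon> - u' \<epsilon>)"
proof -
  define K where "K = DIM('a) + ((1 + 2 * DIM('a)) * (2 * pi) ^ DIM('a))\<^sup>2 + 1"
  define m where "m = min a0 c0"
  have m: "0 < m" "m \<le> a0" "m \<le> c0" using \<open>0 < a0\<close> \<open>0 < c0\<close> by (auto simp: m_def)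
  have \<omega>: "0 < \<omega> \<epsilon>" if "\<epsilon> \<in> {0<..1}" for \<epsilon>
    using \<open>asymptotic_scale \<omega>\<close> that by (auto simp: asymptotic_scale_def)
  obtain Cu N where Cu: "0 < Cu" "\<And>\<epsilon>. \<epsilon> \<in> {0<..1} \<Longrightarrow> nrm (Linf_time T H1) (u' \<epsilon>) \<le> Cu * \<omega> \<epsilon> powi (- int N)"
    and uL: "\<And>\<epsilon>. \<epsilon> \<in> {0<..1} \<Longrightarrow> u' \<epsilon> \<in> elts (Linf_time T H1)"
    using \<open>moderate \<omega> (Linf_time T H1) u'\<close> unfolding moderate_def by blast
  have elts_coeff: "g \<epsilon> \<in> elts Linf" if "moderate_regularisation \<omega> Linf l g" "\<epsilon> \<in> {0<..1}"
    for g :: "real \<Rightarrow> 'a \<Rightarrow> real" and l \<epsilon>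
    using that by (simp add: moderate_regularisation_def moderate_def)
  have elts_init: "g \<epsilon> \<in> elts H1" if "moderate_regularisation \<omega> H1 l g" "\<epsilon> \<in> {0<..1}"
    for g :: "real \<Rightarrow> 'a \<Rightarrow> complex" and l \<epsilon>
    using that by (simp add: moderate_regularisation_def moderate_def)
  have uH: "u \<epsilon> \<in> elts (L2_time T H1)" "u' \<epsilon> \<in> elts (L2_time T H1)" if "\<epsilon> \<in> {0<..1}" for \<epsilon>
    using assms(29,30)[OF that] by (auto simp: weak_solution_def)
  define v where "v \<epsilon> t x = u \<epsilon> t x - u' \<epsilon> t x" for \<epsilon> t x
  have v: "(\<lambda>\<epsilon>. u \<epsilon> - u' \<epsilon>) = v" by (simp add: fun_eq_iff v_def)
  have vH: "v \<epsilon> \<in> elts (L2_time T H1)" if "\<epsilon> \<in> {0<..1}" for \<epsilon>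
    using L2_time_H1_diff[OF uH[OF that]] by (simp add: v_def[abs_def])
  have vm: "strongly_measurable (lebesgue_on {0<..<T}) L2 (v \<epsilon>)" if "\<epsilon> \<in> {0<..1}" for \<epsilon>
    using vH[OF that] by (auto simp: elts_L2_time intro: strongly_measurable_H1_L2)
  have vn: "(\<lambda>t. nrm L2 (v \<epsilon> t)) \<in> borel_measurable (lebesgue_on {0<..<T})" if "\<epsilon> \<in> {0<..1}" for \<epsilon>
    by (rule strongly_measurable_nrm_L2[OF _ vm[OF that]]) simp
  have key: "\<exists>C>0. \<forall>\<epsilon>\<in>{0<..1}. (AE t in lebesgue_on {0<..<T}. nrm L2 (v \<epsilon> t) \<le> C * \<omega> \<epsilon> ^ n) \<and>
      nrm (L2_time T H1) (v \<epsilon>) \<le> C * \<omega> \<epsilon> ^ n" for n :: nat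
  proof -
    \<comment> \<open>The coefficient differences are taken of order n + N: the extra
      \<open>N\<close> powers of the scale pay for the growth of order \<open>N\<close> of the
      second solution.\<close>
    obtain Ca where Ca: "0 < Ca" "\<And>\<epsilon>. \<epsilon> \<in> {0<..1} \<Longrightarrow> nrm Linf (a\<epsilon> \<epsilon> - a\<epsilon>' \<epsilon>) \<le> Ca * \<omega> \<epsilon> ^ (n + N)"
        "\<And>\<epsilon>. \<epsilon> \<in> {0<..1} \<Longrightarrow> a\<epsilon> \<epsilon> - a\<epsilon>' \<epsilon> \<in> elts Linf"
      using assms(21) unfolding negligible_net_def by blast
    obtain Cb where Cb: "0 < Cb" "\<And>\<epsilon>. \<epsilon> \<in> {0<..1} \<Longrightarrow> nrm Linf (b\<epsilon> \<epsilon> - b\<epsilon>' \<epsilon>) \<le> Cb * \<omega> \<epsilon> ^ (n + N)"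
        "\<And>\<epsilon>. \<epsilon> \<in> {0<..1} \<Longrightarrow> b\<epsilon> \<epsilon> - b\<epsilon>' \<epsilon> \<in> elts Linf"
      using assms(22) unfolding negligible_net_def by blast
    obtain Cc where Cc: "0 < Cc" "\<And>\<epsilon>. \<epsilon> \<in> {0<..1} \<Longrightarrow> nrm Linf (c\<epsilon> \<epsilon> - c\<epsilon>' \<epsilon>) \<le> Cc * \<omega> \<epsilon> ^ (n + N)"
        "\<And>\<epsilon>. \<epsilon> \<in> {0<..1} \<Longrightarrow> c\<epsilon> \<epsilon> - c\<epsilon>' \<epsilon> \<in> elts Linf"
      using assms(23) unfolding negligible_net_def by blast
    obtain C0 where C0: "0 < C0" "\<And>\<epsilon>. \<epsilon> \<in> {0<..1} \<Longrightarrow> nrm H1 (u0\<epsilon> \<epsilon> - u0\<epsilon>' \<epsilon>) \<le> C0 * \<omega> \<epsilon> ^ n"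
      using assms(26) unfolding negligible_net_def by blast
    define Cd where "Cd = Ca + Cb + Cc"
    \<comment> \<open>\<open>B\<close> is \<open>R\<close> with the powers of the scale taken out:
      \<open>C0\<close> comes from the initial data, \<open>Cd\<close> from the three coefficient
      differences, and \<open>T * Cu^2\<close> from integrating the essential bound of the second
      solution over (0,T).\<close>
    define B where "B = C0\<^sup>2 + (Cd * K)\<^sup>2 / m * (T * Cu\<^sup>2)"
    have B: "0 < B" unfolding B_def using C0(1) m \<open>0 < T\<close> by (intro add_pos_nonneg) auto
    \<comment> \<open>The L2 norm is bounded by sqrt R and the norm in L2(0,T;H1) by sqrt (R/m); the
      maximum serves both.\<close>
    define C where "C = max (sqrt B) (sqrt (B / m))"
    have C: "0 < C" "sqrt B \<le> C" "sqrt (B / m) \<le> C" unfolding C_def using B by (auto simp: less_max_iff_disj)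
    have "(AE t in lebesgue_on {0<..<T}. nrm L2 (v \<epsilon> t) \<le> C * \<omega> \<epsilon> ^ n) \<and> nrm (L2_time T H1) (v \<epsilon>) \<le> C * \<omega> \<epsilon> ^ n"
      if \<epsilon>: "\<epsilon> \<in> {0<..1}" for \<epsilon>
    proof -
      let ?o = "\<omega> \<epsilon>"
      define \<delta> where "\<delta> = Cd * ?o ^ (n + N)"
      have o: "0 < ?o" by (rule \<omega>[OF \<epsilon>])
      have \<delta>0: "0 \<le> \<delta>" unfolding \<delta>_def Cd_def using Ca(1) Cb(1) Cc(1) o by auto
      obtain M where A: "form_coeffs s M (a\<epsilon> \<epsilon>) (b\<epsilon> \<epsilon>) (c\<epsilon> \<epsilon>)" and A': "form_coeffs s M (a\<epsilon>' \<epsilon>) (b\<epsilon>' \<epsilon>) (c\<epsilon>' \<epsilon>)"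
        using common_bound_form_coeffs[OF assms(2,3) elts_coeff[OF assms(15) \<epsilon>] elts_coeff[OF assms(17) \<epsilon>] elts_coeff[OF assms(19) \<epsilon>]
            elts_coeff[OF assms(16) \<epsilon>] elts_coeff[OF assms(18) \<epsilon>] elts_coeff[OF assms(20) \<epsilon>]] .
      have d: "AE x in lborel. \<bar>f x\<bar> \<le> \<delta>"
        if "f \<in> elts Linf" "nrm Linf f \<le> C' * ?o ^ (n + N)" "C' \<le> Cd" for f :: "'a \<Rightarrow> real" and C'
      proof -
        have "nrm Linf f \<le> \<delta>" unfolding \<delta>_def
          by (rule order_trans[OF that(2)]) (use that(3) o in \<open>auto intro: mult_right_mono\<close>)
        then show ?thesis using Linf_AE_bound[OF that(1)] by (auto elim: eventually_mono)
      qed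
      have le: "Ca \<le> Cd" "Cb \<le> Cd" "Cc \<le> Cd" using Ca(1) Cb(1) Cc(1) by (auto simp: Cd_def)
      have D: "form_coeffs s \<delta> (\<lambda>x. a\<epsilon> \<epsilon> x - a\<epsilon>' \<epsilon> x) (\<lambda>x. b\<epsilon> \<epsilon> x - b\<epsilon>' \<epsilon> x) (\<lambda>x. c\<epsilon> \<epsilon> x - c\<epsilon>' \<epsilon> x)"
        using d[OF Ca(3)[OF \<epsilon>] Ca(2)[OF \<epsilon>] le(1)] d[OF Cb(3)[OF \<epsilon>] Cb(2)[OF \<epsilon>] le(2)] d[OF Cc(3)[OF \<epsilon>] Cc(2)[OF \<epsilon>] le(3)]
        by (intro form_coeffs_diff[OF A A' \<delta>0]) auto
      have ge: "AE x in lborel. m \<le> a\<epsilon> \<epsilon> x" "AE x in lborel. 0 \<le> b\<epsilon> \<epsilon> x" "AE x in lborel. m \<le> c\<epsilon> \<epsilon> x"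
        by (rule eventually_mono[OF assms(27)[OF \<epsilon>]], use m(2,3) \<open>0 < b0\<close> in simp)+
      have i: "u0\<epsilon> \<epsilon> \<in> elts H1" "u0\<epsilon>' \<epsilon> \<in> elts H1"
        using elts_init[OF assms(24) \<epsilon>] elts_init[OF assms(25) \<epsilon>] by auto
      define R where "R = (nrm L2 (\<lambda>x. u0\<epsilon> \<epsilon> x - u0\<epsilon>' \<epsilon> x))\<^sup>2 + (\<delta> * K)\<^sup>2 / m * (LINT t|lebesgue_on {0<..<T}. (nrm H1 (u' \<epsilon> t))\<^sup>2)"
      have E: "AE t in lebesgue_on {0<..<T}. (nrm L2 (v \<epsilon> t))\<^sup>2 \<le> R"
        "m * (LINT t|lebesgue_on {0<..<T}. (nrm H1 (v \<epsilon> t))\<^sup>2) \<le> R"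
        using energy_estimate[OF \<open>0 < T\<close> m(1) A A' D ge assms(29)[OF \<epsilon>] assms(30)[OF \<epsilon>] H1_L2[OF i(1)] H1_L2[OF i(2)]]
        by (simp_all add: R_def K_def v_def[abs_def])
      have "R \<le> B * (?o ^ n)\<^sup>2"
      proof -
        have "(nrm L2 (\<lambda>x. u0\<epsilon> \<epsilon> x - u0\<epsilon>' \<epsilon> x))\<^sup>2 \<le> (C0 * ?o ^ n)\<^sup>2"
          using order_trans[OF nrm_L2_le_H1 C0(2)[OF \<epsilon>]] by (intro power_mono) (auto simp: fun_diff_def)
        moreover have "(LINT t|lebesgue_on {0<..<T}. (nrm H1 (u' \<epsilon> t))\<^sup>2) \<le> T * (Cu\<^sup>2 * (inverse (?o ^ N))\<^sup>2)"
        proof -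
          interpret finite_measure "lebesgue_on {0<..<T}" by (rule finite_measure_lebesgue_on_interval)
          have "(\<lambda>t. nrm H1 (u' \<epsilon> t)) \<in> borel_measurable (lebesgue_on {0<..<T})"
            using uH(2)[OF \<epsilon>] by (auto simp: elts_L2_time intro!: strongly_measurable_nrm_H1)
          from Linf_time_AE_bound[OF uL[OF \<epsilon>] this]
          have ae: "AE t in lebesgue_on {0<..<T}. (nrm H1 (u' \<epsilon> t))\<^sup>2 \<le> Cu\<^sup>2 * (inverse (?o ^ N))\<^sup>2"
          proof eventually_elim
            fix t assume "nrm H1 (u' \<epsilon> t) \<le> nrm (Linf_time T H1) (u' \<epsilon>)"
            then have "nrm H1 (u' \<epsilon> t) \<le> Cu * inverse (?o ^ N)"
              using Cu(2)[OF \<epsilon>] by (simp add: power_int_minus)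
            then have "(nrm H1 (u' \<epsilon> t))\<^sup>2 \<le> (Cu * inverse (?o ^ N))\<^sup>2" by (intro power_mono) auto
            then show "(nrm H1 (u' \<epsilon> t))\<^sup>2 \<le> Cu\<^sup>2 * (inverse (?o ^ N))\<^sup>2" by (simp only: power_mult_distrib)
          qed
          have "(LINT t|lebesgue_on {0<..<T}. (nrm H1 (u' \<epsilon> t))\<^sup>2) \<le> (LINT t|lebesgue_on {0<..<T}. Cu\<^sup>2 * (inverse (?o ^ N))\<^sup>2)"
            using uH(2)[OF \<epsilon>] ae by (intro integral_mono_AE) (auto simp: elts_L2_time)
          also have "\<dots> = T * (Cu\<^sup>2 * (inverse (?o ^ N))\<^sup>2)"
            using \<open>0 < T\<close> by (simp add: measure_restrict_space)
          finally show ?thesis .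
        qed
        then have "(\<delta> * K)\<^sup>2 / m * (LINT t|lebesgue_on {0<..<T}. (nrm H1 (u' \<epsilon> t))\<^sup>2) \<le> (\<delta> * K)\<^sup>2 / m * (T * (Cu\<^sup>2 * (inverse (?o ^ N))\<^sup>2))"
          using m by (intro mult_left_mono) auto
        moreover have "(\<delta> * K)\<^sup>2 / m * (T * (Cu\<^sup>2 * (inverse (?o ^ N))\<^sup>2)) = (Cd * K)\<^sup>2 / m * (T * Cu\<^sup>2) * (?o ^ n)\<^sup>2"
        proof -
          have "\<delta> * inverse (?o ^ N) = Cd * ?o ^ n" using o by (simp add: \<delta>_def power_add)
          then have "(\<delta> * inverse (?o ^ N))\<^sup>2 = (Cd * ?o ^ n)\<^sup>2" by simp
          then have "\<delta>\<^sup>2 * (inverse (?o ^ N))\<^sup>2 = Cd\<^sup>2 * (?o ^ n)\<^sup>2" by (simp only: power_mult_distrib)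
          moreover have "(x * K)\<^sup>2 / m * (T * (Cu\<^sup>2 * z)) = K\<^sup>2 / m * T * Cu\<^sup>2 * (x\<^sup>2 * z)"
            "(x * K)\<^sup>2 / m * (T * Cu\<^sup>2) * z = K\<^sup>2 / m * T * Cu\<^sup>2 * (x\<^sup>2 * z)" for x z
            by (simp_all add: power_mult_distrib)
          ultimately show ?thesis by (simp only:)
        qed
        moreover have "B * (?o ^ n)\<^sup>2 = (C0 * ?o ^ n)\<^sup>2 + (Cd * K)\<^sup>2 / m * (T * Cu\<^sup>2) * (?o ^ n)\<^sup>2"
          unfolding B_def power_mult_distrib[of C0] by (rule distrib_right)
        ultimately show ?thesis unfolding R_def by linarith
      qed
      then have sR: "sqrt R \<le> sqrt B * ?o ^ n"
        using real_sqrt_le_mono[of R "B * (?o ^ n)\<^sup>2"] o by (simp add: real_sqrt_mult)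
      have on: "0 \<le> ?o ^ n" using o by simp
      have "AE t in lebesgue_on {0<..<T}. nrm L2 (v \<epsilon> t) \<le> C * ?o ^ n"
        using E(1)
      proof eventually_elim
        fix t assume "(nrm L2 (v \<epsilon> t))\<^sup>2 \<le> R"
        then have "nrm L2 (v \<epsilon> t) \<le> sqrt R" by (rule real_le_rsqrt)
        also have "\<dots> \<le> C * ?o ^ n" using sR mult_right_mono[OF C(2) on] by linarith
        finally show "nrm L2 (v \<epsilon> t) \<le> C * ?o ^ n" .
      qed
      moreover have "nrm (L2_time T H1) (v \<epsilon>) \<le> C * ?o ^ n"
      proof -
        have "(LINT t|lebesgue_on {0<..<T}. (nrm H1 (v \<epsilon> t))\<^sup>2) \<le> B / m * (?o ^ n)\<^sup>2"
          using E(2) \<open>R \<le> B * (?o ^ n)\<^sup>2\<close> m(1) by (simp add: field_simps)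
        from real_sqrt_le_mono[OF this]
        have "nrm (L2_time T H1) (v \<epsilon>) \<le> sqrt (B / m * (?o ^ n)\<^sup>2)"
          by (simp add: L2_time_def)
        also have "\<dots> = sqrt (B / m) * ?o ^ n"
          by (simp only: real_sqrt_mult real_sqrt_abs abs_of_nonneg[OF on])
        also have "\<dots> \<le> C * ?o ^ n" by (rule mult_right_mono[OF C(3) on])
        finally show ?thesis .
      qed
      ultimately show ?thesis by blast
    qed
    then show ?thesis using C(1) by blast
  qed
  show ?thesis
    unfolding v negligible_net_def
  proof (intro conjI ballI allI)
    fix \<epsilon> :: real assume \<epsilon>: "\<epsilon> \<in> {0<..1}"
    \<comment> \<open>Order 0 already supplies the essential bound needed for membership in the
      space.\<close>
    obtain C where "AE t in lebesgue_on {0<..<T}. nrm L2 (v \<epsilon> t) \<le> C * \<omega> \<epsilon> ^ 0"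
      using key[of 0] \<epsilon> by blast
    then show "v \<epsilon> \<in> elts (inter_space (Linf_time T L2) (L2_time T H1))"
      using vH[OF \<epsilon>] vm[OF \<epsilon>] by (auto simp: inter_space_def Linf_time_def)
  next
    fix n :: nat
    obtain C where C: "0 < C" "\<And>\<epsilon>. \<epsilon> \<in> {0<..1} \<Longrightarrow> AE t in lebesgue_on {0<..<T}. nrm L2 (v \<epsilon> t) \<le> C * \<omega> \<epsilon> ^ n"
      "\<And>\<epsilon>. \<epsilon> \<in> {0<..1} \<Longrightarrow> nrm (L2_time T H1) (v \<epsilon>) \<le> C * \<omega> \<epsilon> ^ n"
      using key[of n] by blast
    \<comment> \<open>The intersection carries the sum of two norms, hence the factor 2.\<close>
    have "nrm (inter_space (Linf_time T L2) (L2_time T H1)) (v \<epsilon>) \<le> (2 * C) * \<omega> \<epsilon> ^ n" if \<epsilon>: "\<epsilon> \<in> {0<..1}" for \<epsilon>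
    proof -
      have "nrm (Linf_time T L2) (v \<epsilon>) \<le> C * \<omega> \<epsilon> ^ n"
        by (rule nrm_Linf_time_le[OF vn[OF \<epsilon>] C(2)[OF \<epsilon>]]) (use C(1) \<omega>[OF \<epsilon>] in auto)
      then show ?thesis using C(3)[OF \<epsilon>] by (simp add: inter_space_def)
    qed
    then show "\<exists>C>0. \<forall>\<epsilon>\<in>{0<..1}. nrm (inter_space (Linf_time T L2) (L2_time T H1)) (v \<epsilon>) \<le> C * \<omega> \<epsilon> ^ n"
      using C(1) by (intro exI[of _ "2 * C"]) auto
  qed
qed

end
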